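(* Let $\sigma,\gamma>0$, $m_\alpha,m_\beta>0$, $\mathbf{a},\mathbf{b}\in\mathbb{R}^d$, $\mathbf{A},\mathbf{B}\in\mathcal{S}^d_{++}$, and let $\alpha=m_\alpha\mathcal{N}(\mathbf{a},\mathbf{A})$ and $\beta=m_\beta\mathcal{N}(\mathbf{b},\mathbf{B})$ be two unbalanced Gaussian measures on $\mathbb{R}^d$. Let $\tau=\frac{\gamma}{2\sigma^2+\gamma}$, $\lambda=\frac{\sigma^2}{1-\tau}=\sigma^2+\frac{\gamma}{2}$, and $$\mathbf{X}=\mathbf{A}+\mathbf{B}+\lambda\mathrm{Id},\quad \widetilde{\mathbf{A}}=\tfrac{\gamma}{2}(\mathrm{Id}-\lambda(\mathbf{A}+\lambda\mathrm{Id})^{-1}),\quad \widetilde{\mathbf{B}}=\tfrac{\gamma}{2}(\mathrm{Id}-\lambda(\mathbf{B}+\lambda\mathrm{Id})^{-1}),\quad \mathbf{C}=\Big(\tfrac1\tau\widetilde{\mathbf{A}}\widetilde{\mathbf{B}}+\tfrac{\sigma^4}{4}\mathrm{Id}\Big)^{1/2}-\tfrac{\sigma^2}{2}\mathrm{Id}.$$ Define $$\mu=\begin{pmatrix}\mathbf{a}+\mathbf{A}\mathbf{X}^{-1}(\mathbf{b}-\mathbf{a})\\ \mathbf{b}+\mathbf{B}\mathbf{X}^{-1}(\mathbf{a}-\mathbf{b})\end{pmatrix},$$ $$\mathbf{H}=\begin{pmatrix}(\mathrm{Id}+\frac1\lambda\mathbf{C})(\mathbf{A}-\mathbf{A}\mathbf{X}^{-1}\mathbf{A})&\mathbf{C}+(\mathrm{Id}+\frac1\lambda\mathbf{C})\mathbf{A}\mathbf{X}^{-1}\mathbf{B}\\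 \mathbf{C}^\top+(\mathrm{Id}+\frac1\lambda\mathbf{C}^\top)\mathbf{B}\mathbf{X}^{-1}\mathbf{A}&(\mathrm{Id}+\frac1\lambda\mathbf{C}^\top)(\mathbf{B}-\mathbf{B}\mathbf{X}^{-1}\mathbf{B})\end{pmatrix},$$ $$m_\pi=\sigma^{\frac{d\sigma^2}{\gamma+\sigma^2}}\left(m_\alpha m_\beta\det(\mathbf{C})\sqrt{\frac{\det(\widetilde{\mathbf{A}}\widetilde{\mathbf{B}})^\tau}{\det(\mathbf{A}\mathbf{B})}}\right)^{\frac{1}{\tau+1}}\frac{e^{-\frac{(\mathbf{a}-\mathbf{b})^\top\mathbf{X}^{-1}(\mathbf{a}-\mathbf{b})}{2(\tau+1)}}}{\sqrt{\det\big(\mathbf{C}-\frac2\gamma\widetilde{\mathbf{A}}\widetilde{\mathbf{B}}\big)}}.$$ Then: (i) the unbalanced optimal transport plan, i.e. the minimizer in the definition of $\mathrm{UOT}_\sigma(\alpha,\beta)$, is the unbalanced Gaussian measure $\pi=m_\pi\,\mathcal{N}(\mu,\mathbf{H})$ on $\mathbb{R}^d\times\mathbb{R}^d$; (ii) $\mathrm{UOT}_\sigma(\alpha,\beta)=\gamma(m_\alpha+m_\beta)+2\sigma^2m_\alpha m_\beta-2(\sigma^2+\gamma)m_\pi$.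
   Context: $\mathcal{S}^d_{++}$ is the set of symmetric positive definite $d\times d$ real matrices; $m\,\mathcal{N}(\mathbf{a},\mathbf{A})$ is the Gaussian probability measure with mean $\mathbf{a}$ and covariance $\mathbf{A}$ multiplied by $m>0$. $\mathcal{M}^+_2$ denotes non-negative finite measures with finite second moment. The square root of a (not necessarily symmetric) matrix with positive real eigenvalues, such as $\frac1\tau\widetilde{\mathbf{A}}\widetilde{\mathbf{B}}+\frac{\sigma^4}{4}\mathrm{Id}$, is the principal one (the unique square root with positive eigenvalues). For non-negative measures, $\mathrm{KL}(\nu\|\rho)=\int(r\log r-r+1)\,d\rho$ with $r=\frac{d\nu}{d\rho}$ if $\nu\ll\rho$, and $+\infty$ otherwise ($0\log0=0$). For $\alpha,\beta\in\mathcal{M}_2^+(\mathbb{R}^d)$, $$\mathrm{UOT}_\sigma(\alpha,\beta)=\inf_{\pi\in\mathcal{M}^+_2(\mathbb{R}^d\times\mathbb{R}^d)}\int\|x-y\|^2\,d\pi(x,y)+2\sigma^2\,\mathrm{KL}(\pi\|\alpha\otimes\beta)+\gamma\,\mathrm{KL}(\pi_1\|\alpha)+\gamma\,\mathrm{KL}(\pi_2\|\beta),$$ where $\pi_1,\pi_2$ are the two marginals of $\pi$. *)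

theory Defs
  imports "HOL-Analysis.Analysis"
begin

definition sym_pos_def :: "real^'n^'n \<Rightarrow> bool" where
  "sym_pos_def A \<longleftrightarrow> transpose A = A \<and> (\<forall>x. x \<noteq> 0 \<longrightarrow> 0 < x \<bullet> (A *v x))"

text \<open>Eigenvalues of a real matrix are taken over the complex numbers, so that a real matrix all of
  whose eigenvalues are positive has no non-real ones.\<close>

definition eigenvalue_of :: "real^'n^'n \<Rightarrow> complex \<Rightarrow> bool" where
  "eigenvalue_of M z \<longleftrightarrow>
     (\<exists>v :: complex^'n. v \<noteq> 0 \<and> map_matrix complex_of_real M *v v = z *s v)"

text \<open>Meant for matrices all of whose eigenvalues are real and positive (not necessarily symmetric);
  such a matrix has exactly one square root of this kind.\<close>

definition principal_sqrt :: "real^'n^'n \<Rightarrow> real^'n^'n" where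
  "principal_sqrt M =
     (THE R. R ** R = M \<and> (\<forall>z. eigenvalue_of R z \<longrightarrow> z \<in> \<real> \<and> 0 < Re z))"

definition block_vec :: "real^'m \<Rightarrow> real^'n \<Rightarrow> real^('m::finite + 'n::finite)" where
  "block_vec u v = (\<chi> i. case i of Inl k \<Rightarrow> u $ k | Inr k \<Rightarrow> v $ k)"

definition block_mat ::
  "real^'m^'m \<Rightarrow> real^'n^'m \<Rightarrow> real^'m^'n \<Rightarrow> real^'n^'n
   \<Rightarrow> real^('m::finite + 'n::finite)^('m + 'n)" where
  "block_mat P Q R S = (\<chi> i j.
     case i of
       Inl k \<Rightarrow> (case j of Inl l \<Rightarrow> P $ k $ l | Inr l \<Rightarrow> Q $ k $ l)
     | Inr k \<Rightarrow> (case j of Inl l \<Rightarrow> R $ k $ l | Inr l \<Rightarrow> S $ k $ l))"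

definition split_vec :: "real^('m::finite + 'n::finite) \<Rightarrow> (real^'m) \<times> (real^'n)" where
  "split_vec z = ((\<chi> i. z $ Inl i), (\<chi> j. z $ Inr j))"

text \<open>Only meaningful when the covariance matrix \<open>A\<close> is symmetric positive definite.\<close>

definition gaussian :: "real^'n \<Rightarrow> real^'n^'n \<Rightarrow> (real^'n) measure" where
  "gaussian a A = density lborel (\<lambda>x. ennreal
     (exp (- ((x - a) \<bullet> (matrix_inv A *v (x - a))) / 2) / sqrt ((2 * pi) ^ CARD('n) * det A)))"

text \<open>The product space carries Gaussians through its identification with \<open>real^('m + 'n)\<close>.\<close>

definition gaussian_pair ::
  "real^('m::finite + 'n::finite) \<Rightarrow> real^('m + 'n)^('m + 'n) \<Rightarrow> ((real^'m) \<times> (real^'n)) measure" where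
  "gaussian_pair \<mu> H = distr (gaussian \<mu> H) borel split_vec"

definition finite_second_moment_measures :: "'a::euclidean_space measure set" where
  "finite_second_moment_measures =
     {M. sets M = sets borel \<and> finite_measure M \<and> integrable M (\<lambda>x. (norm x)\<^sup>2)}"

text \<open>Generalized Kullback--Leibler divergence of finite measures on the same sigma-algebra, not
  normalised to equal mass. The integrand is non-negative, so nothing is truncated by \<open>ennreal\<close>.\<close>

definition KL :: "'a measure \<Rightarrow> 'a measure \<Rightarrow> ennreal" where
  "KL \<nu> \<rho> =
     (if absolutely_continuous \<rho> \<nu>
      then \<integral>\<^sup>+ x. (let r = enn2real (RN_deriv \<rho> \<nu> x) in ennreal (r * ln r - r + 1)) \<partial>\<rho>
      else \<infinity>)"

definition UOT_cost ::
  "real \<Rightarrow> real \<Rightarrow> 'a::euclidean_space measure \<Rightarrow> 'a measure \<Rightarrow> ('a \<times> 'a) measure \<Rightarrow> ennreal" where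
  "UOT_cost \<sigma> \<gamma> \<alpha> \<beta> \<pi> =
     (\<integral>\<^sup>+ (x, y). ennreal ((norm (x - y))\<^sup>2) \<partial>\<pi>)
     + ennreal (2 * \<sigma>\<^sup>2) * KL \<pi> (\<alpha> \<Otimes>\<^sub>M \<beta>)
     + ennreal \<gamma> * KL (distr \<pi> borel fst) \<alpha>
     + ennreal \<gamma> * KL (distr \<pi> borel snd) \<beta>"

definition UOT ::
  "real \<Rightarrow> real \<Rightarrow> 'a::euclidean_space measure \<Rightarrow> 'a measure \<Rightarrow> ennreal" where
  "UOT \<sigma> \<gamma> \<alpha> \<beta> = (INF \<pi> \<in> finite_second_moment_measures. UOT_cost \<sigma> \<gamma> \<alpha> \<beta> \<pi>)"

definition UOT_plans ::
  "real \<Rightarrow> real \<Rightarrow> 'a::euclidean_space measure \<Rightarrow> 'a measure \<Rightarrow> ('a \<times> 'a) measure set" where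
  "UOT_plans \<sigma> \<gamma> \<alpha> \<beta> =
     {\<pi>. is_arg_min (UOT_cost \<sigma> \<gamma> \<alpha> \<beta>) (\<lambda>\<pi>. \<pi> \<in> finite_second_moment_measures) \<pi>}"

end

theory Submission
  imports Defs "HOL-Probability.Distributions"
begin

text \<open>
  \<^bold>\<open>Optimality by duality.\<close>  For finite measures and a function \<open>l\<close> such that \<open>l\<close> is integrable
  with respect to \<open>\<nu>\<close> and \<open>exp l\<close> with respect to \<open>\<rho>\<close>, Young's inequality \<open>t ln t - t \<ge> t l - exp l\<close> gives
  \<open>KL(\<nu>|\<rho>) \<ge> \<integral>l d\<nu> - \<integral>exp l d\<rho> + |\<rho>|\<close>, with equality exactly when \<open>\<nu>\<close> has density \<open>exp l\<close>.  Suppose that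
  \<open>\<pi>\<close> has density \<open>exp l\<close> with respect to \<open>\<alpha> \<otimes> \<beta>\<close>, that its marginals have densities \<open>exp f\<close> and
  \<open>exp g\<close> with respect to \<open>\<alpha>\<close> and \<open>\<beta>\<close>, and that
  \<open>|x - y|\<^sup>2 + 2 \<sigma>\<^sup>2 l(x,y) + \<gamma> f(x) + \<gamma> g(y) = 0\<close> everywhere.  Adding up the three inequalities bounds the
  cost of every competitor from below by a constant that depends only on the masses, and \<open>\<pi>\<close> is the
  only measure that attains it (lemma \<open>UOT_optimality\<close>).  The lemma also yields the optimal value.

  \<^bold>\<open>The Gaussian plan satisfies the criterion.\<close>  For Gaussian data \<open>l\<close>, \<open>f\<close>, \<open>g\<close> are quadratic, so
  the pointwise equation is a matter of comparing quadratic, linear and constant terms.  Write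
  \<open>s = \<sigma>\<^sup>2\<close>, \<open>w = \<gamma>/2\<close>, so that \<open>lam = s + w\<close> and \<open>\<tau> = w/lam\<close>.  The inverse of \<open>At\<close> is
  \<open>(1 + lam A\<^sup>-\<^sup>1)/w\<close>, and \<open>At\<^sup>-\<^sup>1\<close>, \<open>Bt\<close> are
  simultaneously diagonalised by a congruence \<open>V\<close>: \<open>At = V V\<^sup>T\<close> and \<open>Bt = U\<^sup>T D U\<close> with
  \<open>U = V\<^sup>-\<^sup>1\<close>.  Then \<open>C = V \<Delta> U\<close> with \<open>D = \<tau> \<Delta> (\<Delta> + s)\<close> and \<open>0 < \<Delta> < w\<close>, and the
  matrices \<open>At\<close>, \<open>Bt\<close>, \<open>C\<close> and all blocks of \<open>H\<close> are diagonal matrices between two of \<open>V\<close>, \<open>U\<close> and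
  their transposes.  In these coordinates (lemma \<open>plan_precision\<close>) one reads off that
  \<open>H\<^sup>-\<^sup>1\<close> has off-diagonal blocks \<open>- 1/s\<close>, so the mixed term of \<open>2 s l\<close> cancels that of
  \<open>|x - y|\<^sup>2\<close>, and diagonal blocks \<open>P\<close>, \<open>S\<close> with \<open>lam A\<^sup>-\<^sup>1 + 1 = s P + w L1\<close>,
  where \<open>L1\<close> is the inverse covariance of the first marginal (and likewise for \<open>B\<close>, \<open>S\<close>, \<open>L2\<close>).  The choice
  of \<open>\<mu>\<close> removes the linear terms, and the choice of the mass removes the constant
  (lemmas \<open>plan_quadratic_identity\<close> and \<open>log_mass_identity\<close>).

  The determinant of \<open>H\<close> is not computed from its blocks: integrating the Gaussian density over one of the two
  variables shows \<open>det H det L1 det S = 1\<close> (lemma \<open>gaussian_pair_precision\<close>).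
\<close>

section \<open>Dual bound for the divergence and the optimality criterion\<close>

text \<open>Young's inequality for \<open>t ln t - t\<close> and its conjugate \<open>exp\<close>, with the equality case.  At
  \<open>t = 0\<close> it relies on \<open>0 * ln 0 = 0\<close>.\<close>

lemma entropy_fenchel_young:
  fixes t l :: real
  assumes "0 \<le> t"
  shows "0 \<le> t * ln t - t - t * l + exp l"
    and "t * ln t - t - t * l + exp l = 0 \<Longrightarrow> t = exp l"
proof -
  have eq: "t * ln t - t - t * l + exp l = t * (exp l / t - 1 - ln (exp l / t))" if "t > 0"
    using that by (simp add: ln_div algebra_simps)
  have le: "ln (exp l / t) \<le> exp l / t - 1" if "t > 0"
    using that by (intro ln_le_minus_one) simp
  show "0 \<le> t * ln t - t - t * l + exp l"
    using assms eq le by (cases "t = 0") auto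
  assume 0: "t * ln t - t - t * l + exp l = 0"
  then have "t > 0" using assms by (cases "t = 0") auto
  then have "ln (exp l / t) = exp l / t - 1" using eq 0 by simp
  with \<open>t > 0\<close> have "exp l / t = 1" by (intro ln_eq_minus_one) auto
  with \<open>t > 0\<close> show "t = exp l" by simp
qed

text \<open>The dual bound for the divergence, and the fact that it is attained only by the measure with
  density \<open>exp l\<close>.\<close>

lemma KL_lower_bound:
  fixes \<nu> \<rho> :: "'a measure" and l :: "'a \<Rightarrow> real"
  assumes "finite_measure \<rho>" "finite_measure \<nu>" and sets: "sets \<nu> = sets \<rho>"
    and l[measurable]: "l \<in> borel_measurable \<rho>"
    and int: "integrable \<nu> l" and expint: "integrable \<rho> (\<lambda>x. exp (l x))"
    and fin: "KL \<nu> \<rho> \<noteq> \<infinity>"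
  shows "(\<integral>x. l x \<partial>\<nu>) - (\<integral>x. exp (l x) \<partial>\<rho>) + measure \<rho> (space \<rho>) \<le> enn2real (KL \<nu> \<rho>)" (is "?lb \<le> _")
    and "enn2real (KL \<nu> \<rho>) = (\<integral>x. l x \<partial>\<nu>) - (\<integral>x. exp (l x) \<partial>\<rho>) + measure \<rho> (space \<rho>)
      \<Longrightarrow> \<nu> = density \<rho> (\<lambda>x. ennreal (exp (l x)))"
proof -
  interpret \<rho>: finite_measure \<rho> by fact
  interpret \<nu>: finite_measure \<nu> by fact
  have ac: "absolutely_continuous \<rho> \<nu>" using fin by (auto simp: KL_def split: if_splits)
  define r where "r x = enn2real (RN_deriv \<rho> \<nu> x)" for x
  have r[measurable]: "r \<in> borel_measurable \<rho>" unfolding r_def by measurable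
  have r0: "0 \<le> r x" for x by (simp add: r_def)
  have "AE x in \<rho>. RN_deriv \<rho> \<nu> x \<noteq> \<infinity>"
    using \<nu>.sigma_finite_measure_axioms ac sets by (intro \<rho>.RN_deriv_finite) auto
  then have "AE x in \<rho>. RN_deriv \<rho> \<nu> x = ennreal (r x)"
    by eventually_elim (auto simp: r_def top.not_eq_extremum)
  then have "density \<rho> (RN_deriv \<rho> \<nu>) = density \<rho> (\<lambda>x. ennreal (r x))"
    by (intro density_cong) auto
  then have nu: "\<nu> = density \<rho> (\<lambda>x. ennreal (r x))"
    using \<rho>.density_RN_deriv[OF ac] sets by simp
  have rl: "integrable \<rho> (\<lambda>x. r x * l x)" "(\<integral>x. l x \<partial>\<nu>) = (\<integral>x. r x * l x \<partial>\<rho>)"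
    using int r0 unfolding nu by (auto simp: integrable_density integral_density)
  define h where "h x = r x * ln (r x) - r x + 1" for x
  have h0: "0 \<le> h x" for x
    using entropy_fenchel_young(1)[of "r x" 0] r0 by (simp add: h_def)
  have KL: "KL \<nu> \<rho> = (\<integral>\<^sup>+ x. ennreal (h x) \<partial>\<rho>)"
    using ac by (simp add: KL_def h_def r_def Let_def)
  have hm[measurable]: "h \<in> borel_measurable \<rho>" unfolding h_def by measurable
  have hint: "integrable \<rho> h"
    using fin h0 unfolding KL by (intro integrableI_nonneg) (auto simp: top.not_eq_extremum)
  have KL_eq: "enn2real (KL \<nu> \<rho>) = (\<integral>x. h x \<partial>\<rho>)"
    unfolding KL using hint h0 by (subst nn_integral_eq_integral) (auto intro: integral_nonneg_AE)
  define g where "g x = h x - r x * l x + exp (l x) - 1" for x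
  have g: "g x = r x * ln (r x) - r x - r x * l x + exp (l x)" for x by (simp add: g_def h_def)
  have g0: "0 \<le> g x" for x unfolding g using r0 by (rule entropy_fenchel_young)
  have gint: "integrable \<rho> g" unfolding g_def using hint rl expint by auto
  have "(\<integral>x. g x \<partial>\<rho>) = (\<integral>x. h x \<partial>\<rho>) - (\<integral>x. r x * l x \<partial>\<rho>) + (\<integral>x. exp (l x) \<partial>\<rho>) - measure \<rho> (space \<rho>)"
    unfolding g_def using hint rl expint by simp
  then have eq: "enn2real (KL \<nu> \<rho>) = ?lb + (\<integral>x. g x \<partial>\<rho>)" by (simp add: KL_eq rl)
  moreover have "0 \<le> (\<integral>x. g x \<partial>\<rho>)" using g0 by simp
  ultimately show "?lb \<le> enn2real (KL \<nu> \<rho>)" by simp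
  assume "enn2real (KL \<nu> \<rho>) = ?lb"
  then have "(\<integral>x. g x \<partial>\<rho>) = 0" using eq by simp
  then have "AE x in \<rho>. g x = 0"
    using gint g0 by (subst (asm) integral_nonneg_eq_0_iff_AE) auto
  then have "AE x in \<rho>. r x = exp (l x)"
    by eventually_elim (use r0 entropy_fenchel_young(2) g in auto)
  then show "\<nu> = density \<rho> (\<lambda>x. ennreal (exp (l x)))"
    unfolding nu by (intro density_cong) auto
qed

text \<open>Conversely, the measure with density \<open>exp l\<close> attains the dual bound.\<close>

lemma KL_exp_density:
  fixes \<rho> :: "'a measure" and l :: "'a \<Rightarrow> real"
  defines "\<nu> \<equiv> density \<rho> (\<lambda>x. ennreal (exp (l x)))"
  assumes "finite_measure \<rho>" and l[measurable]: "l \<in> borel_measurable \<rho>"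
    and int: "integrable \<nu> l" and expint: "integrable \<rho> (\<lambda>x. exp (l x))"
  shows "KL \<nu> \<rho> = ennreal ((\<integral>x. l x \<partial>\<nu>) - (\<integral>x. exp (l x) \<partial>\<rho>) + measure \<rho> (space \<rho>))"
    and "0 \<le> (\<integral>x. l x \<partial>\<nu>) - (\<integral>x. exp (l x) \<partial>\<rho>) + measure \<rho> (space \<rho>)"
proof -
  interpret \<rho>: finite_measure \<rho> by fact
  have ac: "absolutely_continuous \<rho> \<nu>" unfolding \<nu>_def by (rule absolutely_continuousI_density) auto
  have "AE x in \<rho>. ennreal (exp (l x)) = RN_deriv \<rho> \<nu> x"
    by (rule \<rho>.RN_deriv_unique) (auto simp: \<nu>_def)
  then have KL: "KL \<nu> \<rho> = (\<integral>\<^sup>+ x. ennreal (exp (l x) * l x - exp (l x) + 1) \<partial>\<rho>)"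
    using ac unfolding KL_def Let_def
    by (auto intro!: nn_integral_cong_AE elim!: eventually_mono) (metis enn2real_ennreal exp_ge_zero ln_exp)
  have el: "integrable \<rho> (\<lambda>x. exp (l x) * l x)" "(\<integral>x. l x \<partial>\<nu>) = (\<integral>x. exp (l x) * l x \<partial>\<rho>)"
    using int unfolding \<nu>_def by (auto simp: integrable_density integral_density)
  have nn: "0 \<le> exp (l x) * l x - exp (l x) + 1" for x
    using entropy_fenchel_young(1)[of "exp (l x)" 0] by simp
  have I: "(\<integral>x. exp (l x) * l x - exp (l x) + 1 \<partial>\<rho>) = (\<integral>x. l x \<partial>\<nu>) - (\<integral>x. exp (l x) \<partial>\<rho>) + measure \<rho> (space \<rho>)"
    using el expint by simp
  have "integrable \<rho> (\<lambda>x. exp (l x) * l x - exp (l x) + 1)" using el expint by simp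
  then show "KL \<nu> \<rho> = ennreal ((\<integral>x. l x \<partial>\<nu>) - (\<integral>x. exp (l x) \<partial>\<rho>) + measure \<rho> (space \<rho>))"
    unfolding KL using nn by (subst nn_integral_eq_integral) (auto simp: I)
  show "0 \<le> (\<integral>x. l x \<partial>\<nu>) - (\<integral>x. exp (l x) \<partial>\<rho>) + measure \<rho> (space \<rho>)"
    unfolding I[symmetric] using nn by simp
qed

text \<open>The optimality criterion: the density \<open>exp l\<close> of the plan is tied to the densities \<open>exp f\<close> and
  \<open>exp g\<close> of its marginals by \<open>|x - y|\<^sup>2 + 2 \<sigma>\<^sup>2 l(x,y) + \<gamma> f(x) + \<gamma> g(y) = 0\<close>.  Quadratic growth
  of \<open>f\<close> and \<open>g\<close> makes all integrals finite against measures with finite second moment.\<close>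

lemma UOT_optimality:
  fixes \<alpha> \<beta> :: "'a::euclidean_space measure" and \<pi> :: "('a \<times> 'a) measure"
    and f g :: "'a \<Rightarrow> real" and \<sigma> \<gamma> K :: real
  defines "l \<equiv> \<lambda>p. - ((norm (fst p - snd p))\<^sup>2 + \<gamma> * f (fst p) + \<gamma> * g (snd p)) / (2 * \<sigma>\<^sup>2)"
    and "val \<equiv> \<gamma> * (measure \<alpha> UNIV + measure \<beta> UNIV) + 2 * \<sigma>\<^sup>2 * (measure \<alpha> UNIV * measure \<beta> UNIV)
                - 2 * (\<sigma>\<^sup>2 + \<gamma>) * measure \<pi> UNIV"
  assumes \<sigma>: "\<sigma> > 0" and \<gamma>: "\<gamma> > 0"
    and "finite_measure \<alpha>" "finite_measure \<beta>"
    and sa[measurable_cong]: "sets \<alpha> = sets borel" and sb[measurable_cong]: "sets \<beta> = sets borel"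
    and fm[measurable]: "f \<in> borel_measurable borel" and gm[measurable]: "g \<in> borel_measurable borel"
    and fK: "\<And>x. \<bar>f x\<bar> \<le> K * (1 + (norm x)\<^sup>2)" and gK: "\<And>x. \<bar>g x\<bar> \<le> K * (1 + (norm x)\<^sup>2)"
    and \<pi>: "\<pi> \<in> finite_second_moment_measures"
    and \<pi>_eq: "\<pi> = density (\<alpha> \<Otimes>\<^sub>M \<beta>) (\<lambda>p. ennreal (exp (l p)))"
    and \<pi>1: "distr \<pi> borel fst = density \<alpha> (\<lambda>x. ennreal (exp (f x)))"
    and \<pi>2: "distr \<pi> borel snd = density \<beta> (\<lambda>x. ennreal (exp (g x)))"
  shows "UOT_plans \<sigma> \<gamma> \<alpha> \<beta> = {\<pi>}" "UOT \<sigma> \<gamma> \<alpha> \<beta> = ennreal val" "0 \<le> val"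
proof -
  interpret \<alpha>: finite_measure \<alpha> by fact
  interpret \<beta>: finite_measure \<beta> by fact
  interpret \<alpha>\<beta>: pair_sigma_finite \<alpha> \<beta> by standard
  have spaces: "space \<alpha> = UNIV" "space \<beta> = UNIV"
    using sets_eq_imp_space_eq[OF sa] sets_eq_imp_space_eq[OF sb] by auto
  have sab: "sets (\<alpha> \<Otimes>\<^sub>M \<beta>) = sets borel"
    by (metis borel_prod sa sb sets_pair_measure_cong)
  have mab: "measure (\<alpha> \<Otimes>\<^sub>M \<beta>) UNIV = measure \<alpha> UNIV * measure \<beta> UNIV"
  proof -
    have "emeasure (\<alpha> \<Otimes>\<^sub>M \<beta>) (UNIV \<times> UNIV) = emeasure \<alpha> UNIV * emeasure \<beta> UNIV"
      using sets.top[of \<alpha>] sets.top[of \<beta>] by (intro \<beta>.emeasure_pair_measure_Times) (auto simp: spaces)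
    then show ?thesis by (simp add: measure_def enn2real_mult)
  qed
  have fab: "finite_measure (\<alpha> \<Otimes>\<^sub>M \<beta>)"
    by (rule finite_measure_pair_measure) fact+
  have fst_snd: "(fst :: 'a \<times> 'a \<Rightarrow> 'a) \<in> borel_measurable borel" "(snd :: 'a \<times> 'a \<Rightarrow> 'a) \<in> borel_measurable borel"
    by (auto intro!: borel_measurable_continuous_onI continuous_intros)
  have ff[measurable]: "(\<lambda>p :: 'a \<times> 'a. f (fst p)) \<in> borel_measurable borel"
    using measurable_compose[OF fst_snd(1) fm] .
  have gg[measurable]: "(\<lambda>p :: 'a \<times> 'a. g (snd p)) \<in> borel_measurable borel"
    using measurable_compose[OF fst_snd(2) gm] .
  have cc[measurable]: "(\<lambda>p :: 'a \<times> 'a. (norm (fst p - snd p))\<^sup>2) \<in> borel_measurable borel"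
    by (intro borel_measurable_continuous_onI continuous_intros)
  have lm[measurable]: "l \<in> borel_measurable borel" unfolding l_def by measurable
  have lmab: "l \<in> borel_measurable (\<alpha> \<Otimes>\<^sub>M \<beta>)" using lm sab by (simp cong: measurable_cong_sets)
  have c_bound: "(norm (fst p - snd p))\<^sup>2 \<le> 2 * (norm p)\<^sup>2" for p :: "'a \<times> 'a"
  proof -
    have "(norm (fst p - snd p))\<^sup>2 \<le> (norm (fst p) + norm (snd p))\<^sup>2"
      by (intro power_mono norm_triangle_ineq4) auto
    also have "\<dots> \<le> 2 * ((norm (fst p))\<^sup>2 + (norm (snd p))\<^sup>2)"
      using zero_le_power2[of "norm (fst p) - norm (snd p)"] by (simp add: power2_eq_square algebra_simps)
    finally show ?thesis by (simp add: norm_prod_def)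
  qed
  have K0: "0 \<le> K" using order_trans[OF abs_ge_zero fK[of 0]] by simp
  have facts: "finite_measure \<nu>" "sets \<nu> = sets borel" "space \<nu> = UNIV"
    "integrable \<nu> (\<lambda>p. (norm (fst p - snd p))\<^sup>2)"
    "integrable \<nu> (\<lambda>p. f (fst p))" "integrable \<nu> (\<lambda>p. g (snd p))" "integrable \<nu> l"
    "(\<integral>p. (norm (fst p - snd p))\<^sup>2 \<partial>\<nu>) + 2 * \<sigma>\<^sup>2 * (\<integral>p. l p \<partial>\<nu>)
       + \<gamma> * (\<integral>p. f (fst p) \<partial>\<nu>) + \<gamma> * (\<integral>p. g (snd p) \<partial>\<nu>) = 0"
    if \<nu>: "\<nu> \<in> finite_second_moment_measures" for \<nu> :: "('a \<times> 'a) measure"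
  proof -
    show fin: "finite_measure \<nu>" and sn[measurable_cong]: "sets \<nu> = sets borel"
      using \<nu> by (auto simp: finite_second_moment_measures_def)
    show "space \<nu> = UNIV" using sets_eq_imp_space_eq[OF sn] by simp
    interpret finite_measure \<nu> by fact
    have m2: "integrable \<nu> (\<lambda>p. (norm p)\<^sup>2)"
      using \<nu> by (auto simp: finite_second_moment_measures_def)
    have dom: "integrable \<nu> (\<lambda>p. K * (1 + (norm p)\<^sup>2))" using m2 by simp
    show ci: "integrable \<nu> (\<lambda>p. (norm (fst p - snd p))\<^sup>2)"
    proof (rule Bochner_Integration.integrable_bound)
      show "integrable \<nu> (\<lambda>p. 2 * (norm p)\<^sup>2)" using m2 by simp
      show "AE p in \<nu>. norm ((norm (fst p - snd p))\<^sup>2) \<le> norm (2 * (norm p)\<^sup>2)"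
        by (rule AE_I2) (use c_bound in simp)
    qed measurable
    have fst_le: "(norm (fst p))\<^sup>2 \<le> (norm p)\<^sup>2" "(norm (snd p))\<^sup>2 \<le> (norm p)\<^sup>2" for p :: "'a \<times> 'a"
      by (auto simp: norm_prod_def)
    show fi: "integrable \<nu> (\<lambda>p. f (fst p))"
    proof (rule Bochner_Integration.integrable_bound[OF dom])
      have "norm (f (fst p)) \<le> norm (K * (1 + (norm p)\<^sup>2))" for p :: "'a \<times> 'a"
      proof -
        have "\<bar>f (fst p)\<bar> \<le> K * (1 + (norm p)\<^sup>2)"
          using fK[of "fst p"] fst_le(1)[of p] K0 by (meson add_left_mono mult_left_mono order_trans)
        then show ?thesis by simp
      qed
      then show "AE p in \<nu>. norm (f (fst p)) \<le> norm (K * (1 + (norm p)\<^sup>2))" by simp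
    qed measurable
    show gi: "integrable \<nu> (\<lambda>p. g (snd p))"
    proof (rule Bochner_Integration.integrable_bound[OF dom])
      have "norm (g (snd p)) \<le> norm (K * (1 + (norm p)\<^sup>2))" for p :: "'a \<times> 'a"
      proof -
        have "\<bar>g (snd p)\<bar> \<le> K * (1 + (norm p)\<^sup>2)"
          using gK[of "snd p"] fst_le(2)[of p] K0 by (meson add_left_mono mult_left_mono order_trans)
        then show ?thesis by simp
      qed
      then show "AE p in \<nu>. norm (g (snd p)) \<le> norm (K * (1 + (norm p)\<^sup>2))" by simp
    qed measurable
    show "integrable \<nu> l" unfolding l_def using ci fi gi by simp
    show "(\<integral>p. (norm (fst p - snd p))\<^sup>2 \<partial>\<nu>) + 2 * \<sigma>\<^sup>2 * (\<integral>p. l p \<partial>\<nu>)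
       + \<gamma> * (\<integral>p. f (fst p) \<partial>\<nu>) + \<gamma> * (\<integral>p. g (snd p) \<partial>\<nu>) = 0"
      unfolding l_def using ci fi gi \<sigma> by (simp add: field_simps)
  qed
  have cost1: "(\<integral>\<^sup>+ (x, y). ennreal ((norm (x - y))\<^sup>2) \<partial>\<nu>) = ennreal (\<integral>p. (norm (fst p - snd p))\<^sup>2 \<partial>\<nu>)"
    if "\<nu> \<in> finite_second_moment_measures" for \<nu> :: "('a \<times> 'a) measure"
    unfolding case_prod_beta using facts(4)[OF that] by (intro nn_integral_eq_integral) auto
  have marg: "finite_measure (distr \<nu> borel fst)" "finite_measure (distr \<nu> borel snd)"
    "integrable (distr \<nu> borel fst) f" "integrable (distr \<nu> borel snd) g"
    "(\<integral>x. f x \<partial>(distr \<nu> borel fst)) = (\<integral>p. f (fst p) \<partial>\<nu>)"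
    "(\<integral>x. g x \<partial>(distr \<nu> borel snd)) = (\<integral>p. g (snd p) \<partial>\<nu>)"
    if \<nu>: "\<nu> \<in> finite_second_moment_measures" for \<nu> :: "('a \<times> 'a) measure"
  proof -
    note sn[measurable_cong] = facts(2)[OF \<nu>]
    interpret finite_measure \<nu> using facts(1)[OF \<nu>] .
    show "finite_measure (distr \<nu> borel fst)" "finite_measure (distr \<nu> borel snd)"
      by (intro finite_measure_distr; simp add: measurable_cong_sets[OF sn refl] fst_snd)+
    show "integrable (distr \<nu> borel fst) f" "integrable (distr \<nu> borel snd) g"
      using facts(5,6)[OF \<nu>]
      by (simp_all add: integrable_distr_eq measurable_cong_sets[OF sn refl] fst_snd fm gm)
    show "(\<integral>x. f x \<partial>(distr \<nu> borel fst)) = (\<integral>p. f (fst p) \<partial>\<nu>)"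
      "(\<integral>x. g x \<partial>(distr \<nu> borel snd)) = (\<integral>p. g (snd p) \<partial>\<nu>)"
      by (simp_all add: integral_distr measurable_cong_sets[OF sn refl] fst_snd fm gm)
  qed
  have mass: "integrable \<rho> (\<lambda>x. exp (h x))" "(\<integral>x. exp (h x) \<partial>\<rho>) = measure M (space M)"
    if "finite_measure M" "M = density \<rho> (\<lambda>x. ennreal (exp (h x)))" "h \<in> borel_measurable \<rho>"
    for M \<rho> :: "'b measure" and h
  proof -
    interpret finite_measure M by fact
    note [measurable] = that(3)
    show "integrable \<rho> (\<lambda>x. exp (h x))"
      using integrable_const[of "1::real"] unfolding that(2) by (subst (asm) integrable_density) auto
    have "measure M (space M) = (\<integral>x. 1 \<partial>M)" by simp
    also have "\<dots> = (\<integral>x. exp (h x) \<partial>\<rho>)" unfolding that(2) by (subst integral_density) auto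
    finally show "(\<integral>x. exp (h x) \<partial>\<rho>) = measure M (space M)" by simp
  qed
  note [measurable_cong] = facts(2)[OF \<pi>]
  have meas1: "measure (distr \<pi> borel fst) UNIV = measure \<pi> UNIV"
    "measure (distr \<pi> borel snd) UNIV = measure \<pi> UNIV"
    using facts(3)[OF \<pi>]
    by (simp_all add: measure_distr measurable_cong_sets[OF facts(2)[OF \<pi>] refl] fst_snd)
  note E = mass[OF facts(1)[OF \<pi>] \<pi>_eq lmab]
  have fma: "f \<in> borel_measurable \<alpha>" and gmb: "g \<in> borel_measurable \<beta>" by measurable
  note E1 = mass[OF marg(1)[OF \<pi>] \<pi>1 fma]
  note E2 = mass[OF marg(2)[OF \<pi>] \<pi>2 gmb]
  define LB where "LB \<nu> = (\<integral>p. l p \<partial>\<nu>) - measure \<pi> UNIV + measure \<alpha> UNIV * measure \<beta> UNIV" for \<nu>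
  define LB1 where "LB1 \<nu> = (\<integral>p. f (fst p) \<partial>\<nu>) - measure \<pi> UNIV + measure \<alpha> UNIV" for \<nu> :: "('a \<times> 'a) measure"
  define LB2 where "LB2 \<nu> = (\<integral>p. g (snd p) \<partial>\<nu>) - measure \<pi> UNIV + measure \<beta> UNIV" for \<nu> :: "('a \<times> 'a) measure"
  \<comment> \<open>The integrals against \<open>\<nu>\<close> cancel in the sum of the three dual bounds.\<close>
  have sum: "(\<integral>p. (norm (fst p - snd p))\<^sup>2 \<partial>\<nu>) + 2 * \<sigma>\<^sup>2 * LB \<nu> + \<gamma> * LB1 \<nu> + \<gamma> * LB2 \<nu> = val"
    if "\<nu> \<in> finite_second_moment_measures" for \<nu>
    using facts(8)[OF that] by (simp add: LB_def LB1_def LB2_def val_def algebra_simps)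
  have space_ab: "space (\<alpha> \<Otimes>\<^sub>M \<beta>) = UNIV" by (simp add: space_pair_measure spaces)
  have Epi: "(\<integral>p. exp (l p) \<partial>(\<alpha> \<Otimes>\<^sub>M \<beta>)) = measure \<pi> UNIV"
    "(\<integral>x. exp (f x) \<partial>\<alpha>) = measure \<pi> UNIV" "(\<integral>x. exp (g x) \<partial>\<beta>) = measure \<pi> UNIV"
    using E(2) E1(2) E2(2) facts(3)[OF \<pi>] meas1 by auto
  have cost_pi: "UOT_cost \<sigma> \<gamma> \<alpha> \<beta> \<pi> = ennreal val" and val0: "0 \<le> val"
  proof -
    have il: "integrable (density (\<alpha> \<Otimes>\<^sub>M \<beta>) (\<lambda>p. ennreal (exp (l p)))) l"
      using facts(7)[OF \<pi>] \<pi>_eq by simp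
    have if1: "integrable (density \<alpha> (\<lambda>p. ennreal (exp (f p)))) f"
      using marg(3)[OF \<pi>] \<pi>1 by simp
    have if2: "integrable (density \<beta> (\<lambda>p. ennreal (exp (g p)))) g"
      using marg(4)[OF \<pi>] \<pi>2 by simp
    note k = KL_exp_density[OF fab lmab il E(1), folded \<pi>_eq]
    note k1 = KL_exp_density[OF \<open>finite_measure \<alpha>\<close> fma if1 E1(1), folded \<pi>1]
    note k2 = KL_exp_density[OF \<open>finite_measure \<beta>\<close> gmb if2 E2(1), folded \<pi>2]
    have k: "KL \<pi> (\<alpha> \<Otimes>\<^sub>M \<beta>) = ennreal (LB \<pi>)" "0 \<le> LB \<pi>"
      using k by (auto simp: LB_def Epi space_ab mab)
    have k1: "KL (distr \<pi> borel fst) \<alpha> = ennreal (LB1 \<pi>)" "0 \<le> LB1 \<pi>"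
      using k1 by (auto simp: LB1_def Epi spaces marg(5)[OF \<pi>])
    have k2: "KL (distr \<pi> borel snd) \<beta> = ennreal (LB2 \<pi>)" "0 \<le> LB2 \<pi>"
      using k2 by (auto simp: LB2_def Epi spaces marg(6)[OF \<pi>])
    have c0: "0 \<le> (\<integral>p. (norm (fst p - snd p))\<^sup>2 \<partial>\<pi>)" by simp
    show "0 \<le> val" unfolding sum[OF \<pi>, symmetric] using c0 k k1 k2 \<sigma> \<gamma> by simp
    show "UOT_cost \<sigma> \<gamma> \<alpha> \<beta> \<pi> = ennreal val"
      unfolding UOT_cost_def cost1[OF \<pi>] k(1) k1(1) k2(1) sum[OF \<pi>, symmetric]
      using c0 k(2) k1(2) k2(2) \<sigma> \<gamma> by (simp add: ennreal_mult)
  qed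
  have lower: "ennreal val \<le> UOT_cost \<sigma> \<gamma> \<alpha> \<beta> \<nu> \<and> (UOT_cost \<sigma> \<gamma> \<alpha> \<beta> \<nu> \<le> ennreal val \<longrightarrow> \<nu> = \<pi>)"
    if \<nu>: "\<nu> \<in> finite_second_moment_measures" for \<nu>
  proof (cases "UOT_cost \<sigma> \<gamma> \<alpha> \<beta> \<nu> = \<infinity>")
    case True
    then show ?thesis by (simp add: top_unique)
  next
    case False
    note sn[measurable_cong] = facts(2)[OF \<nu>]
    have fin: "KL \<nu> (\<alpha> \<Otimes>\<^sub>M \<beta>) \<noteq> \<infinity>" "KL (distr \<nu> borel fst) \<alpha> \<noteq> \<infinity>" "KL (distr \<nu> borel snd) \<beta> \<noteq> \<infinity>"
      using False \<sigma> \<gamma> unfolding UOT_cost_def by (auto simp: ennreal_mult_eq_top_iff)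
    define k where "k = enn2real (KL \<nu> (\<alpha> \<Otimes>\<^sub>M \<beta>))"
    define k1 where "k1 = enn2real (KL (distr \<nu> borel fst) \<alpha>)"
    define k2 where "k2 = enn2real (KL (distr \<nu> borel snd) \<beta>)"
    have kk: "KL \<nu> (\<alpha> \<Otimes>\<^sub>M \<beta>) = ennreal k" "KL (distr \<nu> borel fst) \<alpha> = ennreal k1" "KL (distr \<nu> borel snd) \<beta> = ennreal k2"
      "0 \<le> k" "0 \<le> k1" "0 \<le> k2"
      using fin by (auto simp: k_def k1_def k2_def top.not_eq_extremum)
    have c0: "0 \<le> (\<integral>p. (norm (fst p - snd p))\<^sup>2 \<partial>\<nu>)" by simp
    have cost: "UOT_cost \<sigma> \<gamma> \<alpha> \<beta> \<nu> =
        ennreal ((\<integral>p. (norm (fst p - snd p))\<^sup>2 \<partial>\<nu>) + 2 * \<sigma>\<^sup>2 * k + \<gamma> * k1 + \<gamma> * k2)"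
      unfolding UOT_cost_def cost1[OF \<nu>] kk(1-3) using c0 kk(4-6) \<sigma> \<gamma> by (simp add: ennreal_mult)
    have sets_nu: "sets \<nu> = sets (\<alpha> \<Otimes>\<^sub>M \<beta>)" using sn sab by simp
    note b = KL_lower_bound[OF fab facts(1)[OF \<nu>] sets_nu lmab facts(7)[OF \<nu>] E(1) fin(1)]
    have b0: "LB \<nu> \<le> k"
      using b(1) by (simp add: LB_def k_def Epi space_ab mab)
    have beq: "\<nu> = \<pi>" if "k = LB \<nu>"
    proof (rule trans[OF _ \<pi>_eq[symmetric]], rule b(2))
      show "enn2real (KL \<nu> (\<alpha> \<Otimes>\<^sub>M \<beta>)) = (\<integral>x. l x \<partial>\<nu>) - (\<integral>x. exp (l x) \<partial>(\<alpha> \<Otimes>\<^sub>M \<beta>))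
          + measure (\<alpha> \<Otimes>\<^sub>M \<beta>) (space (\<alpha> \<Otimes>\<^sub>M \<beta>))"
        using that by (simp add: LB_def k_def Epi space_ab mab)
    qed
    have b1: "LB1 \<nu> \<le> k1"
      using KL_lower_bound(1)[OF \<open>finite_measure \<alpha>\<close> marg(1)[OF \<nu>] _ fma marg(3)[OF \<nu>] E1(1) fin(2)] sa
      by (simp add: LB1_def k1_def Epi spaces marg(5)[OF \<nu>])
    have b2: "LB2 \<nu> \<le> k2"
      using KL_lower_bound(1)[OF \<open>finite_measure \<beta>\<close> marg(2)[OF \<nu>] _ gmb marg(4)[OF \<nu>] E2(1) fin(3)] sb
      by (simp add: LB2_def k2_def Epi spaces marg(6)[OF \<nu>])
    have m: "2 * \<sigma>\<^sup>2 * LB \<nu> \<le> 2 * \<sigma>\<^sup>2 * k" "\<gamma> * LB1 \<nu> \<le> \<gamma> * k1" "\<gamma> * LB2 \<nu> \<le> \<gamma> * k2"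
      using b0 b1 b2 \<sigma> \<gamma> by auto
    show ?thesis
    proof (intro conjI impI)
      show "ennreal val \<le> UOT_cost \<sigma> \<gamma> \<alpha> \<beta> \<nu>"
        unfolding cost sum[OF \<nu>, symmetric] using m by (intro ennreal_leI) linarith
      assume "UOT_cost \<sigma> \<gamma> \<alpha> \<beta> \<nu> \<le> ennreal val"
      then have "(\<integral>p. (norm (fst p - snd p))\<^sup>2 \<partial>\<nu>) + 2 * \<sigma>\<^sup>2 * k + \<gamma> * k1 + \<gamma> * k2 \<le> val"
        unfolding cost using val0 by (simp add: ennreal_le_iff)
      then have "2 * \<sigma>\<^sup>2 * k = 2 * \<sigma>\<^sup>2 * LB \<nu>" using sum[OF \<nu>] m by linarith
      then show "\<nu> = \<pi>" using \<sigma> by (intro beq) simp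
    qed
  qed
  show "UOT_plans \<sigma> \<gamma> \<alpha> \<beta> = {\<pi>}"
  proof (intro set_eqI iffI)
    fix \<nu> assume "\<nu> \<in> UOT_plans \<sigma> \<gamma> \<alpha> \<beta>"
    then have \<nu>: "\<nu> \<in> finite_second_moment_measures"
      and "\<not> UOT_cost \<sigma> \<gamma> \<alpha> \<beta> \<pi> < UOT_cost \<sigma> \<gamma> \<alpha> \<beta> \<nu>"
      using \<pi> by (auto simp only: UOT_plans_def is_arg_min_def mem_Collect_eq)
    then have "UOT_cost \<sigma> \<gamma> \<alpha> \<beta> \<nu> \<le> ennreal val" by (simp only: cost_pi not_less)
    then have "\<nu> = \<pi>" using lower[OF \<nu>] by (elim conjE mp)
    then show "\<nu> \<in> {\<pi>}" by simp
  next
    fix \<nu> assume "\<nu> \<in> {\<pi>}"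
    then have "\<nu> = \<pi>" by (simp only: singleton_iff)
    moreover have "\<not> UOT_cost \<sigma> \<gamma> \<alpha> \<beta> y < UOT_cost \<sigma> \<gamma> \<alpha> \<beta> \<pi>" if "y \<in> finite_second_moment_measures" for y
      unfolding cost_pi not_less using lower[OF that] by (rule conjunct1)
    ultimately show "\<nu> \<in> UOT_plans \<sigma> \<gamma> \<alpha> \<beta>"
      using \<pi> unfolding UOT_plans_def is_arg_min_def by blast
  qed
  show "UOT \<sigma> \<gamma> \<alpha> \<beta> = ennreal val"
    unfolding UOT_def
  proof (rule antisym)
    show "(INF \<pi>\<in>finite_second_moment_measures. UOT_cost \<sigma> \<gamma> \<alpha> \<beta> \<pi>) \<le> ennreal val"
      using cost_pi by (intro INF_lower2[OF \<pi>]) simp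
    show "ennreal val \<le> (INF \<pi>\<in>finite_second_moment_measures. UOT_cost \<sigma> \<gamma> \<alpha> \<beta> \<pi>)"
      using lower by (intro INF_greatest) (rule conjunct1)
  qed
  show "0 \<le> val" by (rule val0)
qed

section \<open>Simultaneous diagonalisation of quadratic forms\<close>

text \<open>The diagonal matrix with the given entries.\<close>

definition diag_mat :: "('n \<Rightarrow> real) \<Rightarrow> real^'n^'n" where
  "diag_mat d = (\<chi> i j. if i = j then d i else 0)"

text \<open>A quadratic polynomial without constant term that is nonnegative everywhere has no linear term.\<close>

lemma semidefinite_null:
  fixes b c :: real
  assumes "\<And>t. 0 \<le> 2 * t * b + t\<^sup>2 * c"
  shows "b = 0"
proof (rule ccontr)
  assume "b \<noteq> 0"
  define K where "K = \<bar>c\<bar> + 1"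
  have K: "K > 0" "c < K" unfolding K_def by auto
  have "0 \<le> 2 * (- (b / K)) * b + (- (b / K))\<^sup>2 * c" by (rule assms)
  also have "\<dots> = (b\<^sup>2 / K) * (c / K - 2)"
    using K by (simp add: field_simps power2_eq_square)
  also have "\<dots> < 0"
    using K \<open>b \<noteq> 0\<close> by (intro mult_pos_neg) (auto simp: field_simps)
  finally show False by simp
qed

lemma inner_matrix_symmetric:
  fixes A :: "real^'n^'n"
  assumes "transpose A = A"
  shows "x \<bullet> (A *v y) = y \<bullet> (A *v x)"
  by (metis assms dot_lmul_matrix inner_commute transpose_matrix_vector)

text \<open>Every subspace has a basis that is orthonormal for a positive definite form \<open>P\<close> and orthogonal
  for a symmetric form \<open>Q\<close>: a maximiser of the Rayleigh quotient \<open>Q/P\<close> splits off, because its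
  \<open>P\<close>-orthogonal complement is also \<open>Q\<close>-orthogonal to it.\<close>

lemma common_orthogonal_basis_subspace:
  fixes P Q :: "real^'n^'n" and S :: "(real^'n) set"
  assumes P: "sym_pos_def P" and Q: "transpose Q = Q"
    and "subspace S" "dim S = k"
  shows "\<exists>B. finite B \<and> card B = k \<and> B \<subseteq> S \<and> (\<forall>u\<in>B. u \<bullet> (P *v u) = 1) \<and>
     (\<forall>u\<in>B. \<forall>v\<in>B. u \<noteq> v \<longrightarrow> u \<bullet> (P *v v) = 0 \<and> u \<bullet> (Q *v v) = 0)"
  using assms(3,4)
proof (induction k arbitrary: S)
  case 0
  show ?case by (rule exI[of _ "{}"]) auto
next
  case (Suc k S)
  have Ps: "transpose P = P" and Pp: "\<And>x. x \<noteq> 0 \<Longrightarrow> 0 < x \<bullet> (P *v x)"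
    using P by (auto simp: sym_pos_def_def)
  define g where "g x = (x \<bullet> (Q *v x)) / (x \<bullet> (P *v x))" for x
  have "S \<noteq> {0}" using Suc.prems by auto
  then obtain z where z: "z \<in> S" "z \<noteq> 0" using Suc.prems subspace_0 by blast
  have cmp: "compact (S \<inter> sphere 0 1)"
    using closed_subspace[OF Suc.prems(1)] by (simp add: closed_Int_compact)
  have ne: "S \<inter> sphere 0 1 \<noteq> {}"
  proof -
    have "z /\<^sub>R norm z \<in> S \<inter> sphere 0 1"
      using z Suc.prems by (auto simp: subspace_scale)
    then show ?thesis by blast
  qed
  have cont: "continuous_on (S \<inter> sphere 0 1) g"
    unfolding g_def
  proof (intro continuous_intros ballI)
    fix x assume "x \<in> S \<inter> sphere 0 (1::real)"
    then have "x \<noteq> 0" by auto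
    then show "x \<bullet> (P *v x) \<noteq> 0" using Pp[of x] by auto
  qed
  obtain v0 where v0: "v0 \<in> S" "norm v0 = 1" and mx: "\<And>x. x \<in> S \<Longrightarrow> norm x = 1 \<Longrightarrow> g x \<le> g v0"
    using continuous_attains_sup[OF cmp ne cont] by auto
  define m where "m = g v0"
  have "v0 \<noteq> 0" using v0 by auto
  have le: "x \<bullet> (Q *v x) \<le> m * (x \<bullet> (P *v x))" if "x \<in> S" for x
  proof (cases "x = 0")
    case False
    have "g x = g (x /\<^sub>R norm x)"
      using False by (simp add: g_def matrix_vector_mult_scaleR)
    also have "\<dots> \<le> m" unfolding m_def
      using False that Suc.prems by (intro mx) (auto simp: subspace_scale)
    finally show ?thesis using Pp[OF False] by (simp add: g_def field_simps)
  qed auto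
  define v where "v = (1 / sqrt (v0 \<bullet> (P *v v0))) *\<^sub>R v0"
  have v: "v \<in> S" unfolding v_def using v0 Suc.prems by (auto simp: subspace_scale)
  have vP: "v \<bullet> (P *v v) = 1"
    using Pp[OF \<open>v0 \<noteq> 0\<close>] by (simp add: v_def matrix_vector_mult_scaleR)
  have vQ: "v \<bullet> (Q *v v) = m"
    using Pp[OF \<open>v0 \<noteq> 0\<close>] by (simp add: v_def matrix_vector_mult_scaleR m_def g_def)
  \<comment> \<open>The form \<open>m P - Q\<close> is positive semidefinite on \<open>S\<close> and vanishes at \<open>v\<close>, so \<open>v\<close> lies in
    its kernel there.\<close>
  have orth: "v \<bullet> (Q *v w) = 0" if w: "w \<in> S" "v \<bullet> (P *v w) = 0" for w
  proof -
    have sP: "w \<bullet> (P *v v) = 0" using w inner_matrix_symmetric[OF Ps] by metis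
    have sQ: "w \<bullet> (Q *v v) = v \<bullet> (Q *v w)" using inner_matrix_symmetric[OF Q] by metis
    have "- (v \<bullet> (Q *v w)) = 0"
    proof (rule semidefinite_null)
      fix t :: real
      have "v + t *\<^sub>R w \<in> S" using v w Suc.prems by (auto intro: subspace_add subspace_scale)
      from le[OF this] show "0 \<le> 2 * t * - (v \<bullet> (Q *v w)) +
           t\<^sup>2 * (m * (w \<bullet> (P *v w)) - w \<bullet> (Q *v w))"
        by (simp add: matrix_vector_right_distrib matrix_vector_mult_scaleR inner_add_left
            inner_add_right vP vQ sP sQ w algebra_simps power2_eq_square)
    qed
    then show ?thesis by simp
  qed
  define S' where "S' = {w \<in> S. v \<bullet> (P *v w) = 0}"
  have S': "subspace S'" unfolding S'_def using Suc.prems(1)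
    by (auto simp: subspace_def matrix_vector_right_distrib matrix_vector_mult_scaleR inner_add_right)
  have "S \<subseteq> span (insert v S')"
  proof
    fix x assume x: "x \<in> S"
    define c where "c = v \<bullet> (P *v x)"
    have "x - c *\<^sub>R v \<in> S'"
      using x v Suc.prems(1) unfolding S'_def
      by (auto simp: subspace_diff subspace_scale matrix_vector_mult_diff_distrib
          matrix_vector_mult_scaleR inner_diff_right vP c_def)
    then have "(x - c *\<^sub>R v) + c *\<^sub>R v \<in> span (insert v S')"
      by (intro span_add span_scale) (auto intro: span_base)
    then show "x \<in> span (insert v S')" by simp
  qed
  moreover have "insert v S' \<subseteq> S" using v by (auto simp: S'_def)
  ultimately have "dim S = dim (insert v S')"
    by (metis dim_subset dim_span le_antisym)
  moreover have "v \<notin> span S'"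
  proof -
    have "span S' = S'" using S' by simp
    moreover have "v \<notin> S'" using vP by (simp add: S'_def)
    ultimately show ?thesis by metis
  qed
  ultimately have "dim S' = k"
    using Suc.prems(2) dim_insert[of v S'] by simp
  from Suc.IH[OF S' this] obtain B where B: "finite B" "card B = k" "B \<subseteq> S'"
    "\<And>u. u \<in> B \<Longrightarrow> u \<bullet> (P *v u) = 1"
    "\<And>u v. u \<in> B \<Longrightarrow> v \<in> B \<Longrightarrow> u \<noteq> v \<Longrightarrow> u \<bullet> (P *v v) = 0 \<and> u \<bullet> (Q *v v) = 0"
    by blast
  have "v \<notin> B" using B(3) vP by (auto simp: S'_def)
  have *: "v \<bullet> (P *v w) = 0 \<and> v \<bullet> (Q *v w) = 0 \<and> w \<bullet> (P *v v) = 0 \<and> w \<bullet> (Q *v v) = 0"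
    if "w \<in> B" for w
  proof -
    have w: "w \<in> S" "v \<bullet> (P *v w) = 0" using that B(3) by (auto simp: S'_def)
    then show ?thesis
      using orth[OF w] inner_matrix_symmetric[OF Ps, of v w] inner_matrix_symmetric[OF Q, of v w]
      by auto
  qed
  show ?case
    using B \<open>v \<notin> B\<close> v vP * by (intro exI[of _ "insert v B"]) (auto simp: S'_def)
qed

lemma simultaneous_congruence:
  fixes P Q :: "real^'n^'n"
  assumes P: "sym_pos_def P" and Q: "transpose Q = Q"
  obtains V :: "real^'n^'n" and d where "transpose V ** P ** V = mat 1" "transpose V ** Q ** V = diag_mat d"
proof -
  obtain B where B: "finite B" "card B = CARD('n)" 
    "\<And>u. u \<in> B \<Longrightarrow> u \<bullet> (P *v u) = 1"
    "\<And>u v. u \<in> B \<Longrightarrow> v \<in> B \<Longrightarrow> u \<noteq> v \<Longrightarrow> u \<bullet> (P *v v) = 0 \<and> u \<bullet> (Q *v v) = 0"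
    using common_orthogonal_basis_subspace[OF P Q subspace_UNIV refl] by (auto simp: dim_UNIV)
  then obtain f where f: "bij_betw f (UNIV :: 'n set) B"
    by (metis finite_same_card_bij finite)
  define V :: "real^'n^'n" where "V = (\<chi> i j. f j $ i)"
  have comp: "(transpose V ** M ** V) $ i $ j = f i \<bullet> (M *v f j)" for M :: "real^'n^'n" and i j
    by (simp only: matrix_mul_assoc[symmetric])
      (simp add: V_def matrix_matrix_mult_def transpose_def inner_vec_def matrix_vector_mult_def)
  have fB: "f i \<in> B" for i using f by (auto simp: bij_betw_def)
  have fne: "f i \<noteq> f j" if "i \<noteq> j" for i j
    using f that by (auto simp: bij_betw_def inj_on_def)
  show ?thesis
  proof (rule that[of V "\<lambda>i. f i \<bullet> (Q *v f i)"])
    show "transpose V ** P ** V = mat 1"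
      using B(3)[OF fB] B(4)[OF fB fB fne] by (simp add: vec_eq_iff comp mat_def)
    show "transpose V ** Q ** V = diag_mat (\<lambda>i. f i \<bullet> (Q *v f i))"
      using B(4)[OF fB fB fne] by (simp add: vec_eq_iff comp diag_mat_def)
  qed
qed

lemma matrix_inv_inverse:
  fixes A :: "real^'n^'n"
  assumes "invertible A"
  shows "A ** matrix_inv A = mat 1 \<and> matrix_inv A ** A = mat 1"
  using assms unfolding invertible_def matrix_inv_def by (rule someI_ex)

text \<open>For square matrices a one-sided inverse is the inverse.\<close>

lemma matrix_inv_eqI:
  fixes A B :: "real^'n^'n"
  assumes "A ** B = mat 1"
  shows "matrix_inv A = B"
proof -
  have "invertible A" using assms matrix_left_right_inverse invertible_def by blast
  then have "matrix_inv A ** A = mat 1" by (simp add: matrix_inv_inverse)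
  then show ?thesis by (metis assms matrix_mul_assoc matrix_mul_lid matrix_mul_rid)
qed

lemma sym_pos_def_inverse:
  fixes A :: "real^'n^'n"
  assumes "sym_pos_def A"
  shows "A ** matrix_inv A = mat 1" "matrix_inv A ** A = mat 1" "sym_pos_def (matrix_inv A)"
    "det A > 0" "invertible A"
proof -
  obtain V :: "real^'n^'n" and d where V: "transpose V ** A ** V = mat 1"
      and "transpose V ** mat 1 ** V = diag_mat d"
    by (rule simultaneous_congruence[OF assms transpose_mat[of 1]])
  have "x = 0" if "A *v x = 0" for x
  proof (rule ccontr)
    assume "x \<noteq> 0"
    then have "0 < x \<bullet> (A *v x)" using assms by (simp add: sym_pos_def_def)
    then show False using that by simp
  qed
  then show inv: "invertible A" by (simp add: invertible_left_inverse matrix_left_invertible_ker)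
  have "det V * det V * det A = 1"
    using arg_cong[OF V, of det] by (simp add: det_mul det_transpose mult_ac)
  then have "0 < (det V * det V) * det A" by simp
  then show "det A > 0"
    using zero_le_square[of "det V"] by (auto simp: zero_less_mult_iff)
  show 1: "A ** matrix_inv A = mat 1" "matrix_inv A ** A = mat 1"
    using matrix_inv_inverse[OF inv] by auto
  have t: "transpose (matrix_inv A) = matrix_inv A"
  proof -
    have "A ** transpose (matrix_inv A) = mat 1"
      using arg_cong[OF 1(2), of transpose] assms
      by (simp add: matrix_transpose_mul sym_pos_def_def)
    then show ?thesis by (rule matrix_inv_eqI[symmetric])
  qed
  moreover have "0 < x \<bullet> (matrix_inv A *v x)" if "x \<noteq> 0" for x
  proof -
    define y where "y = matrix_inv A *v x"
    have x: "x = A *v y" using 1 by (simp add: y_def matrix_vector_mul_assoc)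
    then have "y \<noteq> 0" using that by auto
    then have "0 < y \<bullet> (A *v y)" using assms by (simp add: sym_pos_def_def)
    then have "0 < x \<bullet> y" unfolding x[symmetric] by (subst inner_commute)
    then show ?thesis by (simp only: y_def)
  qed
  ultimately show "sym_pos_def (matrix_inv A)" by (auto simp: sym_pos_def_def)
qed

section \<open>Linear change of variables and Gaussian integrals\<close>

lemma borel_measurable_matrix_vector_mult[measurable]:
  fixes V :: "real^'n^'m"
  assumes "f \<in> borel_measurable M"
  shows "(\<lambda>x. V *v f x) \<in> borel_measurable M"
  using assms by (rule borel_measurable_continuous_on[rotated])
    (intro linear_continuous_on matrix_vector_mul_bounded_linear)

lemma nn_integral_shift:
  fixes m :: "'a::euclidean_space"
  assumes [measurable]: "f \<in> borel_measurable borel"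
  shows "(\<integral>\<^sup>+ x. f (x - m) \<partial>lborel) = (\<integral>\<^sup>+ x. f x \<partial>lborel)"
  by (subst (2) lborel_distr_plus[of "-m", symmetric]) (simp add: nn_integral_distr)

lemma prod_Basis_cart:
  fixes F :: "real^'n \<Rightarrow> 'b::comm_monoid_mult"
  shows "(\<Prod>b\<in>Basis. F b) = (\<Prod>i\<in>UNIV. F (axis i 1))"
proof -
  have "(Basis :: (real^'n) set) = range (\<lambda>i. axis i 1)"
    by (auto simp: Basis_vec_def)
  moreover have "inj (\<lambda>i. axis i 1 :: real^'n)"
    by (auto simp: inj_on_def axis_eq_axis)
  ultimately show ?thesis by (metis (mono_tags, lifting) prod.reindex_cong)
qed

lemma emeasure_lborel_box_cart:
  fixes a b :: "real^'n"
  assumes "\<And>i. a $ i \<le> b $ i"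
  shows "emeasure lborel (box a b) = ennreal (\<Prod>i\<in>UNIV. b $ i - a $ i)"
proof (subst emeasure_lborel_box)
  fix e :: "real^'n" assume "e \<in> Basis"
  then obtain i where "e = axis i 1" by (auto simp: Basis_vec_def)
  then show "a \<bullet> e \<le> b \<bullet> e" using assms by (simp add: inner_axis)
qed (simp add: prod_Basis_cart inner_axis)

text \<open>A shear is a translation of the coordinate \<open>m\<close> once the other coordinates are fixed.\<close>

lemma nn_integral_shear:
  fixes f :: "real^'n \<Rightarrow> ennreal"
  assumes "m \<noteq> n" and [measurable]: "f \<in> borel_measurable borel"
  shows "(\<integral>\<^sup>+ x. f (x + (x $ n) *\<^sub>R axis m 1) \<partial>lborel) = (\<integral>\<^sup>+ x. f x \<partial>lborel)"
proof -
  interpret product_sigma_finite "\<lambda>_::real^'n. (lborel :: real measure)"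
    by standard
  define e where "e = (axis m 1 :: real^'n)"
  define I where "I = (Basis :: (real^'n) set) - {e}"
  define S where "S = (\<lambda>g :: real^'n \<Rightarrow> real. \<Sum>b\<in>Basis. g b *\<^sub>R b)"
  have e: "e \<in> Basis" "insert e I = Basis" "finite I" "e \<notin> I"
    by (auto simp: I_def e_def axis_in_Basis_iff)
  have ne: "axis n 1 \<noteq> e" using assms by (simp add: e_def axis_eq_axis)
  \<comment> \<open>The coordinate \<open>m\<close>, with basis vector \<open>e\<close>, is integrated out first.\<close>
  have fubini: "(\<integral>\<^sup>+ x. F x \<partial>lborel) =
      (\<integral>\<^sup>+ g. (\<integral>\<^sup>+ y. F (S (g(e := y))) \<partial>lborel) \<partial>(Pi\<^sub>M I (\<lambda>_. lborel)))"
    if [measurable]: "F \<in> borel_measurable borel" for F :: "real^'n \<Rightarrow> ennreal"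
  proof -
    have "(\<integral>\<^sup>+ x. F x \<partial>lborel) = (\<integral>\<^sup>+ g. F (S g) \<partial>(Pi\<^sub>M (insert e I) (\<lambda>_. lborel)))"
      unfolding S_def e by (subst lborel_eq) (simp add: nn_integral_distr)
    also have "\<dots> = (\<integral>\<^sup>+ g. (\<integral>\<^sup>+ y. F (S (g(e := y))) \<partial>lborel) \<partial>(Pi\<^sub>M I (\<lambda>_. lborel)))"
      by (intro product_nn_integral_insert e) (simp add: e S_def)
    finally show ?thesis .
  qed
  have coord: "S g $ i = g (axis i 1)" for g i
  proof -
    have "S g $ i = S g \<bullet> axis i 1" by (simp add: inner_axis)
    then show ?thesis
      by (simp add: S_def axis_in_Basis_iff inner_sum_left_Basis)
  qed
  have shift: "S (g(e := y)) + (S (g(e := y)) $ n) *\<^sub>R axis m 1 = S (g(e := g (axis n 1) + y))" for g y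
    using ne by (auto simp: vec_eq_iff coord e_def axis_def)
  have "(\<integral>\<^sup>+ x. f (x + (x $ n) *\<^sub>R axis m 1) \<partial>lborel) =
      (\<integral>\<^sup>+ g. (\<integral>\<^sup>+ y. f (S (g(e := g (axis n 1) + y))) \<partial>lborel) \<partial>(Pi\<^sub>M I (\<lambda>_. lborel)))"
    by (subst fubini) (simp_all add: shift)
  also have "\<dots> = (\<integral>\<^sup>+ g. (\<integral>\<^sup>+ y. f (S (g(e := y))) \<partial>lborel) \<partial>(Pi\<^sub>M I (\<lambda>_. lborel)))"
  proof (rule nn_integral_cong)
    fix g :: "real^'n \<Rightarrow> real"
    have [measurable]: "(\<lambda>y. S (g(e := y))) \<in> borel_measurable borel"
      unfolding S_def fun_upd_apply by measurable
    show "(\<integral>\<^sup>+ y. f (S (g(e := g (axis n 1) + y))) \<partial>lborel) = (\<integral>\<^sup>+ y. f (S (g(e := y))) \<partial>lborel)"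
      by (subst (2) lborel_distr_plus[of "g (axis n 1)", symmetric]) (simp add: nn_integral_distr)
  qed
  also have "\<dots> = (\<integral>\<^sup>+ x. f x \<partial>lborel)" by (rule fubini[symmetric]) measurable
  finally show ?thesis .
qed

lemma lborel_swap_coordinates:
  "lborel = distr lborel borel (\<lambda>x :: real^'n. \<chi> i. x $ Transposition.transpose m n i)"
proof (rule lborel_eqI)
  let ?T = "Transposition.transpose m n"
  have T: "?T permutes UNIV" by (simp add: permutes_swap_id)
  have meas: "(\<lambda>x :: real^'n. \<chi> i. x $ ?T i) \<in> borel_measurable borel"
    by (intro borel_measurable_continuous_onI continuous_intros)
  fix l u :: "real^'n" assume lu: "\<And>b. b \<in> Basis \<Longrightarrow> l \<bullet> b \<le> u \<bullet> b"
  have lu': "l $ i \<le> u $ i" for i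
    using lu[of "axis i 1"] by (simp add: axis_in_Basis_iff inner_axis)
  have "(\<lambda>x :: real^'n. \<chi> i. x $ ?T i) -` box l u = box (\<chi> i. l $ ?T i) (\<chi> i. u $ ?T i)"
    by (auto simp: mem_box_cart) (metis transpose_involutory)+
  then have "emeasure (distr lborel borel (\<lambda>x. \<chi> i. x $ ?T i)) (box l u) =
      emeasure lborel (box (\<chi> i. l $ ?T i) (\<chi> i. u $ ?T i))"
    using meas by (simp add: emeasure_distr)
  also have "\<dots> = ennreal (\<Prod>i\<in>UNIV. (u - l) $ ?T i)"
    using lu' by (simp add: emeasure_lborel_box_cart)
  also have "(\<Prod>i\<in>UNIV. (u - l) $ ?T i) = (\<Prod>i\<in>UNIV. (u - l) $ i)"
    using prod.permute[OF T, of "\<lambda>i. (u - l) $ i"] by (simp add: o_def)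
  also have "\<dots> = (\<Prod>b\<in>Basis. (u - l) \<bullet> b)"
    by (simp add: prod_Basis_cart inner_axis)
  finally show "emeasure (distr lborel borel (\<lambda>x. \<chi> i. x $ ?T i)) (box l u) =
      ennreal (\<Prod>b\<in>Basis. (u - l) \<bullet> b)" .
qed simp

text \<open>The change of variables formula for an invertible matrix, for an arbitrary finite index type:
  both sides are compatible with products of matrices, so elementary matrices suffice.\<close>

lemma nn_integral_linear_substitution:
  fixes V :: "real^'n^'n"
  assumes "det V \<noteq> 0" and "f \<in> borel_measurable borel"
  shows "(\<integral>\<^sup>+ x. f x \<partial>lborel) = ennreal \<bar>det V\<bar> * (\<integral>\<^sup>+ x. f (V *v x) \<partial>lborel)"
  using assms
proof (induction V arbitrary: f rule: induct_matrix_elementary_alt)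
  case (1 A B)
  note [measurable] = "1.prems"(2)
  have "det A \<noteq> 0" "det B \<noteq> 0" using "1.prems" by (auto simp: det_mul)
  then show ?case
    using "1.IH"(1)[of f] "1.IH"(2)[of "\<lambda>x. f (A *v x)"]
    by (simp add: det_mul abs_mult ennreal_mult mult.assoc flip: matrix_vector_mul_assoc)
next
  case (2 A i)
  then show ?case using det_zero_row(2) by blast
next
  case (3 A)
  note [measurable] = "3.prems"(2)
  define c where "c = (\<lambda>b. b \<bullet> (A *v b))"
  have c_axis: "c (axis i 1) = A $ i $ i" for i
    by (simp add: c_def inner_axis' matrix_vector_mult_basis column_def)
  have dt: "det A = (\<Prod>i\<in>UNIV. A $ i $ i)" using "3.hyps" by (simp add: det_diagonal)
  then have cnz: "c b \<noteq> 0" if "b \<in> Basis" for b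
    using that "3.prems"(1) c_axis by (auto simp: Basis_vec_def)
  have T: "(\<Sum>b\<in>Basis. (c b * (x \<bullet> b)) *\<^sub>R b) = A *v x" for x
  proof -
    have "(\<Sum>b\<in>Basis. (c b * (x \<bullet> b)) *\<^sub>R b) $ i = A $ i $ i * x $ i" for i
    proof -
      have "(\<Sum>b\<in>Basis. (c b * (x \<bullet> b)) *\<^sub>R b) \<bullet> axis i 1 = c (axis i 1) * (x \<bullet> axis i 1)"
        by (subst inner_sum_left_Basis) (auto simp: axis_in_Basis_iff)
      then show ?thesis by (simp add: inner_axis c_axis)
    qed
    moreover have "(A *v x) $ i = A $ i $ i * x $ i" for i
      using "3.hyps" by (simp add: matrix_vector_mult_def sum.remove[of UNIV i])
    ultimately show ?thesis by (simp add: vec_eq_iff)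
  qed
  have lb: "lborel = density (distr lborel borel (\<lambda>x. A *v x)) (\<lambda>_. ennreal \<bar>det A\<bar>)"
    using lborel_affine_euclidean[of c 0, OF cnz]
    by (simp add: T dt prod_Basis_cart c_axis abs_prod)
  show ?case
    by (subst lb) (simp add: nn_integral_density nn_integral_distr nn_integral_cmult)
next
  case (4 m n)
  note [measurable] = "4.prems"(2)
  let ?A = "\<chi> i j. mat 1 $ i $ Transposition.transpose m n j :: real^'n^'n"
  have d: "\<bar>det ?A\<bar> = 1"
    by (simp add: det_permute_columns permutes_swap_id abs_mult sign_def)
  have v: "?A *v x = (\<chi> i. x $ Transposition.transpose m n i)" for x :: "real^'n"
  proof -
    have "(\<Sum>j\<in>UNIV. (if i = Transposition.transpose m n j then 1 else 0) * x $ j) =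
        x $ Transposition.transpose m n i" for i
      by (subst sum.remove[of _ "Transposition.transpose m n i"])
        (auto intro!: sum.neutral split: if_splits)
    then show ?thesis by (simp add: vec_eq_iff matrix_vector_mult_def mat_def)
  qed
  have [measurable]: "(\<lambda>x :: real^'n. \<chi> i. x $ Transposition.transpose m n i) \<in> borel_measurable borel"
    by (intro borel_measurable_continuous_onI continuous_intros)
  show ?case
    unfolding d v by (subst lborel_swap_coordinates[of m n]) (simp add: nn_integral_distr)
next
  case (5 m n)
  let ?A = "\<chi> i j. of_bool (i = m \<and> j = n \<or> i = j) :: real^'n^'n"
  have "?A = (\<chi> k. if k = m then row m (mat 1) + 1 *s row n (mat 1) else row k (mat 1))"
    using "5.hyps" by (auto simp: vec_eq_iff row_def mat_def)
  then have d: "det ?A = 1" using det_row_operation[OF "5.hyps", of "mat 1 :: real^'n^'n" 1] by simp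
  have v: "?A *v x = x + (x $ n) *\<^sub>R axis m 1" for x :: "real^'n"
  proof -
    have "(\<Sum>j\<in>UNIV. of_bool (i = m \<and> j = n \<or> i = j) * x $ j) = x $ i + (if i = m then x $ n else 0)" for i
    proof -
      have "(\<Sum>j\<in>UNIV. of_bool (i = m \<and> j = n \<or> i = j) * x $ j) =
          (\<Sum>j\<in>UNIV. (if j = i then x $ j else 0) + (if j = n then (if i = m then x $ j else 0) else 0))"
        using "5.hyps" by (intro sum.cong) auto
      then show ?thesis by (simp add: sum.distrib)
    qed
    then show ?thesis by (simp add: vec_eq_iff matrix_vector_mult_def axis_def)
  qed
  show ?case
    unfolding d v using nn_integral_shear[OF "5.hyps" "5.prems"(2)] by simp
qed

lemma nn_integral_standard_gaussian_real:
  "(\<integral>\<^sup>+ x. ennreal (exp (- x\<^sup>2 / 2)) \<partial>lborel) = ennreal (sqrt (2 * pi))"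
proof -
  interpret prob_space "density lborel (std_normal_density)"
    by (rule prob_space_normal_density) simp
  have "(\<integral>\<^sup>+ x. ennreal (exp (- x\<^sup>2 / 2)) \<partial>lborel) =
      (\<integral>\<^sup>+ x. ennreal (sqrt (2 * pi)) * ennreal (std_normal_density x) \<partial>lborel)"
    by (intro nn_integral_cong) (simp add: normal_density_def flip: ennreal_mult)
  also have "\<dots> = ennreal (sqrt (2 * pi)) * emeasure (density lborel std_normal_density) UNIV"
    by (simp add: nn_integral_cmult emeasure_density)
  finally show ?thesis using emeasure_space_1 by simp
qed

lemma nn_integral_standard_gaussian:
  "(\<integral>\<^sup>+ x. ennreal (exp (- (x \<bullet> x) / 2)) \<partial>(lborel :: 'a::euclidean_space measure)) =
     ennreal (sqrt ((2 * pi) ^ DIM('a)))"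
proof -
  have "(\<integral>\<^sup>+ x. ennreal (exp (- (x \<bullet> x) / 2)) \<partial>(lborel :: 'a measure)) =
     (\<integral>\<^sup>+ x. (\<Prod>b\<in>Basis. ennreal (exp (- (x \<bullet> b)\<^sup>2 / 2))) \<partial>(lborel :: 'a measure))"
  proof (intro nn_integral_cong)
    fix x :: 'a
    have "x \<bullet> x = (\<Sum>b\<in>Basis. (x \<bullet> b)\<^sup>2)"
      by (subst euclidean_inner) (simp add: power2_eq_square)
    then show "ennreal (exp (- (x \<bullet> x) / 2)) = (\<Prod>b\<in>Basis. ennreal (exp (- (x \<bullet> b)\<^sup>2 / 2)))"
      by (simp add: prod_ennreal exp_sum sum_negf sum_divide_distrib flip: exp_sum)
  qed
  also have "\<dots> = (\<Prod>b\<in>(Basis :: 'a set). ennreal (sqrt (2 * pi)))"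
    by (subst nn_integral_lborel_prod) (auto simp: nn_integral_standard_gaussian_real[simplified])
  finally show ?thesis by (simp add: ennreal_power real_sqrt_power real_sqrt_mult power_mult_distrib)
qed

text \<open>A congruence that turns \<open>K\<close> into the identity reduces this to the standard Gaussian integral.\<close>

lemma nn_integral_gaussian:
  fixes K :: "real^'n^'n"
  assumes "sym_pos_def K"
  shows "(\<integral>\<^sup>+ x. ennreal (exp (- ((x - m) \<bullet> (K *v (x - m))) / 2)) \<partial>lborel) =
     ennreal (sqrt ((2 * pi) ^ CARD('n) / det K))"
proof -
  obtain V :: "real^'n^'n" and d where V: "transpose V ** K ** V = mat 1"
      and "transpose V ** mat 1 ** V = diag_mat d"
    by (rule simultaneous_congruence[OF assms transpose_mat[of 1]])
  have d: "det V * det V * det K = 1"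
    using arg_cong[OF V, of det] by (simp add: det_mul det_transpose mult_ac)
  then have dV: "det V \<noteq> 0" by auto
  have sq: "(V *v y) \<bullet> (K *v (V *v y)) = y \<bullet> y" for y
  proof -
    have "(V *v y) \<bullet> (K *v (V *v y)) = y \<bullet> ((transpose V ** K ** V) *v y)"
      by (metis dot_lmul_matrix inner_commute matrix_vector_mul_assoc transpose_matrix_vector)
    then show ?thesis by (simp add: V)
  qed
  have "(\<integral>\<^sup>+ x. ennreal (exp (- ((x - m) \<bullet> (K *v (x - m))) / 2)) \<partial>lborel) =
      (\<integral>\<^sup>+ x. ennreal (exp (- (x \<bullet> (K *v x)) / 2)) \<partial>lborel)"
    by (rule nn_integral_shift) measurable
  also have "\<dots> = ennreal \<bar>det V\<bar> * ennreal (sqrt ((2 * pi) ^ CARD('n)))"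
    by (subst nn_integral_linear_substitution[OF dV])
      (simp_all add: sq nn_integral_standard_gaussian[simplified])
  also have "\<dots> = ennreal (\<bar>det V\<bar> * sqrt ((2 * pi) ^ CARD('n)))"
    by (simp add: ennreal_mult)
  also have "\<bar>det V\<bar> = sqrt (1 / det K)"
  proof -
    have "1 / det K = (det V)\<^sup>2" using sym_pos_def_inverse(4)[OF assms] d
      by (simp add: divide_eq_eq power2_eq_square)
    then show ?thesis by simp
  qed
  finally show ?thesis by (simp add: real_sqrt_mult real_sqrt_divide)
qed

text \<open>The density in the definition of \<open>gaussian\<close>, as a real function.\<close>

definition gaussian_density :: "real^'n \<Rightarrow> real^'n^'n \<Rightarrow> real^'n \<Rightarrow> real" where
  "gaussian_density a A x =
     exp (- ((x - a) \<bullet> (matrix_inv A *v (x - a))) / 2) / sqrt ((2 * pi) ^ CARD('n) * det A)"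

lemma gaussian_eq_density: "gaussian a A = density lborel (\<lambda>x. ennreal (gaussian_density a A x))"
  by (simp add: gaussian_def gaussian_density_def)

lemma borel_measurable_gaussian_density[measurable]:
  assumes "f \<in> borel_measurable M"
  shows "(\<lambda>x. gaussian_density a A (f x)) \<in> borel_measurable M"
  using assms unfolding gaussian_density_def by measurable

lemma gaussian_density_pos:
  assumes "sym_pos_def A"
  shows "0 < gaussian_density a A x"
  using sym_pos_def_inverse(4)[OF assms] by (simp add: gaussian_density_def)

lemma det_matrix_inv_sym_pos_def:
  assumes "sym_pos_def A"
  shows "det (matrix_inv A) = 1 / det A"
  using sym_pos_def_inverse(4)[OF assms] arg_cong[OF sym_pos_def_inverse(1)[OF assms], of det]
  by (simp add: det_mul field_simps)

lemma nn_integral_gaussian_density: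
  assumes "sym_pos_def A"
  shows "(\<integral>\<^sup>+ x. ennreal (gaussian_density a A x) \<partial>lborel) = 1"
proof -
  let ?N = "sqrt ((2 * pi) ^ CARD('a) * det A)"
  have N: "?N > 0" using sym_pos_def_inverse(4)[OF assms] by simp
  have "(\<integral>\<^sup>+ x. ennreal (gaussian_density a A x) \<partial>lborel) =
     (\<integral>\<^sup>+ x. ennreal (1 / ?N) * ennreal (exp (- ((x - a) \<bullet> (matrix_inv A *v (x - a))) / 2)) \<partial>lborel)"
    using N by (intro nn_integral_cong) (simp add: gaussian_density_def flip: ennreal_mult)
  also have "\<dots> = ennreal (1 / ?N) * ennreal (sqrt ((2 * pi) ^ CARD('a) / det (matrix_inv A)))"
    by (subst nn_integral_cmult)
      (simp_all add: nn_integral_gaussian[OF sym_pos_def_inverse(3)[OF assms], simplified])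
  also have "\<dots> = ennreal (1 / ?N * ?N)"
    using N by (simp add: det_matrix_inv_sym_pos_def[OF assms] flip: ennreal_mult)
  also have "1 / ?N * ?N = 1" using N by (metis less_irrefl nonzero_divide_eq_eq)
  finally show ?thesis by simp
qed

lemma sym_pos_def_lower_bound:
  fixes K :: "real^'n^'n"
  assumes "sym_pos_def K"
  obtains \<epsilon> where "\<epsilon> > 0" "\<And>x. \<epsilon> * (norm x)\<^sup>2 \<le> x \<bullet> (K *v x)"
proof -
  obtain V :: "real^'n^'n" and d where V: "transpose V ** K ** V = mat 1"
      and "transpose V ** mat 1 ** V = diag_mat d"
    by (rule simultaneous_congruence[OF assms transpose_mat[of 1]])
  define U where "U = transpose V ** K"
  have "V ** U = mat 1" using V matrix_left_right_inverse by (auto simp: U_def)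
  define B where "B = onorm ((*v) V) + 1"
  have B: "B > 0" using onorm_pos_le[OF matrix_vector_mul_bounded_linear, of V]
    by (simp add: B_def)
  have "1 / B\<^sup>2 * (norm x)\<^sup>2 \<le> x \<bullet> (K *v x)" for x
  proof -
    define y where "y = U *v x"
    have x: "V *v y = x" by (simp add: y_def matrix_vector_mul_assoc \<open>V ** U = mat 1\<close>)
    have "norm (V *v y) \<le> onorm ((*v) V) * norm y"
      by (rule onorm[OF matrix_vector_mul_bounded_linear])
    also have "\<dots> \<le> B * norm y" by (intro mult_right_mono) (auto simp: B_def)
    finally have "(norm x)\<^sup>2 \<le> (B * norm y)\<^sup>2" unfolding x by (intro power_mono) auto
    also have "\<dots> = B\<^sup>2 * (y \<bullet> y)" by (simp add: power_mult_distrib power2_norm_eq_inner)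
    also have "y \<bullet> y = y \<bullet> ((transpose V ** K ** V) *v y)" by (simp add: V)
    also have "\<dots> = (V *v y) \<bullet> (K *v (V *v y))"
      by (metis dot_lmul_matrix inner_commute matrix_vector_mul_assoc transpose_matrix_vector)
    finally show ?thesis using B unfolding x by (simp add: field_simps)
  qed
  then show ?thesis using B by (intro that[of "1 / B\<^sup>2"]) auto
qed

text \<open>The quadratic factor is absorbed by half of the exponent, which leaves the Gaussian integral for
  \<open>K/2\<close>.\<close>

lemma nn_integral_gaussian_second_moment:
  fixes A :: "real^'n^'n"
  assumes A: "sym_pos_def A"
  shows "(\<integral>\<^sup>+ x. ennreal (gaussian_density a A x * (norm x)\<^sup>2) \<partial>lborel) < \<infinity>"
proof -
  define K where "K = matrix_inv A"
  have K: "sym_pos_def K" using sym_pos_def_inverse(3)[OF A] by (simp add: K_def)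
  have K2: "sym_pos_def ((1/2) *\<^sub>R K)"
    using K by (simp add: sym_pos_def_def transpose_scalar flip: scaleR_matrix_vector_assoc)
  obtain \<epsilon> where \<epsilon>: "\<epsilon> > 0" "\<And>x. \<epsilon> * (norm x)\<^sup>2 \<le> x \<bullet> (K *v x)"
    using sym_pos_def_lower_bound[OF K] by blast
  define N where "N = sqrt ((2 * pi) ^ CARD('n) * det A)"
  have N: "N > 0" using sym_pos_def_inverse(4)[OF A] by (simp add: N_def)
  have bound: "gaussian_density a A x * (norm x)\<^sup>2 \<le>
      (8 / (\<epsilon> * N)) * exp (- ((x - a) \<bullet> (((1/2) *\<^sub>R K) *v (x - a))) / 2)
      + 2 * (norm a)\<^sup>2 * gaussian_density a A x" for x
  proof -
    define Q where "Q = (x - a) \<bullet> (K *v (x - a))"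
    have "(norm x)\<^sup>2 \<le> (norm (x - a) + norm a)\<^sup>2"
      using norm_triangle_ineq[of "x - a" a] by (intro power_mono) auto
    also have "\<dots> \<le> 2 * (norm (x - a))\<^sup>2 + 2 * (norm a)\<^sup>2"
      using zero_le_power2[of "norm (x - a) - norm a"] by (simp add: power2_eq_square algebra_simps)
    also have "(norm (x - a))\<^sup>2 \<le> Q / \<epsilon>"
      using \<epsilon>(2)[of "x - a"] \<epsilon>(1) by (simp add: Q_def field_simps)
    finally have 1: "(norm x)\<^sup>2 \<le> 2 * (Q / \<epsilon>) + 2 * (norm a)\<^sup>2" by simp
    have "Q / 4 \<le> exp (Q / 4)" using exp_ge_add_one_self[of "Q / 4"] by linarith
    then have "Q * exp (- Q / 2) \<le> 4 * exp (Q / 4) * exp (- Q / 2)"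
      by (intro mult_right_mono) auto
    also have "\<dots> = 4 * exp (- Q / 4)" by (simp flip: exp_add)
    finally have 2: "Q * exp (- Q / 2) \<le> 4 * exp (- Q / 4)" .
    have g: "gaussian_density a A x = exp (- Q / 2) / N"
      by (simp add: gaussian_density_def Q_def K_def N_def)
    have "gaussian_density a A x * (norm x)\<^sup>2 \<le>
        gaussian_density a A x * (2 * (Q / \<epsilon>) + 2 * (norm a)\<^sup>2)"
      using gaussian_density_pos[OF A, of a x] 1 by (intro mult_left_mono) auto
    also have "\<dots> = (2 / (\<epsilon> * N)) * (Q * exp (- Q / 2)) + 2 * (norm a)\<^sup>2 * gaussian_density a A x"
      by (simp add: g algebra_simps)
    also have "\<dots> \<le> (2 / (\<epsilon> * N)) * (4 * exp (- Q / 4)) + 2 * (norm a)\<^sup>2 * gaussian_density a A x"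
      using N \<epsilon>(1) 2 by (intro add_right_mono mult_left_mono) auto
    finally show ?thesis
      by (simp add: Q_def flip: scaleR_matrix_vector_assoc)
  qed
  have "(\<integral>\<^sup>+ x. ennreal (gaussian_density a A x * (norm x)\<^sup>2) \<partial>lborel) \<le>
     (\<integral>\<^sup>+ x. ennreal (8 / (\<epsilon> * N)) * ennreal (exp (- ((x - a) \<bullet> (((1/2) *\<^sub>R K) *v (x - a))) / 2))
      + ennreal (2 * (norm a)\<^sup>2) * ennreal (gaussian_density a A x) \<partial>lborel)"
    using bound N \<epsilon>(1) gaussian_density_pos[OF A, THEN less_imp_le]
    by (intro nn_integral_mono) (simp add: ennreal_leI flip: ennreal_mult ennreal_plus)
  also have "\<dots> = ennreal (8 / (\<epsilon> * N)) *
      (\<integral>\<^sup>+ x. ennreal (exp (- ((x - a) \<bullet> (((1/2) *\<^sub>R K) *v (x - a))) / 2)) \<partial>lborel)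
      + ennreal (2 * (norm a)\<^sup>2) * (\<integral>\<^sup>+ x. ennreal (gaussian_density a A x) \<partial>lborel)"
    by (subst nn_integral_add) (measurable, simp add: nn_integral_cmult)
  also have "\<dots> < \<infinity>"
    unfolding nn_integral_gaussian[OF K2] nn_integral_gaussian_density[OF A]
    by (simp add: ennreal_mult_less_top)
  finally show ?thesis .
qed

section \<open>Gaussian measures on a product space\<close>

lemma sum_UNIV_Plus:
  fixes f :: "('m::finite + 'n::finite) \<Rightarrow> real"
  shows "(\<Sum>i\<in>UNIV. f i) = (\<Sum>i\<in>UNIV. f (Inl i)) + (\<Sum>j\<in>UNIV. f (Inr j))"
  by (subst UNIV_Plus_UNIV[symmetric], subst sum.Plus) auto

lemma prod_UNIV_Plus:
  fixes f :: "('m::finite + 'n::finite) \<Rightarrow> real"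
  shows "(\<Prod>i\<in>UNIV. f i) = (\<Prod>i\<in>UNIV. f (Inl i)) * (\<Prod>j\<in>UNIV. f (Inr j))"
  by (subst UNIV_Plus_UNIV[symmetric], subst prod.Plus) auto

lemma block_vec_nth[simp]:
  "block_vec u v $ Inl i = u $ i" "block_vec u v $ Inr j = v $ j"
  by (simp_all add: block_vec_def)

lemma vec_eq_iff_Plus:
  fixes u v :: "'a^('m::finite + 'n::finite)"
  shows "u = v \<longleftrightarrow> (\<forall>i. u $ Inl i = v $ Inl i) \<and> (\<forall>j. u $ Inr j = v $ Inr j)"
  unfolding vec_eq_iff by (metis sum.exhaust)

lemma split_block_vec: "split_vec (block_vec u v) = (u, v)"
  by (simp add: split_vec_def vec_eq_iff)

lemma block_split_vec: "block_vec (fst (split_vec z)) (snd (split_vec z)) = z"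
  by (simp add: split_vec_def vec_eq_iff_Plus)

lemma obtain_block_vec:
  fixes z :: "real^('m::finite + 'n::finite)"
  obtains u v where "z = block_vec u v"
  using block_split_vec by metis

lemma block_vec_diff: "block_vec x y - block_vec a b = block_vec (x - a) (y - b)"
  by (simp add: vec_eq_iff_Plus)

lemma inner_block_vec: "block_vec x y \<bullet> block_vec a b = x \<bullet> a + y \<bullet> b"
  by (simp add: inner_vec_def sum_UNIV_Plus)

lemma block_mat_nth[simp]:
  "block_mat P Q R S $ Inl i $ Inl j = P $ i $ j"
  "block_mat P Q R S $ Inl i $ Inr l = Q $ i $ l"
  "block_mat P Q R S $ Inr k $ Inl j = R $ k $ j"
  "block_mat P Q R S $ Inr k $ Inr l = S $ k $ l"
  by (simp_all add: block_mat_def)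

lemma block_mat_mult_block_vec:
  "block_mat P Q R S *v block_vec u v = block_vec (P *v u + Q *v v) (R *v u + S *v v)"
  by (simp add: vec_eq_iff_Plus matrix_vector_mult_def sum_UNIV_Plus)

lemma block_mat_mult:
  "block_mat P Q R S ** block_mat P' Q' R' S' =
   block_mat (P ** P' + Q ** R') (P ** Q' + Q ** S') (R ** P' + S ** R') (R ** Q' + S ** S')"
  by (simp add: vec_eq_iff_Plus matrix_matrix_mult_def sum_UNIV_Plus)

lemma block_mat_one: "block_mat (mat 1) 0 0 (mat 1) = mat 1"
  by (auto simp: vec_eq_iff_Plus mat_def)

lemma transpose_block_mat:
  "transpose (block_mat P Q R S) = block_mat (transpose P) (transpose R) (transpose Q) (transpose S)"
  by (simp add: vec_eq_iff_Plus transpose_def)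

lemma borel_measurable_split_vec[measurable]: 
  "(split_vec :: real^('m::finite + 'n::finite) \<Rightarrow> _) \<in> borel \<rightarrow>\<^sub>M borel"
  unfolding split_vec_def
  by (intro borel_measurable_continuous_onI continuous_intros)

lemma borel_measurable_block_vec[measurable]:
  "(\<lambda>p. block_vec (fst p) (snd p) :: real^('m::finite + 'n::finite)) \<in> borel \<rightarrow>\<^sub>M borel"
proof (intro borel_measurable_continuous_onI)
  show "continuous_on UNIV (\<lambda>p. block_vec (fst p) (snd p) :: real^('m + 'n))"
    unfolding block_vec_def
  proof (intro continuous_on_vec_lambda)
    fix i :: "'m + 'n"
    show "continuous_on UNIV (\<lambda>p. case i of Inl k \<Rightarrow> fst p $ k | Inr k \<Rightarrow> snd p $ k)"
      by (cases i) (auto intro!: continuous_intros)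
  qed
qed

lemma lborel_split_vec:
  "distr lborel borel (split_vec :: real^('m::finite + 'n::finite) \<Rightarrow> _) = lborel"
proof (rule lborel_eqI[symmetric])
  fix l u :: "(real^'m) \<times> (real^'n)"
  assume lu: "\<And>b. b \<in> Basis \<Longrightarrow> l \<bullet> b \<le> u \<bullet> b"
  obtain l1 l2 u1 u2 where lu_eq: "l = (l1, l2)" "u = (u1, u2)" by (metis surj_pair)
  have 1: "l1 $ i \<le> u1 $ i" for i
    using lu[of "(axis i 1, 0)"] by (simp add: lu_eq Basis_prod_def inner_axis)
  have 2: "l2 $ i \<le> u2 $ i" for i
    using lu[of "(0, axis i 1)"] by (simp add: lu_eq Basis_prod_def inner_axis)
  have bx: "box l u = box l1 u1 \<times> box l2 u2" by (simp add: lu_eq box_prod)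
  have "emeasure (distr lborel borel split_vec) (box l u) =
      emeasure lborel (split_vec -` box l u :: (real^('m + 'n)) set)"
    by (subst emeasure_distr) auto
  also have "split_vec -` box l u = (box (block_vec l1 l2) (block_vec u1 u2) :: (real^('m + 'n)) set)"
  proof -
    have "split_vec z \<in> box l u \<longleftrightarrow> z \<in> box (block_vec l1 l2) (block_vec u1 u2)" for z :: "real^('m + 'n)"
    proof -
      obtain x y where z: "z = block_vec x y" by (rule obtain_block_vec)
      have "(\<forall>k :: 'm + 'n. P k) \<longleftrightarrow> (\<forall>i. P (Inl i)) \<and> (\<forall>j. P (Inr j))" for P
        by (metis sum.exhaust)
      then show ?thesis unfolding z split_block_vec bx by (simp add: mem_box_cart)
    qed
    then show ?thesis by (intro set_eqI) (simp only: vimage_eq)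
  qed
  also have "emeasure lborel \<dots> =
      ennreal ((\<Prod>i\<in>UNIV. u1 $ i - l1 $ i) * (\<Prod>i\<in>UNIV. u2 $ i - l2 $ i))"
  proof -
    have "block_vec l1 l2 $ k \<le> block_vec u1 u2 $ k" for k :: "'m + 'n"
      using 1 2 by (cases k) auto
    then show ?thesis by (subst emeasure_lborel_box_cart) (auto simp: prod_UNIV_Plus)
  qed
  also have "\<dots> = emeasure lborel (box l1 u1) * emeasure lborel (box l2 u2)"
    using 1 2 by (simp add: emeasure_lborel_box_cart prod_nonneg ennreal_mult)
  also have "\<dots> = emeasure lborel (box l u)"
    unfolding bx lborel_prod[symmetric] by (subst lborel.emeasure_pair_measure_Times) auto
  also have "\<dots> = (\<Prod>b\<in>Basis. (u - l) \<bullet> b)" using lu by (rule emeasure_lborel_box)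
  finally show "emeasure (distr lborel borel split_vec) (box l u) =
      ennreal (\<Prod>b\<in>Basis. (u - l) \<bullet> b)" .
qed simp

text \<open>The density of \<open>gaussian_pair\<close> with respect to Lebesgue measure on the product space.\<close>

lemma gaussian_pair_eq_density:
  "gaussian_pair \<mu> H =
     density lborel (\<lambda>p. ennreal (gaussian_density \<mu> H (block_vec (fst p) (snd p))))"
  unfolding gaussian_pair_def gaussian_eq_density
proof -
  have "density (distr lborel borel (split_vec :: real^('a + 'b) \<Rightarrow> _))
      (\<lambda>p. ennreal (gaussian_density \<mu> H (block_vec (fst p) (snd p)))) =
    distr (density lborel (\<lambda>x. ennreal (gaussian_density \<mu> H x))) borel split_vec"
    by (subst density_distr) (simp_all add: block_split_vec)
  then show "distr (density lborel (\<lambda>x. ennreal (gaussian_density \<mu> H x))) borel split_vec =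
     density lborel (\<lambda>p. ennreal (gaussian_density \<mu> H (block_vec (fst p) (snd p))))"
    by (simp add: lborel_split_vec)
qed

text \<open>Completing the square in \<open>v\<close>; what remains in \<open>u\<close> is the Schur complement of \<open>S\<close>.\<close>

lemma complete_square:
  fixes P S :: "real^'n^'n" and u v :: "real^'n"
  assumes S: "sym_pos_def S"
  shows "u \<bullet> (P *v u) - 2 * k * (u \<bullet> v) + v \<bullet> (S *v v) =
    u \<bullet> ((P - k\<^sup>2 *\<^sub>R matrix_inv S) *v u) +
    (v - k *\<^sub>R (matrix_inv S *v u)) \<bullet> (S *v (v - k *\<^sub>R (matrix_inv S *v u)))"
proof -
  define T where "T = matrix_inv S"
  have ST: "S ** T = mat 1" and Ss: "transpose S = S"
    using sym_pos_def_inverse[OF S] S by (auto simp: T_def sym_pos_def_def)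
  have "S *v (T *v u) = u" by (simp add: matrix_vector_mul_assoc ST)
  moreover have "(T *v u) \<bullet> (S *v v) = v \<bullet> u"
    using inner_matrix_symmetric[OF Ss] calculation by metis
  ultimately show ?thesis
    unfolding T_def[symmetric]
    by (simp add: matrix_vector_mult_diff_distrib matrix_vector_mult_scaleR inner_diff_left
        inner_diff_right matrix_vector_mult_diff_rdistrib inner_commute power2_eq_square
        algebra_simps flip: scaleR_matrix_vector_assoc)
qed

text \<open>The integral over the second variable of a Gaussian whose inverse covariance has blocks \<open>P\<close>,
  \<open>- k\<close>, \<open>- k\<close>, \<open>S\<close>.\<close>

lemma nn_integral_gaussian_fibre:
  fixes P S :: "real^'n^'n" and u b :: "real^'n"
  assumes S: "sym_pos_def S"
  shows "(\<integral>\<^sup>+ y. ennreal (exp (- (u \<bullet> (P *v u) - 2 * k * (u \<bullet> (y - b)) + (y - b) \<bullet> (S *v (y - b))) / 2)) \<partial>lborel)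
    = ennreal (exp (- (u \<bullet> ((P - k\<^sup>2 *\<^sub>R matrix_inv S) *v u)) / 2) * sqrt ((2 * pi) ^ CARD('n) / det S))"
proof -
  define T where "T = matrix_inv S"
  define m where "m = b + k *\<^sub>R (T *v u)"
  have sq: "u \<bullet> (P *v u) - 2 * k * (u \<bullet> (y - b)) + (y - b) \<bullet> (S *v (y - b)) =
      u \<bullet> ((P - k\<^sup>2 *\<^sub>R T) *v u) + (y - m) \<bullet> (S *v (y - m))" for y
    using complete_square[OF S, of u P k "y - b"] by (simp add: T_def m_def diff_diff_eq)
  have meas: "(\<lambda>y. ennreal (exp (- ((y - m) \<bullet> (S *v (y - m))) / 2))) \<in> borel_measurable lborel"
    by measurable
  have "(\<integral>\<^sup>+ y. ennreal (exp (- (u \<bullet> (P *v u) - 2 * k * (u \<bullet> (y - b)) + (y - b) \<bullet> (S *v (y - b))) / 2)) \<partial>lborel)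
    = (\<integral>\<^sup>+ y. ennreal (exp (- (u \<bullet> ((P - k\<^sup>2 *\<^sub>R T) *v u)) / 2)) *
         ennreal (exp (- ((y - m) \<bullet> (S *v (y - m))) / 2)) \<partial>lborel)"
    unfolding sq by (intro nn_integral_cong) (simp add: diff_divide_distrib add_divide_distrib flip: ennreal_mult exp_add)
  also have "\<dots> = ennreal (exp (- (u \<bullet> ((P - k\<^sup>2 *\<^sub>R T) *v u)) / 2)) *
      ennreal (sqrt ((2 * pi) ^ CARD('n) / det S))"
    by (subst nn_integral_cmult[OF meas]) (simp only: nn_integral_gaussian[OF S])
  finally show ?thesis by (simp add: T_def flip: ennreal_mult')
qed

lemma distr_density_marginal:
  fixes g :: "'a::euclidean_space \<times> 'b::euclidean_space \<Rightarrow> ennreal"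
  assumes "g \<in> borel_measurable borel"
  shows "distr (density lborel g) borel fst = density lborel (\<lambda>x. \<integral>\<^sup>+ y. g (x, y) \<partial>lborel)"
    and "distr (density lborel g) borel snd = density lborel (\<lambda>y. \<integral>\<^sup>+ x. g (x, y) \<partial>lborel)"
proof -
  have g[measurable]: "g \<in> borel_measurable (lborel \<Otimes>\<^sub>M lborel)"
    using assms by (simp add: lborel_prod)
  have fst_snd: "(fst :: 'a \<times> 'b \<Rightarrow> 'a) \<in> borel_measurable borel" "(snd :: 'a \<times> 'b \<Rightarrow> 'b) \<in> borel_measurable borel"
    by (auto intro!: borel_measurable_continuous_onI continuous_intros)
  show "distr (density lborel g) borel fst = density lborel (\<lambda>x. \<integral>\<^sup>+ y. g (x, y) \<partial>lborel)"
  proof (rule measure_eqI)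
    fix A assume "A \<in> sets (distr (density lborel g) borel fst)"
    then have A[measurable]: "A \<in> sets borel" by simp
    have "emeasure (distr (density lborel g) borel fst) A = emeasure (density lborel g) (fst -` A)"
      using fst_snd(1) by (subst emeasure_distr) auto
    also have "\<dots> = (\<integral>\<^sup>+ p. g p * indicator A (fst p) \<partial>lborel)"
      using measurable_sets_borel[OF fst_snd(1) A] assms
      by (subst emeasure_density) (auto intro!: nn_integral_cong split: split_indicator)
    also have "\<dots> = (\<integral>\<^sup>+ x. (\<integral>\<^sup>+ y. g (x, y) * indicator A x \<partial>lborel) \<partial>lborel)"
      unfolding lborel_prod[symmetric] by (subst lborel.nn_integral_fst[symmetric]) auto
    also have "\<dots> = emeasure (density lborel (\<lambda>x. \<integral>\<^sup>+ y. g (x, y) \<partial>lborel)) A"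
      by (simp add: emeasure_density nn_integral_multc)
    finally show "emeasure (distr (density lborel g) borel fst) A =
        emeasure (density lborel (\<lambda>x. \<integral>\<^sup>+ y. g (x, y) \<partial>lborel)) A" .
  qed simp
  show "distr (density lborel g) borel snd = density lborel (\<lambda>y. \<integral>\<^sup>+ x. g (x, y) \<partial>lborel)"
  proof (rule measure_eqI)
    fix A assume "A \<in> sets (distr (density lborel g) borel snd)"
    then have A[measurable]: "A \<in> sets borel" by simp
    have "emeasure (distr (density lborel g) borel snd) A = emeasure (density lborel g) (snd -` A)"
      using fst_snd(2) by (subst emeasure_distr) auto
    also have "\<dots> = (\<integral>\<^sup>+ p. g p * indicator A (snd p) \<partial>lborel)"
      using measurable_sets_borel[OF fst_snd(2) A] assms
      by (subst emeasure_density) (auto intro!: nn_integral_cong split: split_indicator)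
    also have "\<dots> = (\<integral>\<^sup>+ y. (\<integral>\<^sup>+ x. g (x, y) * indicator A y \<partial>lborel) \<partial>lborel)"
      unfolding lborel_prod[symmetric] by (subst lborel_pair.nn_integral_snd[symmetric]) auto
    also have "\<dots> = emeasure (density lborel (\<lambda>y. \<integral>\<^sup>+ x. g (x, y) \<partial>lborel)) A"
      by (simp add: emeasure_density nn_integral_multc)
    finally show "emeasure (distr (density lborel g) borel snd) A =
        emeasure (density lborel (\<lambda>y. \<integral>\<^sup>+ x. g (x, y) \<partial>lborel)) A" .
  qed simp
qed

text \<open>A Gaussian measure on the product space whose inverse covariance has blocks \<open>P\<close>, \<open>- k\<close>,
  \<open>- k\<close>, \<open>S\<close>: its marginals are Gaussian, with the Schur complements as inverse covariances.  Comparing the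
  normalising constants before and after integration gives the determinant of \<open>H\<close>.\<close>

lemma gaussian_pair_precision:
  fixes P S L1 L2 :: "real^'n^'n" and a b :: "real^'n" and H :: "real^('n + 'n)^('n + 'n)"
  assumes P: "sym_pos_def P" and S: "sym_pos_def S"
    and L1: "sym_pos_def L1" "L1 = P - k\<^sup>2 *\<^sub>R matrix_inv S"
    and L2: "sym_pos_def L2" "L2 = S - k\<^sup>2 *\<^sub>R matrix_inv P"
    and H: "H ** block_mat P (- k *\<^sub>R mat 1) (- k *\<^sub>R mat 1) S = mat 1"
  shows "sym_pos_def H"
    and "\<And>x y. (block_vec x y - block_vec a b) \<bullet> (matrix_inv H *v (block_vec x y - block_vec a b)) =
      (x - a) \<bullet> (P *v (x - a)) - 2 * k * ((x - a) \<bullet> (y - b)) + (y - b) \<bullet> (S *v (y - b))"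
    and "det H * det L1 * det S = 1"
    and "distr (gaussian_pair (block_vec a b) H) borel fst = gaussian a (matrix_inv L1)"
    and "distr (gaussian_pair (block_vec a b) H) borel snd = gaussian b (matrix_inv L2)"
proof -
  define K where "K = block_mat P (- k *\<^sub>R mat 1) (- k *\<^sub>R mat 1) S"
  have minus: "(- k *\<^sub>R mat 1) *v z = - (k *\<^sub>R z)" for z :: "real^'n"
    by (metis matrix_vector_mul_lid scaleR_matrix_vector_assoc scaleR_minus_left)
  have quad: "block_vec u v \<bullet> (K *v block_vec u v) = u \<bullet> (P *v u) - 2 * k * (u \<bullet> v) + v \<bullet> (S *v v)" for u v
    by (simp add: K_def block_mat_mult_block_vec inner_block_vec inner_add_right inner_diff_right minus
        inner_commute[of v u] del: scaleR_minus_left)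
  have K: "sym_pos_def K"
    unfolding sym_pos_def_def
  proof (intro conjI allI impI)
    have "transpose (- k *\<^sub>R mat 1 :: real^'n^'n) = - k *\<^sub>R mat 1"
      by (auto simp: vec_eq_iff transpose_def mat_def)
    then show "transpose K = K"
      using P S by (simp add: K_def transpose_block_mat sym_pos_def_def)
    fix z :: "real^('n + 'n)" assume z: "z \<noteq> 0"
    obtain u v where uv: "z = block_vec u v" by (rule obtain_block_vec)
    define m where "m = v - k *\<^sub>R (matrix_inv S *v u)"
    have eq: "z \<bullet> (K *v z) = u \<bullet> (L1 *v u) + m \<bullet> (S *v m)"
      unfolding uv quad complete_square[OF S] L1(2) m_def ..
    have nn: "0 \<le> u \<bullet> (L1 *v u)" "0 \<le> m \<bullet> (S *v m)"
      using L1(1) S unfolding sym_pos_def_def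
      by (metis inner_zero_left less_eq_real_def)+
    show "0 < z \<bullet> (K *v z)"
    proof (cases "u = 0")
      case True
      then have "m = v" by (simp add: m_def)
      then have "m \<noteq> 0" using z True by (auto simp: uv vec_eq_iff_Plus vec_eq_iff)
      then have "0 < m \<bullet> (S *v m)" using S by (simp add: sym_pos_def_def)
      then show ?thesis using nn unfolding eq by linarith
    next
      case False
      then have "0 < u \<bullet> (L1 *v u)" using L1(1) by (simp add: sym_pos_def_def)
      then show ?thesis using nn unfolding eq by linarith
    qed
  qed
  have HK: "matrix_inv H = K" using H by (simp add: matrix_inv_eqI K_def)
  have "K ** H = mat 1" using H matrix_left_right_inverse unfolding K_def by blast
  then have KH: "matrix_inv K = H" by (rule matrix_inv_eqI)
  show Hp: "sym_pos_def H" using sym_pos_def_inverse(3)[OF K] KH by simp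
  define N where "N = sqrt ((2 * pi) ^ (2 * CARD('n)) * det H)"
  have N: "0 < N" using sym_pos_def_inverse(4)[OF Hp] by (simp add: N_def)
  have card: "CARD('n + 'n) = 2 * CARD('n)" by simp
  show inv_quad: "(block_vec x y - block_vec a b) \<bullet> (matrix_inv H *v (block_vec x y - block_vec a b)) =
      (x - a) \<bullet> (P *v (x - a)) - 2 * k * ((x - a) \<bullet> (y - b)) + (y - b) \<bullet> (S *v (y - b))" for x y
    unfolding HK block_vec_diff quad ..
  have dens: "gaussian_density (block_vec a b) H (block_vec x y) =
      exp (- ((x - a) \<bullet> (P *v (x - a)) - 2 * k * ((x - a) \<bullet> (y - b)) + (y - b) \<bullet> (S *v (y - b))) / 2)
        / sqrt ((2 * pi) ^ (2 * CARD('n)) * det H)" for x y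
    unfolding gaussian_density_def inv_quad card ..
  have gm: "(\<lambda>p. ennreal (gaussian_density (block_vec a b) H (block_vec (fst p) (snd p)))) \<in> borel_measurable borel"
    by measurable
  have fib1: "(\<integral>\<^sup>+ y. ennreal (gaussian_density (block_vec a b) H (block_vec x y)) \<partial>lborel) =
      ennreal (1 / N * (exp (- ((x - a) \<bullet> (L1 *v (x - a))) / 2) * sqrt ((2 * pi) ^ CARD('n) / det S)))" for x
  proof -
    have "(\<integral>\<^sup>+ y. ennreal (gaussian_density (block_vec a b) H (block_vec x y)) \<partial>lborel) =
      (\<integral>\<^sup>+ y. ennreal (1 / N) * ennreal (exp (- ((x - a) \<bullet> (P *v (x - a)) - 2 * k * ((x - a) \<bullet> (y - b)) + (y - b) \<bullet> (S *v (y - b))) / 2)) \<partial>lborel)"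
      unfolding dens N_def[symmetric] using N by (intro nn_integral_cong) (simp flip: ennreal_mult)
    also have "\<dots> = ennreal (1 / N) * (\<integral>\<^sup>+ y. ennreal (exp (- ((x - a) \<bullet> (P *v (x - a)) - 2 * k * ((x - a) \<bullet> (y - b)) + (y - b) \<bullet> (S *v (y - b))) / 2)) \<partial>lborel)"
      by (rule nn_integral_cmult) measurable
    also have "\<dots> = ennreal (1 / N) * ennreal (exp (- ((x - a) \<bullet> (L1 *v (x - a))) / 2) * sqrt ((2 * pi) ^ CARD('n) / det S))"
      unfolding nn_integral_gaussian_fibre[OF S] L1(2) ..
    also have "\<dots> = ennreal (1 / N * (exp (- ((x - a) \<bullet> (L1 *v (x - a))) / 2) * sqrt ((2 * pi) ^ CARD('n) / det S)))"
      by (rule ennreal_mult'[symmetric]) (use N in simp)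
    finally show ?thesis .
  qed
  have perm: "p - 2 * k * (u \<bullet> v) + r = r - 2 * k * (v \<bullet> u) + p" for p r and u v :: "real^'n"
    by (simp add: inner_commute)
  have fib2: "(\<integral>\<^sup>+ x. ennreal (gaussian_density (block_vec a b) H (block_vec x y)) \<partial>lborel) =
      ennreal (1 / N * (exp (- ((y - b) \<bullet> (L2 *v (y - b))) / 2) * sqrt ((2 * pi) ^ CARD('n) / det P)))" for y
  proof -
    have "(\<integral>\<^sup>+ x. ennreal (gaussian_density (block_vec a b) H (block_vec x y)) \<partial>lborel) =
      (\<integral>\<^sup>+ x. ennreal (1 / N) * ennreal (exp (- ((y - b) \<bullet> (S *v (y - b)) - 2 * k * ((y - b) \<bullet> (x - a)) + (x - a) \<bullet> (P *v (x - a))) / 2)) \<partial>lborel)"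
      unfolding dens N_def[symmetric] using N
      by (intro nn_integral_cong, subst perm) (simp flip: ennreal_mult)
    also have "\<dots> = ennreal (1 / N) * (\<integral>\<^sup>+ x. ennreal (exp (- ((y - b) \<bullet> (S *v (y - b)) - 2 * k * ((y - b) \<bullet> (x - a)) + (x - a) \<bullet> (P *v (x - a))) / 2)) \<partial>lborel)"
      by (rule nn_integral_cmult) measurable
    also have "\<dots> = ennreal (1 / N) * ennreal (exp (- ((y - b) \<bullet> (L2 *v (y - b))) / 2) * sqrt ((2 * pi) ^ CARD('n) / det P))"
      unfolding nn_integral_gaussian_fibre[OF P] L2(2) ..
    also have "\<dots> = ennreal (1 / N * (exp (- ((y - b) \<bullet> (L2 *v (y - b))) / 2) * sqrt ((2 * pi) ^ CARD('n) / det P)))"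
      by (rule ennreal_mult'[symmetric]) (use N in simp)
    finally show ?thesis .
  qed
  \<comment> \<open>A probability density of Gaussian shape is a Gaussian density: the total mass fixes the constant.\<close>
  have normalised: "c * sqrt ((2 * pi) ^ CARD('n) / det L) = 1"
    "M = gaussian m (matrix_inv L)"
    if L: "sym_pos_def L" and c: "0 < c" and M: "emeasure M UNIV = 1"
      "M = density lborel (\<lambda>x. ennreal (c * exp (- ((x - m) \<bullet> (L *v (x - m))) / 2)))"
    for L :: "real^'n^'n" and c m M
  proof -
    have "emeasure M UNIV = (\<integral>\<^sup>+ x. ennreal c * ennreal (exp (- ((x - m) \<bullet> (L *v (x - m))) / 2)) \<partial>lborel)"
      unfolding M(2) using c by (simp add: emeasure_density ennreal_mult)
    also have "\<dots> = ennreal c * (\<integral>\<^sup>+ x. ennreal (exp (- ((x - m) \<bullet> (L *v (x - m))) / 2)) \<partial>lborel)"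
      by (rule nn_integral_cmult) measurable
    also have "\<dots> = ennreal (c * sqrt ((2 * pi) ^ CARD('n) / det L))"
      unfolding nn_integral_gaussian[OF L] using c by (simp add: ennreal_mult')
    finally show 1: "c * sqrt ((2 * pi) ^ CARD('n) / det L) = 1"
      using M(1) by (metis ennreal_eq_1)
    have il: "matrix_inv (matrix_inv L) = L"
      using sym_pos_def_inverse(2)[OF L] by (rule matrix_inv_eqI)
    have p: "0 < sqrt ((2 * pi) ^ CARD('n) / det L)" using sym_pos_def_inverse(4)[OF L] by simp
    then have "c = 1 / sqrt ((2 * pi) ^ CARD('n) / det L)" using 1 by (metis less_irrefl nonzero_eq_divide_eq)
    then have "c = 1 / sqrt ((2 * pi) ^ CARD('n) * det (matrix_inv L))"
      by (simp add: det_matrix_inv_sym_pos_def[OF L])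
    then show "M = gaussian m (matrix_inv L)"
      unfolding M(2) gaussian_def il by (simp add: mult.commute)
  qed
  let ?\<pi> = "gaussian_pair (block_vec a b) H"
  have fst_snd: "fst \<in> ?\<pi> \<rightarrow>\<^sub>M (borel :: (real^'n) measure)" "snd \<in> ?\<pi> \<rightarrow>\<^sub>M (borel :: (real^'n) measure)"
    unfolding gaussian_pair_def
    by (auto intro!: borel_measurable_continuous_onI continuous_intros)
  have tot: "emeasure ?\<pi> (space ?\<pi>) = 1"
    using nn_integral_gaussian_density[OF Hp]
    by (simp add: gaussian_pair_def gaussian_eq_density emeasure_distr emeasure_density)
  have m1: "emeasure (distr ?\<pi> borel fst) UNIV = 1" "emeasure (distr ?\<pi> borel snd) UNIV = 1"
    using tot fst_snd by (simp_all add: emeasure_distr)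
  have d1: "distr ?\<pi> borel fst = density lborel (\<lambda>x. ennreal ((1 / N * sqrt ((2 * pi) ^ CARD('n) / det S)) * exp (- ((x - a) \<bullet> (L1 *v (x - a))) / 2)))"
    unfolding gaussian_pair_eq_density distr_density_marginal(1)[OF gm] fst_conv snd_conv fib1 by (simp add: mult_ac)
  have d2: "distr ?\<pi> borel snd = density lborel (\<lambda>x. ennreal ((1 / N * sqrt ((2 * pi) ^ CARD('n) / det P)) * exp (- ((x - b) \<bullet> (L2 *v (x - b))) / 2)))"
    unfolding gaussian_pair_eq_density distr_density_marginal(2)[OF gm] fst_conv snd_conv fib2 by (simp add: mult_ac)
  have c0: "0 < 1 / N * sqrt ((2 * pi) ^ CARD('n) / det S)" "0 < 1 / N * sqrt ((2 * pi) ^ CARD('n) / det P)"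
    using N sym_pos_def_inverse(4)[OF S] sym_pos_def_inverse(4)[OF P] by simp_all
  show "distr ?\<pi> borel fst = gaussian a (matrix_inv L1)"
    by (rule normalised(2)[OF L1(1) c0(1) m1(1) d1])
  show "distr ?\<pi> borel snd = gaussian b (matrix_inv L2)"
    by (rule normalised(2)[OF L2(1) c0(2) m1(2) d2])
  have "1 / N * sqrt ((2 * pi) ^ CARD('n) / det S) * sqrt ((2 * pi) ^ CARD('n) / det L1) = 1"
    by (rule normalised(1)[OF L1(1) c0(1) m1(1) d1])
  then have "sqrt ((2 * pi) ^ CARD('n) / det S) * sqrt ((2 * pi) ^ CARD('n) / det L1) = N"
    using N by (simp add: field_simps)
  then have "sqrt ((2 * pi) ^ CARD('n) / det S * ((2 * pi) ^ CARD('n) / det L1)) = N"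
    by (simp only: real_sqrt_mult)
  then have "(2 * pi) ^ CARD('n) / det S * ((2 * pi) ^ CARD('n) / det L1) = (2 * pi) ^ (2 * CARD('n)) * det H"
    unfolding N_def by (simp only: real_sqrt_eq_iff)
  moreover have "(2 * pi) ^ (2 * CARD('n)) = (2 * pi) ^ CARD('n) * (2 * pi) ^ CARD('n)"
    by (simp only: mult_2[of "CARD('n)"] power_add)
  moreover define T where "T = (2 * pi) ^ CARD('n)"
  ultimately have "(T * T) * (1 / (det S * det L1)) = (T * T) * det H" by simp
  moreover have "T * T \<noteq> 0" by (simp add: T_def)
  ultimately have "1 / (det S * det L1) = det H" by (simp only: mult_cancel_left) blast
  then show "det H * det L1 * det S = 1"
    using sym_pos_def_inverse(4)[OF S] sym_pos_def_inverse(4)[OF L1(1)] by (simp add: field_simps)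
qed

lemma scale_measure_density_lborel:
  assumes "f \<in> borel_measurable borel" "\<And>x. 0 \<le> f x" "0 \<le> c"
  shows "scale_measure (ennreal c) (density lborel (\<lambda>x. ennreal (f x))) =
    density lborel (\<lambda>x. ennreal (c * f x))"
proof (rule measure_eqI)
  note [measurable] = assms(1)
  fix A assume "A \<in> sets (scale_measure (ennreal c) (density lborel (\<lambda>x. ennreal (f x))))"
  then have [measurable]: "A \<in> sets borel" by simp
  have "emeasure (density lborel (\<lambda>x. ennreal (c * f x))) A =
      (\<integral>\<^sup>+ x. ennreal c * (ennreal (f x) * indicator A x) \<partial>lborel)"
    using assms(2,3) by (simp add: emeasure_density ennreal_mult mult.assoc)
  also have "\<dots> = ennreal c * (\<integral>\<^sup>+ x. ennreal (f x) * indicator A x \<partial>lborel)"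
    by (rule nn_integral_cmult) measurable
  finally show "emeasure (scale_measure (ennreal c) (density lborel (\<lambda>x. ennreal (f x)))) A =
      emeasure (density lborel (\<lambda>x. ennreal (c * f x))) A"
    by (simp add: emeasure_density)
qed simp

lemma distr_scale_measure:
  assumes "f \<in> measurable M N"
  shows "distr (scale_measure c M) N f = scale_measure c (distr M N f)"
  using assms by (intro measure_eqI) (auto simp: emeasure_distr space_scale_measure)

lemma scaled_gaussian_eq_density:
  assumes "sym_pos_def A" "0 \<le> m"
  shows "scale_measure (ennreal m) (gaussian a A) = density lborel (\<lambda>x. ennreal (m * gaussian_density a A x))"
  unfolding gaussian_eq_density using assms gaussian_density_pos[OF assms(1), THEN less_imp_le]
  by (intro scale_measure_density_lborel) auto

lemma scaled_gaussian_mass: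
  assumes "sym_pos_def A" "0 \<le> m"
  shows "emeasure (scale_measure (ennreal m) (gaussian a A)) UNIV = ennreal m"
    "finite_measure (scale_measure (ennreal m) (gaussian a A))"
    "measure (scale_measure (ennreal m) (gaussian a A)) UNIV = m"
proof -
  show 1: "emeasure (scale_measure (ennreal m) (gaussian a A)) UNIV = ennreal m"
    using nn_integral_gaussian_density[OF assms(1)] by (simp add: gaussian_eq_density emeasure_density)
  have "space (scale_measure (ennreal m) (gaussian a A)) = UNIV"
    by (simp add: space_scale_measure gaussian_eq_density)
  then show "finite_measure (scale_measure (ennreal m) (gaussian a A))"
    using 1 by (intro finite_measureI) simp
  show "measure (scale_measure (ennreal m) (gaussian a A)) UNIV = m"
    using 1 assms(2) by (simp add: measure_def)
qed

lemma scaled_gaussian_pair: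
  fixes \<mu> :: "real^('m::finite + 'n::finite)" and H :: "real^('m + 'n)^('m + 'n)"
  assumes H: "sym_pos_def H" and m: "0 \<le> m"
  defines "\<pi> \<equiv> scale_measure (ennreal m) (gaussian_pair \<mu> H)"
  shows "\<pi> \<in> finite_second_moment_measures" "measure \<pi> UNIV = m"
    "\<pi> = density lborel (\<lambda>p. ennreal (m * gaussian_density \<mu> H (block_vec (fst p) (snd p))))"
proof -
  show dens: "\<pi> = density lborel (\<lambda>p. ennreal (m * gaussian_density \<mu> H (block_vec (fst p) (snd p))))"
    unfolding \<pi>_def gaussian_pair_eq_density using m gaussian_density_pos[OF H, THEN less_imp_le]
    by (intro scale_measure_density_lborel) auto
  have eq: "\<pi> = distr (scale_measure (ennreal m) (gaussian \<mu> H)) borel split_vec"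
    unfolding \<pi>_def gaussian_pair_def
    by (rule distr_scale_measure[symmetric]) (simp add: gaussian_eq_density)
  let ?G = "scale_measure (ennreal m) (gaussian \<mu> H)"
  have spl: "split_vec \<in> ?G \<rightarrow>\<^sub>M borel"
    unfolding scaled_gaussian_eq_density[OF H m] by simp
  interpret finite_measure ?G by (rule scaled_gaussian_mass(2)[OF H m])
  have fin: "finite_measure \<pi>" unfolding eq by (rule finite_measure_distr[OF spl])
  have spG: "space ?G = UNIV" by (simp add: scaled_gaussian_eq_density[OF H m])
  show "measure \<pi> UNIV = m"
    unfolding eq using scaled_gaussian_mass(3)[OF H m] spl spG by (subst measure_distr) auto
  have nrm: "(norm (split_vec z))\<^sup>2 = (norm z)\<^sup>2" for z :: "real^('m + 'n)"
  proof -
    obtain x y where z: "z = block_vec x y" by (rule obtain_block_vec)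
    show ?thesis unfolding z split_block_vec
      by (simp add: norm_prod_def power2_norm_eq_inner inner_block_vec)
  qed
  have "integrable \<pi> (\<lambda>p. (norm p)\<^sup>2)"
  proof -
    have "(\<integral>\<^sup>+ z. ennreal (m * gaussian_density \<mu> H z * (norm z)\<^sup>2) \<partial>lborel) =
        ennreal m * (\<integral>\<^sup>+ z. ennreal (gaussian_density \<mu> H z * (norm z)\<^sup>2) \<partial>lborel)"
      using m by (subst nn_integral_cmult[symmetric]) (auto simp: ennreal_mult' mult.assoc)
    also have "\<dots> < \<infinity>"
      using nn_integral_gaussian_second_moment[OF H] by (simp add: ennreal_mult_less_top)
    finally have "integrable lborel (\<lambda>z. m * gaussian_density \<mu> H z * (norm z)\<^sup>2)"
      using m gaussian_density_pos[OF H, THEN less_imp_le] by (intro integrableI_nonneg) auto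
    then have "integrable ?G (\<lambda>z. (norm z)\<^sup>2)"
      unfolding scaled_gaussian_eq_density[OF H m]
      using m gaussian_density_pos[OF H, THEN less_imp_le] by (subst integrable_density) auto
    then show ?thesis
      unfolding eq using spl by (subst integrable_distr_eq) (auto simp: nrm)
  qed
  then show "\<pi> \<in> finite_second_moment_measures"
    using fin unfolding finite_second_moment_measures_def by (simp add: \<pi>_def gaussian_pair_def)
qed

section \<open>Diagonalisable matrices and their principal square roots\<close>

lemma diag_mat_mult: "diag_mat f ** diag_mat g = diag_mat (\<lambda>i. f i * g i)"
  by (simp add: vec_eq_iff diag_mat_def matrix_matrix_mult_def if_distrib[of "\<lambda>x. x * y" for y]
      cong: if_cong)

lemma diag_mat_one: "diag_mat (\<lambda>_. 1) = mat 1"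
  by (simp add: vec_eq_iff diag_mat_def mat_def)

lemma diag_mat_add: "diag_mat f + diag_mat g = diag_mat (\<lambda>i. f i + g i)"
  by (simp add: vec_eq_iff diag_mat_def)

lemma diag_mat_diff: "diag_mat f - diag_mat g = diag_mat (\<lambda>i. f i - g i)"
  by (simp add: vec_eq_iff diag_mat_def)

lemma diag_mat_scale: "c *\<^sub>R diag_mat f = diag_mat (\<lambda>i. c * f i)"
  by (simp add: vec_eq_iff diag_mat_def)

lemma transpose_diag_mat[simp]: "transpose (diag_mat f) = diag_mat f"
  by (auto simp: vec_eq_iff diag_mat_def transpose_def)

lemma det_diag_mat: "det (diag_mat f) = (\<Prod>i\<in>UNIV. f i)"
  by (subst det_diagonal) (auto simp: diag_mat_def)

lemma diag_mat_mult_vec: "diag_mat f *v x = (\<chi> i. f i * x $ i)"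
  by (simp add: vec_eq_iff diag_mat_def matrix_vector_mult_def if_distrib[of "\<lambda>x. x * y" for y]
      cong: if_cong)

lemma matrix_diff_ldistrib: "A ** (B - C) = A ** B - A ** C" for A :: "real^'n^'m"
  by (simp add: matrix_matrix_mult_def vec_eq_iff right_diff_distrib sum_subtractf)

lemma matrix_diff_rdistrib: "(A - B) ** C = A ** C - B ** C" for A :: "real^'n^'m"
  by (simp add: matrix_matrix_mult_def vec_eq_iff left_diff_distrib sum_subtractf)

lemma matrix_add_rdistrib': "(A + B) ** C = A ** C + B ** C" for A :: "real^'n^'m"
  by (simp add: matrix_matrix_mult_def vec_eq_iff distrib_right sum.distrib)

lemma matrix_scaleR_left: "(c *\<^sub>R A) ** B = c *\<^sub>R (A ** B)" for A :: "real^'n^'m"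
  by (simp add: matrix_matrix_mult_def vec_eq_iff sum_distrib_left mult.assoc)

lemma matrix_scaleR_right: "A ** (c *\<^sub>R B) = c *\<^sub>R (A ** B)" for A :: "real^'n^'m"
  by (simp add: matrix_matrix_mult_def vec_eq_iff sum_distrib_left mult_ac)

lemmas matrix_ring_simps = matrix_diff_ldistrib matrix_diff_rdistrib matrix_add_ldistrib
  matrix_add_rdistrib' matrix_scaleR_left matrix_scaleR_right

text \<open>A diagonal matrix between two square matrices.  All matrices of the problem are brought to this
  form with \<open>L\<close> and \<open>R\<close> taken from a diagonalising matrix, its inverse and their transposes.\<close>

definition sandwich :: "real^'n^'n \<Rightarrow> ('n \<Rightarrow> real) \<Rightarrow> real^'n^'n \<Rightarrow> real^'n^'n" where
  "sandwich L f R = L ** diag_mat f ** R"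

text \<open>Products of sandwiched diagonal matrices are computed entrywise when the inner matrices cancel.\<close>

lemma sandwich_mult:
  assumes "M ** N = mat 1"
  shows "sandwich L f M ** sandwich N g R = sandwich L (\<lambda>i. f i * g i) R"
proof -
  have "sandwich L f M ** sandwich N g R = L ** diag_mat f ** (M ** N) ** diag_mat g ** R"
    by (simp add: sandwich_def matrix_mul_assoc)
  also have "\<dots> = L ** (diag_mat f ** diag_mat g) ** R"
    by (simp add: assms matrix_mul_assoc)
  finally show ?thesis by (simp add: sandwich_def diag_mat_mult)
qed

lemma sandwich_add: "sandwich L f R + sandwich L g R = sandwich L (\<lambda>i. f i + g i) R"
  by (simp add: sandwich_def matrix_ring_simps flip: diag_mat_add)

lemma sandwich_diff: "sandwich L f R - sandwich L g R = sandwich L (\<lambda>i. f i - g i) R"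
  by (simp add: sandwich_def matrix_ring_simps flip: diag_mat_diff)

lemma sandwich_scale: "c *\<^sub>R sandwich L f R = sandwich L (\<lambda>i. c * f i) R"
  by (simp add: sandwich_def matrix_ring_simps flip: diag_mat_scale)

lemma sandwich_one: "L ** R = mat 1 \<Longrightarrow> sandwich L (\<lambda>_. 1) R = mat 1"
  by (simp add: sandwich_def diag_mat_one)

lemma transpose_sandwich: "transpose (sandwich L f R) = sandwich (transpose R) f (transpose L)"
  by (simp add: sandwich_def matrix_transpose_mul matrix_mul_assoc)

lemma det_sandwich: "det (sandwich L f R) = det L * det R * (\<Prod>i\<in>UNIV. f i)"
  by (simp add: sandwich_def det_mul det_diag_mat mult_ac)

lemma sym_pos_def_sandwich:
  fixes R :: "real^'n^'n"
  assumes "L ** R = mat 1" "\<And>i. 0 < f i"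
  shows "sym_pos_def (sandwich (transpose R) f R)"
  unfolding sym_pos_def_def
proof (intro conjI allI impI)
  show "transpose (sandwich (transpose R) f R) = sandwich (transpose R) f R"
    by (simp add: transpose_sandwich)
  fix x :: "real^'n" assume "x \<noteq> 0"
  define y where "y = R *v x"
  have "L *v y = x" using assms(1) by (simp add: y_def matrix_vector_mul_assoc)
  then have "y \<noteq> 0" using \<open>x \<noteq> 0\<close> by auto
  then obtain i where i: "y $ i \<noteq> 0" by (auto simp: vec_eq_iff)
  have "x \<bullet> (sandwich (transpose R) f R *v x) = y \<bullet> (diag_mat f *v y)"
    unfolding sandwich_def y_def
    by (metis dot_lmul_matrix inner_commute matrix_vector_mul_assoc transpose_matrix_vector)
  also have "\<dots> = (\<Sum>i\<in>UNIV. f i * (y $ i)\<^sup>2)"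
    by (simp add: diag_mat_mult_vec inner_vec_def power2_eq_square mult_ac)
  also have "\<dots> > 0"
    using i assms(2) by (intro sum_pos2[of _ i]) (auto simp: less_imp_le)
  finally show "0 < x \<bullet> (sandwich (transpose R) f R *v x)" .
qed

lemma map_matrix_of_real_mult_vec:
  fixes M N :: "real^'n^'n" and v :: "complex^'n"
  shows "map_matrix complex_of_real (M ** N) *v v =
    map_matrix complex_of_real M *v (map_matrix complex_of_real N *v v)"
proof -
  have "map_matrix complex_of_real (M ** N) = map_matrix complex_of_real M ** map_matrix complex_of_real N"
    by (simp add: vec_eq_iff matrix_matrix_mult_def)
  then show ?thesis by (simp add: matrix_vector_mul_assoc)
qed

text \<open>The eigenvalues of a diagonalised matrix are diagonal entries.\<close>

lemma eigenvalue_of_sandwich: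
  assumes VU: "V ** U = mat 1" and "eigenvalue_of (sandwich V e U) z"
  shows "\<exists>i. z = complex_of_real (e i)"
proof -
  let ?c = "map_matrix complex_of_real"
  obtain v where v: "v \<noteq> 0" "?c (sandwich V e U) *v v = z *s v"
    using assms by (auto simp: eigenvalue_of_def)
  define w where "w = ?c U *v v"
  have UV: "U ** V = mat 1" using VU matrix_left_right_inverse by blast
  have one: "?c (mat 1) *v u = u" for u :: "complex^'a"
  proof -
    have "?c (mat 1) = (mat 1 :: complex^'a^'a)" by (simp add: vec_eq_iff mat_def)
    then show ?thesis by simp
  qed
  have "?c V *v w = v"
    unfolding w_def map_matrix_of_real_mult_vec[symmetric] VU by (rule one)
  then have "w \<noteq> 0" using v(1) by auto
  then obtain i where i: "w $ i \<noteq> 0" by (auto simp: vec_eq_iff)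
  have "?c V *v (?c (diag_mat e) *v w) = z *s v"
    using v(2) by (simp only: w_def sandwich_def map_matrix_of_real_mult_vec)
  then have "?c U *v (?c V *v (?c (diag_mat e) *v w)) = z *s w"
    by (simp add: w_def vector_scalar_commute)
  then have "?c (diag_mat e) *v w = z *s w"
    unfolding map_matrix_of_real_mult_vec[symmetric, of U V] UV one .
  then have "(?c (diag_mat e) *v w) $ i = z * w $ i" by simp
  moreover have "(?c (diag_mat e) *v w) $ i = complex_of_real (e i) * w $ i"
    by (simp add: matrix_vector_mult_def diag_mat_def if_distrib[of complex_of_real]
        if_distrib[of "\<lambda>x. x * y" for y] cong: if_cong)
  ultimately show ?thesis using i by auto
qed

lemma real_eigenvector_eigenvalue_of:
  fixes M :: "real^'n^'n"
  assumes "x \<noteq> 0" "M *v x = c *\<^sub>R x"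
  shows "eigenvalue_of M (complex_of_real c)"
  unfolding eigenvalue_of_def
proof (intro exI conjI)
  let ?x = "\<chi> i. complex_of_real (x $ i)"
  show "?x \<noteq> 0" using assms(1) by (auto simp: vec_eq_iff)
  have "(\<Sum>j\<in>UNIV. M $ i $ j * x $ j) = c * x $ i" for i
    using arg_cong[OF assms(2), of "\<lambda>v. v $ i"] by (simp add: matrix_vector_mult_def)
  then have "(\<Sum>j\<in>UNIV. complex_of_real (M $ i $ j) * complex_of_real (x $ j)) = of_real (c * x $ i)" for i
    by (simp flip: of_real_mult of_real_sum)
  then show "map_matrix complex_of_real M *v ?x = complex_of_real c *s ?x"
    by (simp add: vec_eq_iff matrix_vector_mult_def)
qed

text \<open>The principal square root of a real diagonalisable matrix with positive eigenvalues.  If \<open>R\<close> is another square root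
  with positive eigenvalues, then \<open>W = R - V e U\<close> maps an eigenvector of \<open>V e U\<close> with eigenvalue \<open>e i\<close> to an
  eigenvector of \<open>R\<close> with eigenvalue \<open>- e i\<close> or to \<open>0\<close>; the first is impossible, so \<open>W = 0\<close>.\<close>

lemma principal_sqrt_sandwich:
  fixes V U :: "real^'n^'n"
  assumes VU: "V ** U = mat 1" and e: "\<And>i. 0 < e i"
  shows "principal_sqrt (sandwich V (\<lambda>i. (e i)\<^sup>2) U) = sandwich V e U"
  unfolding principal_sqrt_def
proof (rule the_equality)
  have UV: "U ** V = mat 1" using VU matrix_left_right_inverse by blast
  let ?R = "sandwich V e U"
  have sq: "?R ** ?R = sandwich V (\<lambda>i. (e i)\<^sup>2) U"
    by (simp add: sandwich_mult[OF UV] power2_eq_square)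
  have pos: "z \<in> \<real> \<and> 0 < Re z" if "eigenvalue_of ?R z" for z
    using eigenvalue_of_sandwich[OF VU that] e by auto
  show "?R ** ?R = sandwich V (\<lambda>i. (e i)\<^sup>2) U \<and> (\<forall>z. eigenvalue_of ?R z \<longrightarrow> z \<in> \<real> \<and> 0 < Re z)"
    using sq pos by blast
  fix R assume R: "R ** R = sandwich V (\<lambda>i. (e i)\<^sup>2) U \<and> (\<forall>z. eigenvalue_of R z \<longrightarrow> z \<in> \<real> \<and> 0 < Re z)"
  define W where "W = R - ?R"
  \<comment> \<open>The difference of two square roots of the same matrix solves a homogeneous Sylvester equation.\<close>
  have syl: "R ** W = - (W ** ?R)"
    using R sq by (simp add: W_def matrix_diff_ldistrib matrix_diff_rdistrib)
  have eig: "?R *v (V *v axis i 1) = e i *\<^sub>R (V *v axis i 1)" for i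
  proof -
    have "?R *v (V *v axis i 1) = V *v (diag_mat e *v ((U ** V) *v axis i 1))"
      by (simp add: sandwich_def matrix_vector_mul_assoc matrix_mul_assoc)
    also have "\<dots> = V *v (e i *\<^sub>R axis i 1)"
    proof -
      have "diag_mat e *v axis i 1 = e i *\<^sub>R axis i 1"
        by (simp add: diag_mat_mult_vec vec_eq_iff axis_def)
      then show ?thesis by (simp add: UV)
    qed
    finally show ?thesis by (simp add: matrix_vector_mult_scaleR)
  qed
  have zero: "W *v (V *v axis i 1) = 0" for i
  proof (rule ccontr)
    assume nz: "W *v (V *v axis i 1) \<noteq> 0"
    have "R *v (W *v (V *v axis i 1)) = (R ** W) *v (V *v axis i 1)"
      by (simp add: matrix_vector_mul_assoc matrix_mul_assoc)
    also have "\<dots> = - (W *v (?R *v (V *v axis i 1)))"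
    proof -
      have "(- (W ** ?R)) *v y = - (W *v (?R *v y))" for y
        using matrix_vector_mult_diff_rdistrib[of 0 "W ** ?R" y]
        by (simp add: matrix_vector_mul_assoc)
      then show ?thesis by (simp only: syl)
    qed
    also have "\<dots> = (- e i) *\<^sub>R (W *v (V *v axis i 1))"
      by (simp add: eig matrix_vector_mult_scaleR)
    finally have "eigenvalue_of R (complex_of_real (- e i))"
      using nz by (intro real_eigenvector_eigenvalue_of)
    then have "0 < Re (complex_of_real (- e i))" using R by blast
    then show False using e[of i] by simp
  qed
  have "W ** V = 0"
  proof -
    have "(W ** V) $ k $ i = 0" for k i
    proof -
      have "(W ** V) *v axis i 1 = 0" using zero[of i] by (simp add: matrix_vector_mul_assoc)
      then have "column i (W ** V) = 0" by (simp add: matrix_vector_mult_basis)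
      then show ?thesis by (simp add: column_def vec_eq_iff)
    qed
    then show ?thesis by (simp add: vec_eq_iff)
  qed
  then have "W ** (V ** U) = 0" by (simp add: matrix_mul_assoc) 
  then have "W = 0" by (simp add: VU)
  then show "R = ?R" by (simp add: W_def)
qed

text \<open>\<open>A - A (A + Y)\<^sup>-\<^sup>1 A\<close> is the inverse of \<open>A\<^sup>-\<^sup>1 + Y\<^sup>-\<^sup>1\<close>.  With
  \<open>Y = B + lam\<close> this handles the diagonal blocks of \<open>H\<close>, and the second claim with \<open>c = lam\<close> its off-diagonal
  blocks.\<close>

lemma parallel_sum:
  fixes A Y :: "real^'n^'n"
  assumes A: "sym_pos_def A" and Y: "sym_pos_def Y" and X: "X = A + Y"
  defines "G \<equiv> A - A ** matrix_inv X ** A"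
  shows "G ** (matrix_inv A + matrix_inv Y) = mat 1"
    and "A ** matrix_inv X ** (Y - c *\<^sub>R mat 1) = G ** (mat 1 - c *\<^sub>R matrix_inv Y)"
proof -
  have Xp: "sym_pos_def X"
    using A Y by (auto simp: X sym_pos_def_def matrix_vector_mult_add_rdistrib inner_add_right
        transpose_def vec_eq_iff add_pos_pos)
  note iA = sym_pos_def_inverse(1,2)[OF A] and iY = sym_pos_def_inverse(1,2)[OF Y]
    and iX = sym_pos_def_inverse(1,2)[OF Xp]
  have G: "G = A ** matrix_inv X ** Y"
  proof -
    have "A ** matrix_inv X ** Y = A ** (matrix_inv X ** X) - A ** matrix_inv X ** A"
      by (simp add: X matrix_ring_simps matrix_mul_assoc)
    then show ?thesis by (simp add: G_def iX)
  qed
  have "Y ** (matrix_inv A + matrix_inv Y) = X ** matrix_inv A"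
    by (simp add: X matrix_ring_simps iA iY)
  then have "G ** (matrix_inv A + matrix_inv Y) = A ** (matrix_inv X ** X) ** matrix_inv A"
    by (simp add: G flip: matrix_mul_assoc)
  then show "G ** (matrix_inv A + matrix_inv Y) = mat 1" by (simp add: iX iA)
  have "Y ** (mat 1 - c *\<^sub>R matrix_inv Y) = Y - c *\<^sub>R mat 1"
    by (simp add: matrix_ring_simps iY)
  then show "A ** matrix_inv X ** (Y - c *\<^sub>R mat 1) = G ** (mat 1 - c *\<^sub>R matrix_inv Y)"
    by (simp add: G flip: matrix_mul_assoc)
qed

section \<open>The inverse covariance of the plan\<close>

lemma sym_pos_def_add_scaleR:
  fixes K :: "real^'n^'n"
  assumes "sym_pos_def K" "0 \<le> c" "0 < k"
  shows "sym_pos_def (c *\<^sub>R mat 1 + k *\<^sub>R K)"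
  unfolding sym_pos_def_def
proof (intro conjI allI impI)
  show "transpose (c *\<^sub>R mat 1 + k *\<^sub>R K) = c *\<^sub>R mat 1 + k *\<^sub>R K"
    using assms(1) by (auto simp: sym_pos_def_def transpose_def vec_eq_iff mat_def)
  fix x :: "real^'n" assume "x \<noteq> 0"
  then have "0 < k * (x \<bullet> (K *v x))" "0 \<le> c * (x \<bullet> x)" using assms by (auto simp: sym_pos_def_def)
  then show "0 < x \<bullet> ((c *\<^sub>R mat 1 + k *\<^sub>R K) *v x)"
    by (simp add: matrix_vector_mult_add_rdistrib inner_add_right flip: scaleR_matrix_vector_assoc)
qed

text \<open>The matrix \<open>At\<close> is the inverse of \<open>(1 + lam A\<^sup>-\<^sup>1)/w\<close>, and it lies strictly between \<open>0\<close>
  and \<open>w\<close>; \<open>Bt\<close> is the same function of \<open>B\<close>.\<close>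

lemma contracted_covariance:
  fixes A At :: "real^'n^'n"
  assumes A: "sym_pos_def A" and w: "0 < w" and lam: "0 < lam"
    and At: "At = w *\<^sub>R (mat 1 - lam *\<^sub>R matrix_inv (A + lam *\<^sub>R mat 1))"
  defines "Ai \<equiv> (1 / w) *\<^sub>R (mat 1 + lam *\<^sub>R matrix_inv A)"
  shows "sym_pos_def Ai" "At = matrix_inv Ai" "sym_pos_def At"
    "\<And>x. x \<noteq> 0 \<Longrightarrow> x \<bullet> (At *v x) < w * (x \<bullet> x)"
    "\<And>x. x \<noteq> 0 \<Longrightarrow> x \<bullet> x < w * (x \<bullet> (Ai *v x))"
    "sym_pos_def (A + lam *\<^sub>R mat 1)"
proof -
  have Ainv: "sym_pos_def (matrix_inv A)" using A by (rule sym_pos_def_inverse)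
  define Y where "Y = A + lam *\<^sub>R mat 1"
  have "Y = lam *\<^sub>R mat 1 + 1 *\<^sub>R A" by (simp add: Y_def)
  then have Y: "sym_pos_def Y" using sym_pos_def_add_scaleR[OF A, of lam 1] lam by simp
  then show "sym_pos_def (A + lam *\<^sub>R mat 1)" by (simp add: Y_def)
  have "Ai = (1 / w) *\<^sub>R mat 1 + (lam / w) *\<^sub>R matrix_inv A"
    by (simp add: Ai_def scaleR_add_right)
  then show Ai: "sym_pos_def Ai" using sym_pos_def_add_scaleR[OF Ainv, of "1 / w" "lam / w"] w lam by simp
  have "Ai = (1 / w) *\<^sub>R (Y ** matrix_inv A)"
    by (simp add: Ai_def Y_def matrix_ring_simps sym_pos_def_inverse(1)[OF A])
  moreover have "At = w *\<^sub>R (matrix_inv Y ** A)"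
  proof -
    have "mat 1 - lam *\<^sub>R matrix_inv Y = matrix_inv Y ** (Y - lam *\<^sub>R mat 1)"
      by (simp add: matrix_ring_simps sym_pos_def_inverse(2)[OF Y])
    then show ?thesis by (simp add: At Y_def)
  qed
  ultimately have "At ** Ai = matrix_inv Y ** (A ** Y) ** matrix_inv A"
    using w by (simp add: matrix_ring_simps matrix_mul_assoc)
  also have "A ** Y = Y ** A" by (simp add: Y_def matrix_ring_simps)
  also have "matrix_inv Y ** (Y ** A) ** matrix_inv A = (matrix_inv Y ** Y) ** (A ** matrix_inv A)"
    by (simp add: matrix_mul_assoc)
  finally have "At ** Ai = (matrix_inv Y ** Y) ** (A ** matrix_inv A)" .
  then have "At ** Ai = mat 1"
    by (simp add: sym_pos_def_inverse(1)[OF A] sym_pos_def_inverse(2)[OF Y])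
  then have "Ai ** At = mat 1" using matrix_left_right_inverse by blast
  then show AtAi: "At = matrix_inv Ai" by (rule matrix_inv_eqI[symmetric])
  show "sym_pos_def At" unfolding AtAi using Ai by (rule sym_pos_def_inverse)
  fix x :: "real^'n" assume x: "x \<noteq> 0"
  have "0 < x \<bullet> (matrix_inv Y *v x)" "0 < x \<bullet> (matrix_inv A *v x)"
    using sym_pos_def_inverse(3)[OF Y] Ainv x by (auto simp: sym_pos_def_def)
  then have p: "0 < w * (lam * (x \<bullet> (matrix_inv Y *v x)))" "0 < lam * (x \<bullet> (matrix_inv A *v x))"
    using w lam by auto
  show "x \<bullet> (At *v x) < w * (x \<bullet> x)"
    using p unfolding At Y_def[symmetric]
    by (simp add: matrix_vector_mult_diff_rdistrib inner_diff_right algebra_simps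
        flip: scaleR_matrix_vector_assoc)
  show "x \<bullet> x < w * (x \<bullet> (Ai *v x))"
    using p w unfolding Ai_def
    by (simp add: matrix_vector_mult_add_rdistrib inner_add_right
        flip: scaleR_matrix_vector_assoc)
qed

text \<open>The inverse of the covariance \<open>H\<close>, the inverse covariances \<open>L1\<close> and \<open>L2\<close> of its marginals, and the
  determinants that enter the mass.  Here \<open>\<delta>\<close> lists the eigenvalues of \<open>C\<close>, \<open>d\<close> those of \<open>At Bt\<close>, and
  \<open>v\<close> is the determinant of the diagonalising congruence.\<close>

lemma plan_precision:
  fixes A B X At Bt C :: "real^'n^'n" and s w lam \<tau> :: real
    and H :: "real^('n + 'n)^('n + 'n)"
  assumes s: "0 < s" and w: "0 < w" and lam: "lam = s + w" and \<tau>: "\<tau> = w / lam"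
    and A: "sym_pos_def A" and B: "sym_pos_def B"
    and X: "X = A + B + lam *\<^sub>R mat 1"
    and At: "At = w *\<^sub>R (mat 1 - lam *\<^sub>R matrix_inv (A + lam *\<^sub>R mat 1))"
    and Bt: "Bt = w *\<^sub>R (mat 1 - lam *\<^sub>R matrix_inv (B + lam *\<^sub>R mat 1))"
    and C: "C = principal_sqrt ((1 / \<tau>) *\<^sub>R (At ** Bt) + (s\<^sup>2 / 4) *\<^sub>R mat 1) - (s / 2) *\<^sub>R mat 1"
    and H: "H = block_mat
               ((mat 1 + (1 / lam) *\<^sub>R C) ** (A - A ** matrix_inv X ** A))
               (C + (mat 1 + (1 / lam) *\<^sub>R C) ** A ** matrix_inv X ** B)
               (transpose C + (mat 1 + (1 / lam) *\<^sub>R transpose C) ** B ** matrix_inv X ** A)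
               ((mat 1 + (1 / lam) *\<^sub>R transpose C) ** (B - B ** matrix_inv X ** B))"
  obtains P S L1 L2 :: "real^'n^'n" and \<delta> d :: "'n \<Rightarrow> real" and v :: real
  where "sym_pos_def P" "sym_pos_def S" "sym_pos_def L1" "sym_pos_def L2"
    "L1 = P - (1 / s)\<^sup>2 *\<^sub>R matrix_inv S" "L2 = S - (1 / s)\<^sup>2 *\<^sub>R matrix_inv P"
    "H ** block_mat P (- (1 / s) *\<^sub>R mat 1) (- (1 / s) *\<^sub>R mat 1) S = mat 1"
    "lam *\<^sub>R matrix_inv A + mat 1 = s *\<^sub>R P + w *\<^sub>R L1"
    "lam *\<^sub>R matrix_inv B + mat 1 = s *\<^sub>R S + w *\<^sub>R L2"
    "\<And>i. 0 < \<delta> i" "\<And>i. \<delta> i < w" "\<And>i. d i = \<tau> * \<delta> i * (\<delta> i + s)" "v \<noteq> 0"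
    "det C = (\<Prod>i\<in>UNIV. \<delta> i)" "det (At ** Bt) = (\<Prod>i\<in>UNIV. d i)"
    "det (C - (1 / w) *\<^sub>R (At ** Bt)) = (\<Prod>i\<in>UNIV. \<delta> i * (w - \<delta> i) / lam)"
    "det S = v\<^sup>2 * (\<Prod>i\<in>UNIV. 1 / (s * \<delta> i))"
    "det L1 = (1 / v\<^sup>2) * (\<Prod>i\<in>UNIV. (w - \<delta> i) / lam)"
    "det L2 = v\<^sup>2 * (\<Prod>i\<in>UNIV. (w - \<delta> i) / (lam * d i))"
proof -
  have lam0: "0 < lam" using s w lam by simp
  have \<tau>0: "0 < \<tau>" using w lam0 by (simp add: \<tau>)
  define Ai where "Ai = (1 / w) *\<^sub>R (mat 1 + lam *\<^sub>R matrix_inv A)"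
  define Bi where "Bi = (1 / w) *\<^sub>R (mat 1 + lam *\<^sub>R matrix_inv B)"
  note a = contracted_covariance[OF A w lam0 At, folded Ai_def]
  note b = contracted_covariance[OF B w lam0 Bt, folded Bi_def]
  have Bts: "transpose Bt = Bt" using b(3) by (simp add: sym_pos_def_def)
  obtain V :: "real^'n^'n" and d where V: "transpose V ** Ai ** V = mat 1" "transpose V ** Bt ** V = diag_mat d"
    by (rule simultaneous_congruence[OF a(1) Bts])
  define U where "U = transpose V ** Ai"
  have UV: "U ** V = mat 1" using V by (simp add: U_def)
  then have VU: "V ** U = mat 1" using matrix_left_right_inverse by blast
  have tt: "transpose V ** transpose U = mat 1" "transpose U ** transpose V = mat 1"
    using arg_cong[OF UV, of transpose] arg_cong[OF VU, of transpose]
    by (simp_all add: matrix_transpose_mul)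
  \<comment> \<open>The four kinds of sandwiched matrices, one for each pairing of a vector space and its dual.\<close>
  define vv where "vv f = sandwich V f (transpose V)" for f
  define vu where "vu f = sandwich V f U" for f
  define wv where "wv f = sandwich (transpose U) f (transpose V)" for f
  define wu where "wu f = sandwich (transpose U) f U" for f
  note dfs = vv_def vu_def wv_def wu_def
  have mult: "vv f ** wv g = vv (\<lambda>i. f i * g i)" "vv f ** wu g = vu (\<lambda>i. f i * g i)"
    "vu f ** vv g = vv (\<lambda>i. f i * g i)" "vu f ** vu g = vu (\<lambda>i. f i * g i)"
    "wv f ** wv g = wv (\<lambda>i. f i * g i)" "wv f ** wu g = wu (\<lambda>i. f i * g i)"
    "wu f ** vv g = wv (\<lambda>i. f i * g i)" "wu f ** vu g = wu (\<lambda>i. f i * g i)" for f g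
    unfolding dfs by (simp_all add: sandwich_mult UV tt)
  have add: "vv f + vv g = vv (\<lambda>i. f i + g i)" "vu f + vu g = vu (\<lambda>i. f i + g i)"
    "wv f + wv g = wv (\<lambda>i. f i + g i)" "wu f + wu g = wu (\<lambda>i. f i + g i)" for f g
    unfolding dfs by (simp_all add: sandwich_add)
  have diff: "vv f - vv g = vv (\<lambda>i. f i - g i)" "vu f - vu g = vu (\<lambda>i. f i - g i)"
    "wv f - wv g = wv (\<lambda>i. f i - g i)" "wu f - wu g = wu (\<lambda>i. f i - g i)" for f g
    unfolding dfs by (simp_all add: sandwich_diff)
  have scale: "c *\<^sub>R vv f = vv (\<lambda>i. c * f i)" "c *\<^sub>R vu f = vu (\<lambda>i. c * f i)"
    "c *\<^sub>R wv f = wv (\<lambda>i. c * f i)" "c *\<^sub>R wu f = wu (\<lambda>i. c * f i)" for c f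
    unfolding dfs by (simp_all add: sandwich_scale)
  have one: "vu (\<lambda>_. 1) = mat 1" "wv (\<lambda>_. 1) = mat 1"
    unfolding dfs by (simp_all add: sandwich_one VU tt)
  have inv: "matrix_inv (wu f) = vv (\<lambda>i. 1 / f i)" "matrix_inv (vv f) = wu (\<lambda>i. 1 / f i)"
    if "\<And>i. f i \<noteq> 0" for f
    using that by (auto intro!: matrix_inv_eqI simp: mult one)
  have spd: "sym_pos_def (wu f)" "sym_pos_def (vv f)" if "\<And>i. 0 < f i" for f
    using sym_pos_def_sandwich[OF VU, of f] sym_pos_def_sandwich[OF tt(2), of f] that
    by (simp_all add: dfs)
  have Ai_wu: "Ai = wu (\<lambda>_. 1)"
  proof -
    have "wu (\<lambda>_. 1) = transpose U ** U" by (simp add: wu_def sandwich_def diag_mat_one)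
    also have "\<dots> = (transpose U ** transpose V) ** Ai"
      by (simp add: U_def[symmetric] flip: matrix_mul_assoc)
    finally show ?thesis by (simp add: tt)
  qed
  have At_vv: "At = vv (\<lambda>_. 1)" unfolding a(2) Ai_wu by (subst inv) auto
  have Bt_wu: "Bt = wu d"
  proof -
    have "wu d = (transpose U ** transpose V) ** Bt ** (V ** U)"
      by (simp add: wu_def sandwich_def V(2)[symmetric] matrix_mul_assoc)
    then show ?thesis by (simp add: tt VU)
  qed
  \<comment> \<open>\<open>d i\<close> is the value of the form \<open>Bt\<close>, which is below \<open>w\<close>, at a vector where the form \<open>At\<^sup>-\<^sup>1\<close>, which
    is above \<open>1/w\<close>, is \<open>1\<close>.\<close>
  have d: "0 < d i" "d i < w\<^sup>2" for i
  proof -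
    define x where "x = V *v axis i 1"
    have quad: "x \<bullet> (M *v x) = (transpose V ** M ** V) $ i $ i" for M :: "real^'n^'n"
    proof -
      have "x \<bullet> (M *v x) = axis i 1 \<bullet> ((transpose V ** M ** V) *v axis i 1)"
        unfolding x_def by (metis dot_lmul_matrix inner_commute matrix_vector_mul_assoc transpose_matrix_vector)
      also have "\<dots> = (transpose V ** M ** V) $ i $ i"
        by (simp add: inner_axis' matrix_vector_mult_basis column_def)
      finally show ?thesis .
    qed
    have "U *v x = axis i 1" by (simp add: x_def matrix_vector_mul_assoc UV)
    then have "x \<noteq> 0" by (auto simp: axis_eq_0_iff)
    have 1: "x \<bullet> (Ai *v x) = 1" unfolding quad V by (simp add: mat_def)
    have 2: "x \<bullet> (Bt *v x) = d i" unfolding quad V by (simp add: diag_mat_def)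
    show "0 < d i" using b(3) \<open>x \<noteq> 0\<close> 2 by (auto simp: sym_pos_def_def)
    have "d i < w * (x \<bullet> x)" using b(4)[OF \<open>x \<noteq> 0\<close>] 2 by simp
    also have "\<dots> \<le> w * w" using a(5)[OF \<open>x \<noteq> 0\<close>] 1 w by simp
    finally show "d i < w\<^sup>2" by (simp add: power2_eq_square)
  qed
  \<comment> \<open>\<open>e\<close> lists the eigenvalues of the principal square root, so \<open>\<delta>\<close> those of \<open>C\<close>, and the
    quadratic equation for \<open>C\<close> becomes \<open>d = \<tau> \<delta> (\<delta> + s)\<close>.\<close>
  define e where "e i = sqrt (d i / \<tau> + s\<^sup>2 / 4)" for i
  define \<delta> where "\<delta> i = e i - s / 2" for i
  have e2: "(e i)\<^sup>2 = d i / \<tau> + s\<^sup>2 / 4" for i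
    using d(1)[of i] \<tau>0 by (simp add: e_def add_nonneg_nonneg)
  have e0: "0 < e i" for i
    using d(1)[of i] \<tau>0 s by (simp add: e_def add_pos_pos)
  have d\<delta>: "d i = \<tau> * \<delta> i * (\<delta> i + s)" for i
  proof -
    have "\<delta> i * (\<delta> i + s) = (e i)\<^sup>2 - s\<^sup>2 / 4"
      by (simp add: \<delta>_def power2_eq_square algebra_simps)
    then show ?thesis using \<tau>0 by (simp add: e2 mult.assoc)
  qed
  have \<delta>0: "0 < \<delta> i" for i
  proof -
    have "(s / 2)\<^sup>2 < (e i)\<^sup>2" using d(1)[of i] \<tau>0 by (simp add: e2 power_divide)
    then show ?thesis using power2_less_imp_less[of "s / 2" "e i"] e0[of i] by (simp add: \<delta>_def)
  qed
  have \<delta>w: "\<delta> i < w" for i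
  proof (rule ccontr)
    assume "\<not> \<delta> i < w"
    then have "w * (w + s) \<le> \<delta> i * (\<delta> i + s)" using w s by (intro mult_mono) auto
    then have "\<tau> * (w * (w + s)) \<le> \<tau> * (\<delta> i * (\<delta> i + s))" using \<tau>0 by simp
    also have "\<dots> = d i" by (simp add: d\<delta> mult.assoc)
    also have "\<tau> * (w * (w + s)) = w\<^sup>2" using lam0 by (simp add: \<tau> lam power2_eq_square field_simps)
    finally show False using d(2)[of i] by simp
  qed
  have nzi: "\<delta> i \<noteq> 0" "w - \<delta> i \<noteq> 0" "d i \<noteq> 0" "\<delta> i + s \<noteq> 0" for i
    using \<delta>0[of i] \<delta>w[of i] d(1)[of i] s by auto
  have nzc: "s \<noteq> 0" "w \<noteq> 0" "lam \<noteq> 0" "\<tau> \<noteq> 0" using s w lam0 \<tau>0 by auto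
  note nz = nzi nzc
  have C_vu: "C = vu \<delta>"
  proof -
    have "(1 / \<tau>) *\<^sub>R (At ** Bt) + (s\<^sup>2 / 4) *\<^sub>R mat 1 = vu (\<lambda>i. (e i)\<^sup>2)"
      by (simp add: At_vv Bt_wu mult scale add e2 flip: one(1))
    moreover have "principal_sqrt (vu (\<lambda>i. (e i)\<^sup>2)) = vu e"
      unfolding vu_def by (rule principal_sqrt_sandwich[OF VU e0])
    ultimately have "C = vu e - (s / 2) *\<^sub>R vu (\<lambda>_. 1)" by (simp add: C one)
    then show ?thesis by (simp add: scale diff \<delta>_def[abs_def])
  qed
  have Ct: "transpose C = wv \<delta>" by (simp add: C_vu dfs transpose_sandwich)
  have Bi_vv: "Bi = vv (\<lambda>i. 1 / d i)"
  proof -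
    have "matrix_inv Bt = Bi"
      unfolding b(2) using sym_pos_def_inverse(2)[OF b(1)] by (rule matrix_inv_eqI)
    then show ?thesis unfolding Bt_wu by (subst (asm) inv) (use nz in auto)
  qed
  have Ainv: "matrix_inv A = (1 / lam) *\<^sub>R (w *\<^sub>R Ai - mat 1)"
    using nz by (simp add: Ai_def)
  have Binv: "matrix_inv B = (1 / lam) *\<^sub>R (w *\<^sub>R Bi - mat 1)"
    using nz by (simp add: Bi_def)
  have YA: "matrix_inv (A + lam *\<^sub>R mat 1) = (1 / lam) *\<^sub>R (mat 1 - (1 / w) *\<^sub>R At)"
    using nz by (simp add: At scaleR_diff_right)
  have YB: "matrix_inv (B + lam *\<^sub>R mat 1) = (1 / lam) *\<^sub>R (mat 1 - (1 / w) *\<^sub>R Bt)"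
    using nz by (simp add: Bt scaleR_diff_right)
  have wd: "w - d i / w = (w - \<delta> i) * (lam + \<delta> i) / lam" for i
  proof -
    have "d i / w = \<delta> i * (\<delta> i + s) / lam" using nz by (simp add: d\<delta> \<tau>)
    then have "w - d i / w = (w * lam - \<delta> i * (\<delta> i + s)) / lam"
      using nz by (simp add: diff_divide_distrib)
    also have "w * lam - \<delta> i * (\<delta> i + s) = (w - \<delta> i) * (lam + \<delta> i)"
      by (simp add: lam algebra_simps)
    finally show ?thesis .
  qed
  have lamd: "lam + \<delta> i \<noteq> 0" for i using lam0 \<delta>0[of i] by simp
  define GA where "GA = A - A ** matrix_inv X ** A"
  define GB where "GB = B - B ** matrix_inv X ** B"
  note pA = parallel_sum[OF A b(6), of X, folded GA_def]
  note pB = parallel_sum[OF B a(6), of X, folded GB_def]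
  have GA: "GA = vv (\<lambda>i. lam\<^sup>2 / ((w - \<delta> i) * (lam + \<delta> i)))"
  proof -
    have "GA ** (matrix_inv A + matrix_inv (B + lam *\<^sub>R mat 1)) = mat 1"
      by (rule pA(1)) (simp add: X)
    moreover have "matrix_inv A + matrix_inv (B + lam *\<^sub>R mat 1) = (1 / lam) *\<^sub>R (w *\<^sub>R Ai - (1 / w) *\<^sub>R Bt)"
      unfolding Ainv YB by (simp add: scaleR_diff_right)
    moreover have "\<dots> = wu (\<lambda>i. (w - \<delta> i) * (lam + \<delta> i) / lam\<^sup>2)"
      by (simp add: Ai_wu Bt_wu scale diff wd power2_eq_square)
    ultimately have "GA ** wu (\<lambda>i. (w - \<delta> i) * (lam + \<delta> i) / lam\<^sup>2) = mat 1" by simp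
    then have "GA ** (wu (\<lambda>i. (w - \<delta> i) * (lam + \<delta> i) / lam\<^sup>2) ** vv (\<lambda>i. lam\<^sup>2 / ((w - \<delta> i) * (lam + \<delta> i))))
        = vv (\<lambda>i. lam\<^sup>2 / ((w - \<delta> i) * (lam + \<delta> i)))"
      by (simp add: matrix_mul_assoc)
    then show ?thesis using nz lamd by (simp add: mult one)
  qed
  have GB: "GB = wu (\<lambda>i. lam\<^sup>2 * d i / ((w - \<delta> i) * (lam + \<delta> i)))"
  proof -
    have "GB ** (matrix_inv B + matrix_inv (A + lam *\<^sub>R mat 1)) = mat 1"
      by (rule pB(1)) (simp add: X)
    moreover have "matrix_inv B + matrix_inv (A + lam *\<^sub>R mat 1) = (1 / lam) *\<^sub>R (w *\<^sub>R Bi - (1 / w) *\<^sub>R At)"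
      unfolding Binv YA by (simp add: scaleR_diff_right)
    moreover have "\<dots> = vv (\<lambda>i. (w - \<delta> i) * (lam + \<delta> i) / (lam\<^sup>2 * d i))"
    proof -
      have "w / d i - 1 / w = (w - d i / w) / d i" for i using nz by (simp add: field_simps)
      then have "1 / lam * (w / d i - 1 / w) = (w - \<delta> i) * (lam + \<delta> i) / (lam\<^sup>2 * d i)" for i
        by (simp add: wd power2_eq_square)
      then show ?thesis by (simp add: Bi_vv At_vv scale diff)
    qed
    ultimately have "GB ** vv (\<lambda>i. (w - \<delta> i) * (lam + \<delta> i) / (lam\<^sup>2 * d i)) = mat 1" by simp
    then have "GB ** (vv (\<lambda>i. (w - \<delta> i) * (lam + \<delta> i) / (lam\<^sup>2 * d i)) ** wu (\<lambda>i. lam\<^sup>2 * d i / ((w - \<delta> i) * (lam + \<delta> i))))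
        = wu (\<lambda>i. lam\<^sup>2 * d i / ((w - \<delta> i) * (lam + \<delta> i)))"
      by (simp add: matrix_mul_assoc)
    then show ?thesis using nz lamd by (simp add: mult one)
  qed
  have AXB: "A ** matrix_inv X ** B = GA ** ((1 / w) *\<^sub>R Bt)"
  proof -
    have "A ** matrix_inv X ** ((B + lam *\<^sub>R mat 1) - lam *\<^sub>R mat 1)
        = GA ** (mat 1 - lam *\<^sub>R matrix_inv (B + lam *\<^sub>R mat 1))"
      by (rule pA(2)) (simp add: X)
    then show ?thesis using nz by (simp add: YB)
  qed
  have BXA: "B ** matrix_inv X ** A = GB ** ((1 / w) *\<^sub>R At)"
  proof -
    have "B ** matrix_inv X ** ((A + lam *\<^sub>R mat 1) - lam *\<^sub>R mat 1)
        = GB ** (mat 1 - lam *\<^sub>R matrix_inv (A + lam *\<^sub>R mat 1))"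
      by (rule pB(2)) (simp add: X)
    then show ?thesis using nz by (simp add: YA)
  qed
  have frac: "(1 + 1 / lam * \<delta> i) * (lam\<^sup>2 / ((w - \<delta> i) * (lam + \<delta> i))) = lam / (w - \<delta> i)"
    "(1 + 1 / lam * \<delta> i) * (lam\<^sup>2 * d i / ((w - \<delta> i) * (lam + \<delta> i))) = lam * d i / (w - \<delta> i)" for i
    using nz lamd[of i] by (simp_all add: divide_simps power2_eq_square)
  have H11: "(mat 1 + (1 / lam) *\<^sub>R C) ** GA = vv (\<lambda>i. lam / (w - \<delta> i))"
    by (simp only: C_vu GA one(1)[symmetric] scale add mult frac)
  have H22: "(mat 1 + (1 / lam) *\<^sub>R transpose C) ** GB = wu (\<lambda>i. lam * d i / (w - \<delta> i))"
    by (simp only: Ct GB one(2)[symmetric] scale add mult frac)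
  have dw: "1 / w * d i = \<delta> i * (\<delta> i + s) / lam" for i
    using nz by (simp add: d\<delta> \<tau>)
  have off1: "\<delta> i + lam / (w - \<delta> i) * (1 / w * d i) = lam * \<delta> i / (w - \<delta> i)" for i
  proof -
    have "lam / (w - \<delta> i) * (1 / w * d i) = \<delta> i * (\<delta> i + s) / (w - \<delta> i)"
      unfolding dw using nzi[of i] nzc by simp
    moreover have "\<delta> i = \<delta> i * (w - \<delta> i) / (w - \<delta> i)" using nzi[of i] nzc by simp
    ultimately have "\<delta> i + lam / (w - \<delta> i) * (1 / w * d i)
        = (\<delta> i * (w - \<delta> i) + \<delta> i * (\<delta> i + s)) / (w - \<delta> i)"
      by (simp only: add_divide_distrib)
    then show ?thesis by (simp add: lam algebra_simps)
  qed
  have off2: "\<delta> i + lam * d i / (w - \<delta> i) * (1 / w * 1) = lam * \<delta> i / (w - \<delta> i)" for i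
    using off1[of i] by (simp add: mult_ac)
  have H12: "C + (mat 1 + (1 / lam) *\<^sub>R C) ** A ** matrix_inv X ** B = vu (\<lambda>i. lam * \<delta> i / (w - \<delta> i))"
  proof -
    have "(mat 1 + (1 / lam) *\<^sub>R C) ** A ** matrix_inv X ** B = (mat 1 + (1 / lam) *\<^sub>R C) ** GA ** ((1 / w) *\<^sub>R Bt)"
      using AXB by (simp only: matrix_mul_assoc[symmetric])
    then show ?thesis by (simp only: H11) (simp only: C_vu Bt_wu scale mult add off1 off2)
  qed
  have H21: "transpose C + (mat 1 + (1 / lam) *\<^sub>R transpose C) ** B ** matrix_inv X ** A = wv (\<lambda>i. lam * \<delta> i / (w - \<delta> i))"
  proof -
    have "(mat 1 + (1 / lam) *\<^sub>R transpose C) ** B ** matrix_inv X ** A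
        = (mat 1 + (1 / lam) *\<^sub>R transpose C) ** GB ** ((1 / w) *\<^sub>R At)"
      using BXA by (simp only: matrix_mul_assoc[symmetric])
    then show ?thesis by (simp only: H22) (simp only: Ct At_vv scale mult add off1 off2)
  qed
  define P where "P = wu (\<lambda>i. \<tau> / s * (\<delta> i + s))"
  define S where "S = vv (\<lambda>i. 1 / (s * \<delta> i))"
  define L1 where "L1 = wu (\<lambda>i. (w - \<delta> i) / lam)"
  define L2 where "L2 = vv (\<lambda>i. (w - \<delta> i) / (lam * d i))"
  define v where "v = det V"
  have "v * det U = 1" using arg_cong[OF VU, of det] by (simp add: v_def det_mul)
  then have v: "v \<noteq> 0" "det U = 1 / v"
    by (auto, metis mult_zero_left nonzero_mult_div_cancel_left zero_neq_one)
  have fpos: "0 < \<tau> / s * (\<delta> i + s)" "0 < 1 / (s * \<delta> i)" "0 < (w - \<delta> i) / lam" "0 < (w - \<delta> i) / (lam * d i)" for i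
    using \<delta>0[of i] \<delta>w[of i] d(1)[of i] s lam0 \<tau>0 by auto
  have \<tau>s: "\<tau> * (\<delta> i + s) - \<delta> i = s / lam * (w - \<delta> i)" for i
    using nz by (simp add: \<tau> lam field_simps)
  show ?thesis
  proof (rule that[of P S L1 L2 \<delta> d v])
    show "sym_pos_def P" "sym_pos_def S" "sym_pos_def L1" "sym_pos_def L2"
      unfolding P_def S_def L1_def L2_def using fpos by (auto intro!: spd)
    show "L1 = P - (1 / s)\<^sup>2 *\<^sub>R matrix_inv S"
    proof -
      have "matrix_inv S = wu (\<lambda>i. s * \<delta> i)"
        unfolding S_def by (subst inv) (use nz in auto)
      moreover have "\<tau> / s * (\<delta> i + s) - (1 / s)\<^sup>2 * (s * \<delta> i) = (w - \<delta> i) / lam" for i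
      proof -
        have "\<tau> / s * (\<delta> i + s) - (1 / s)\<^sup>2 * (s * \<delta> i) = (\<tau> * (\<delta> i + s) - \<delta> i) / s"
          using nzc by (simp add: power2_eq_square diff_divide_distrib)
        then show ?thesis unfolding \<tau>s using nzc by simp
      qed
      ultimately show ?thesis by (simp only: L1_def P_def scale diff)
    qed
    show "L2 = S - (1 / s)\<^sup>2 *\<^sub>R matrix_inv P"
    proof -
      have "matrix_inv P = vv (\<lambda>i. 1 / (\<tau> / s * (\<delta> i + s)))"
        unfolding P_def by (rule inv(1)) (use nz in auto)
      moreover have "1 / (s * \<delta> i) - (1 / s)\<^sup>2 * (1 / (\<tau> / s * (\<delta> i + s))) = (w - \<delta> i) / (lam * d i)" for i
      proof -
        have "1 / (s * \<delta> i) - (1 / s)\<^sup>2 * (1 / (\<tau> / s * (\<delta> i + s)))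
            = (\<tau> * (\<delta> i + s) - \<delta> i) / (s * (\<tau> * \<delta> i * (\<delta> i + s)))"
          using nzi[of i] nzc by (simp add: divide_simps power2_eq_square; simp add: algebra_simps)
        also have "\<dots> = (w - \<delta> i) / (lam * d i)"
          unfolding \<tau>s d\<delta> using nzi[of i] nzc by (simp add: divide_simps)
        finally show ?thesis .
      qed
      ultimately show ?thesis by (simp only: L2_def S_def scale diff)
    qed
    show "H ** block_mat P (- (1 / s) *\<^sub>R mat 1) (- (1 / s) *\<^sub>R mat 1) S = mat 1"
    proof -
      have Q: "- (1 / s) *\<^sub>R mat 1 = wv (\<lambda>_. - (1 / s) * 1)" "- (1 / s) *\<^sub>R mat 1 = vu (\<lambda>_. - (1 / s) * 1)"
        by (simp_all only: scale[symmetric] one)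
      have zero: "vv (\<lambda>_. 0) = 0" "wu (\<lambda>_. 0) = 0"
        by (simp_all add: dfs sandwich_def diag_mat_def vec_eq_iff matrix_matrix_mult_def)
      have 1: "lam / (w - \<delta> i) * (\<tau> / s * (\<delta> i + s)) + lam * \<delta> i / (w - \<delta> i) * (- (1 / s) * 1) = 1" for i
      proof -
        have "lam / (w - \<delta> i) * (\<tau> / s * (\<delta> i + s)) + lam * \<delta> i / (w - \<delta> i) * (- (1 / s) * 1)
            = lam / ((w - \<delta> i) * s) * (\<tau> * (\<delta> i + s) - \<delta> i)"
          using nzi[of i] nzc by (simp add: divide_simps; simp add: algebra_simps)
        then show ?thesis unfolding \<tau>s using nzi[of i] nzc by simp
      qed
      have 2: "lam / (w - \<delta> i) * (- (1 / s) * 1) + lam * \<delta> i / (w - \<delta> i) * (1 / (s * \<delta> i)) = 0" for i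
        using nzi[of i] nzc by simp
      have 3: "lam * \<delta> i / (w - \<delta> i) * (\<tau> / s * (\<delta> i + s)) + lam * d i / (w - \<delta> i) * (- (1 / s) * 1) = 0" for i
        unfolding d\<delta> using nzi[of i] nzc by (simp add: divide_simps)
      have 4: "lam * \<delta> i / (w - \<delta> i) * (- (1 / s) * 1) + lam * d i / (w - \<delta> i) * (1 / (s * \<delta> i)) = 1" for i
      proof -
        have "lam * \<delta> i / (w - \<delta> i) * (- (1 / s) * 1) + lam * d i / (w - \<delta> i) * (1 / (s * \<delta> i))
            = lam / ((w - \<delta> i) * s) * (\<tau> * (\<delta> i + s) - \<delta> i)"
          unfolding d\<delta> using nzi[of i] nzc by (simp add: divide_simps; simp add: algebra_simps)
        then show ?thesis unfolding \<tau>s using nzi[of i] nzc by simp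
      qed
      have "H ** block_mat P (wv (\<lambda>_. - (1 / s) * 1)) (vu (\<lambda>_. - (1 / s) * 1)) S
          = block_mat (mat 1) 0 0 (mat 1)"
        unfolding H GA_def[symmetric] GB_def[symmetric] H11 H12 H21 H22 block_mat_mult P_def S_def
        by (simp only: mult add 1 2 3 4 one zero)
      then show ?thesis by (simp only: Q[symmetric] block_mat_one)
    qed
    show "lam *\<^sub>R matrix_inv A + mat 1 = s *\<^sub>R P + w *\<^sub>R L1"
    proof -
      have "lam *\<^sub>R matrix_inv A + mat 1 = w *\<^sub>R wu (\<lambda>_. 1)"
        using nz by (simp add: Ainv flip: Ai_wu)
      moreover have "s * (\<tau> / s * (\<delta> i + s)) + w * ((w - \<delta> i) / lam) = w * 1" for i
      proof -
        have "s * (\<tau> / s * (\<delta> i + s)) = \<tau> * (\<delta> i + s)" "w * ((w - \<delta> i) / lam) = \<tau> * (w - \<delta> i)"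
          using nzc by (simp_all add: \<tau>)
        then have "s * (\<tau> / s * (\<delta> i + s)) + w * ((w - \<delta> i) / lam) = \<tau> * lam"
          by (simp add: lam algebra_simps)
        then show ?thesis using nzc by (simp add: \<tau>)
      qed
      ultimately show ?thesis by (simp only: P_def L1_def scale add)
    qed
    show "lam *\<^sub>R matrix_inv B + mat 1 = s *\<^sub>R S + w *\<^sub>R L2"
    proof -
      have "lam *\<^sub>R matrix_inv B + mat 1 = w *\<^sub>R vv (\<lambda>i. 1 / d i)"
        using nz by (simp add: Binv flip: Bi_vv)
      moreover have "s * (1 / (s * \<delta> i)) + w * ((w - \<delta> i) / (lam * d i)) = w * (1 / d i)" for i
      proof -
        have "w * ((w - \<delta> i) / (lam * d i)) = \<tau> * (w - \<delta> i) / d i" using nz by (simp add: \<tau>)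
        moreover have "1 / \<delta> i = \<tau> * (\<delta> i + s) / d i" unfolding d\<delta> using nz by simp
        ultimately have "s * (1 / (s * \<delta> i)) + w * ((w - \<delta> i) / (lam * d i)) = \<tau> * lam / d i"
          using nz by (simp add: lam algebra_simps flip: add_divide_distrib)
        then show ?thesis using nz by (simp add: \<tau>)
      qed
      ultimately show ?thesis by (simp only: S_def L2_def scale add)
    qed
    show "0 < \<delta> i" "\<delta> i < w" "d i = \<tau> * \<delta> i * (\<delta> i + s)" for i
      by (rule \<delta>0 \<delta>w d\<delta>)+
    show "v \<noteq> 0" by (rule v)
    show "det C = (\<Prod>i\<in>UNIV. \<delta> i)"
      using v by (simp add: C_vu vu_def det_sandwich v_def[symmetric])
    show "det (At ** Bt) = (\<Prod>i\<in>UNIV. d i)"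
      using v by (simp add: At_vv Bt_wu mult vu_def det_sandwich v_def[symmetric])
    have "\<delta> i - 1 / w * (1 * d i) = \<delta> i * (w - \<delta> i) / lam" for i
    proof -
      have "1 / w * (1 * d i) = \<delta> i * (\<delta> i + s) / lam" using dw[of i] by simp
      moreover have "\<delta> i = \<delta> i * lam / lam" using nzc by simp
      ultimately have "\<delta> i - 1 / w * (1 * d i) = (\<delta> i * lam - \<delta> i * (\<delta> i + s)) / lam"
        by (simp only: diff_divide_distrib)
      then show ?thesis by (simp add: lam algebra_simps)
    qed
    then have "C - (1 / w) *\<^sub>R (At ** Bt) = vu (\<lambda>i. \<delta> i * (w - \<delta> i) / lam)"
      by (simp only: C_vu At_vv Bt_wu mult scale diff)
    then show "det (C - (1 / w) *\<^sub>R (At ** Bt)) = (\<Prod>i\<in>UNIV. \<delta> i * (w - \<delta> i) / lam)"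
      using v by (simp add: vu_def det_sandwich v_def[symmetric])
    show "det S = v\<^sup>2 * (\<Prod>i\<in>UNIV. 1 / (s * \<delta> i))"
      by (simp add: S_def vv_def det_sandwich det_transpose v_def power2_eq_square)
    show "det L1 = (1 / v\<^sup>2) * (\<Prod>i\<in>UNIV. (w - \<delta> i) / lam)"
      by (simp add: L1_def wu_def det_sandwich det_transpose v power2_eq_square)
    show "det L2 = v\<^sup>2 * (\<Prod>i\<in>UNIV. (w - \<delta> i) / (lam * d i))"
      by (simp add: L2_def vv_def det_sandwich det_transpose v_def power2_eq_square)
  qed
qed

section \<open>The pointwise optimality equation\<close>

text \<open>The quadratic and linear terms of the pointwise optimality equation.  With \<open>k = X\<^sup>-\<^sup>1 (a - b)\<close> one has
  \<open>x - a = u - A k\<close>, \<open>y - b = v + B k\<close> and \<open>x - y = u - v + lam k\<close>, so only a constant remains.\<close>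

lemma plan_quadratic_identity:
  fixes A B P S L1 L2 X :: "real^'n^'n"
  assumes A: "sym_pos_def A" and B: "sym_pos_def B" and s: "s \<noteq> 0" and lam: "0 < lam"
    and X: "X = A + B + lam *\<^sub>R mat 1"
    and P: "lam *\<^sub>R matrix_inv A + mat 1 = s *\<^sub>R P + w *\<^sub>R L1"
    and S: "lam *\<^sub>R matrix_inv B + mat 1 = s *\<^sub>R S + w *\<^sub>R L2"
    and u: "u = x - (a + (A ** matrix_inv X) *v (b - a))"
    and v: "v = y - (b + (B ** matrix_inv X) *v (a - b))"
  shows "(norm (x - y))\<^sup>2 - s * (u \<bullet> (P *v u) - 2 * (1 / s) * (u \<bullet> v) + v \<bullet> (S *v v))
     + lam * ((x - a) \<bullet> (matrix_inv A *v (x - a)) + (y - b) \<bullet> (matrix_inv B *v (y - b)))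
     - w * (u \<bullet> (L1 *v u) + v \<bullet> (L2 *v v)) = lam * ((a - b) \<bullet> (matrix_inv X *v (a - b)))"
proof -
  have "X = lam *\<^sub>R mat 1 + 1 *\<^sub>R (A + B)" by (simp add: X)
  moreover have "sym_pos_def (A + B)"
    using A B by (auto simp: sym_pos_def_def matrix_vector_mult_add_rdistrib inner_add_right
        transpose_def vec_eq_iff add_pos_pos)
  ultimately have Xp: "sym_pos_def X" using sym_pos_def_add_scaleR[of "A + B" lam 1] lam by simp
  define k where "k = matrix_inv X *v (a - b)"
  have Xk: "X *v k = a - b" by (simp add: k_def matrix_vector_mul_assoc sym_pos_def_inverse(1)[OF Xp])
  then have ab: "a - b = A *v k + B *v k + lam *\<^sub>R k"
    by (simp add: X matrix_vector_mult_add_rdistrib flip: scaleR_matrix_vector_assoc)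
  have neg: "matrix_inv X *v (b - a) = - k"
    using matrix_vector_mult_diff_distrib[of "matrix_inv X" 0 "a - b"] by (simp add: k_def)
  have negA: "A *v (- k) = - (A *v k)"
    using matrix_vector_mult_diff_distrib[of A 0 k] by simp
  have xa: "x - a = u - A *v k"
    by (simp add: u neg negA flip: matrix_vector_mul_assoc)
  have yb: "y - b = v + B *v k"
    by (simp add: v flip: matrix_vector_mul_assoc k_def)
  have xy: "x - y = u - v + lam *\<^sub>R k"
  proof -
    have "x - y = (x - a) - (y - b) + (a - b)" by simp
    then show ?thesis unfolding xa yb ab by simp
  qed
  define Ai where "Ai = matrix_inv A"
  define Bi where "Bi = matrix_inv B"
  have Aik: "Ai *v (A *v k) = k" "Bi *v (B *v k) = k"
    by (simp_all add: Ai_def Bi_def matrix_vector_mul_assoc sym_pos_def_inverse(2)[OF A] sym_pos_def_inverse(2)[OF B])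
  have Ais: "transpose Ai = Ai" "transpose Bi = Bi"
    using sym_pos_def_inverse(3)[OF A] sym_pos_def_inverse(3)[OF B] by (auto simp: Ai_def Bi_def sym_pos_def_def)
  have swap: "(A *v k) \<bullet> (Ai *v u) = u \<bullet> k" "(B *v k) \<bullet> (Bi *v v) = v \<bullet> k"
    using inner_matrix_symmetric[OF Ais(1), of "A *v k" u] inner_matrix_symmetric[OF Ais(2), of "B *v k" v] Aik
    by simp_all
  have qA: "(x - a) \<bullet> (Ai *v (x - a)) = u \<bullet> (Ai *v u) - 2 * (u \<bullet> k) + k \<bullet> (A *v k)"
    unfolding xa by (simp add: matrix_vector_mult_diff_distrib inner_diff_left inner_diff_right Aik swap inner_commute)
  have qB: "(y - b) \<bullet> (Bi *v (y - b)) = v \<bullet> (Bi *v v) + 2 * (v \<bullet> k) + k \<bullet> (B *v k)"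
    unfolding yb by (simp add: matrix_vector_right_distrib inner_add_left inner_add_right Aik swap inner_commute)
  have PA: "lam * (u \<bullet> (Ai *v u)) + u \<bullet> u = s * (u \<bullet> (P *v u)) + w * (u \<bullet> (L1 *v u))"
    using arg_cong[OF P, of "\<lambda>M. u \<bullet> (M *v u)"]
    by (simp add: Ai_def matrix_vector_mult_add_rdistrib inner_add_right flip: scaleR_matrix_vector_assoc)
  have SB: "lam * (v \<bullet> (Bi *v v)) + v \<bullet> v = s * (v \<bullet> (S *v v)) + w * (v \<bullet> (L2 *v v))"
    using arg_cong[OF S, of "\<lambda>M. v \<bullet> (M *v v)"]
    by (simp add: Bi_def matrix_vector_mult_add_rdistrib inner_add_right flip: scaleR_matrix_vector_assoc)
  have nxy: "(norm (x - y))\<^sup>2 = u \<bullet> u - 2 * (u \<bullet> v) + v \<bullet> v + 2 * lam * (u \<bullet> k) - 2 * lam * (v \<bullet> k) + lam\<^sup>2 * (k \<bullet> k)"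
    unfolding xy power2_norm_eq_inner
    by (simp add: inner_diff_left inner_diff_right inner_add_left inner_add_right inner_commute
        power2_eq_square algebra_simps)
  have q0: "(a - b) \<bullet> k = k \<bullet> (A *v k) + k \<bullet> (B *v k) + lam * (k \<bullet> k)"
    unfolding ab by (simp add: inner_add_left inner_add_right inner_commute)
  have sq: "s * (u \<bullet> (P *v u) - 2 * (1 / s) * (u \<bullet> v) + v \<bullet> (S *v v))
      = s * (u \<bullet> (P *v u)) - 2 * (u \<bullet> v) + s * (v \<bullet> (S *v v))"
    using s by (simp add: algebra_simps)
  show ?thesis
    unfolding sq nxy Ai_def[symmetric] Bi_def[symmetric] qA qB k_def[symmetric] q0
    using PA SB by (simp add: algebra_simps power2_eq_square)
qed

lemma quadratic_growth:
  fixes M :: "real^'n^'n"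
  obtains K where "0 \<le> K" "\<And>x. \<bar>(x - a) \<bullet> (M *v (x - a))\<bar> \<le> K * (1 + (norm x)\<^sup>2)"
proof -
  define c where "c = onorm ((*v) M)"
  have c: "0 \<le> c" unfolding c_def by (rule onorm_pos_le[OF matrix_vector_mul_bounded_linear])
  have "\<bar>(x - a) \<bullet> (M *v (x - a))\<bar> \<le> (c * (2 * (1 + (norm a)\<^sup>2))) * (1 + (norm x)\<^sup>2)" for x
  proof -
    have "\<bar>(x - a) \<bullet> (M *v (x - a))\<bar> \<le> norm (x - a) * norm (M *v (x - a))"
      by (rule Cauchy_Schwarz_ineq2)
    also have "\<dots> \<le> norm (x - a) * (c * norm (x - a))"
      unfolding c_def by (intro mult_left_mono onorm[OF matrix_vector_mul_bounded_linear]) auto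
    also have "\<dots> = c * (norm (x - a))\<^sup>2" by (simp add: power2_eq_square)
    also have "(norm (x - a))\<^sup>2 \<le> (norm x + norm a)\<^sup>2"
      by (intro power_mono norm_triangle_ineq4) auto
    also have "(norm x + norm a)\<^sup>2 \<le> 2 * ((norm x)\<^sup>2 + (norm a)\<^sup>2)"
      using zero_le_power2[of "norm x - norm a"] by (simp add: power2_eq_square algebra_simps)
    also have "\<dots> \<le> 2 * (1 + (norm a)\<^sup>2) * (1 + (norm x)\<^sup>2)"
      by (simp add: algebra_simps)
    finally show ?thesis using c by (simp add: mult_left_mono mult.assoc)
  qed
  then show ?thesis using c by (intro that[of "c * (2 * (1 + (norm a)\<^sup>2))"]) auto
qed

text \<open>The constant term of the pointwise optimality equation: \<open>m\<close> is the mass of the plan, \<open>dA\<close>, \<open>dB\<close>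
  are the determinants of \<open>A\<close>, \<open>B\<close>, and \<open>dS\<close>, \<open>d1\<close>, \<open>d2\<close> those of \<open>S\<close>, \<open>L1\<close>,
  \<open>L2\<close>.  After taking logarithms both sides are linear in the same few sums.\<close>

lemma log_mass_identity:
  fixes s w lam \<tau> q ma mb m dA dB v :: real and d \<delta> :: "'n::finite \<Rightarrow> real"
  assumes s: "0 < s" and w: "0 < w" and lam: "lam = s + w" and \<tau>: "\<tau> = w / lam"
    and \<delta>: "\<And>i. 0 < \<delta> i" "\<And>i. \<delta> i < w" and d: "\<And>i. d i = \<tau> * \<delta> i * (\<delta> i + s)"
    and pos: "0 < ma" "0 < mb" "0 < dA" "0 < dB" "v \<noteq> 0"
    and m: "m = sqrt s powr (real CARD('n) * s / (2 * w + s))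
               * (ma * mb * (\<Prod>i\<in>UNIV. \<delta> i) * sqrt ((\<Prod>i\<in>UNIV. d i) powr \<tau> / (dA * dB))) powr (1 / (\<tau> + 1))
               * (exp (- q / (2 * (\<tau> + 1))) / sqrt (\<Prod>i\<in>UNIV. \<delta> i * (w - \<delta> i) / lam))"
    and dS: "dS = v\<^sup>2 * (\<Prod>i\<in>UNIV. 1 / (s * \<delta> i))"
    and d1: "d1 = (1 / v\<^sup>2) * (\<Prod>i\<in>UNIV. (w - \<delta> i) / lam)"
    and d2: "d2 = v\<^sup>2 * (\<Prod>i\<in>UNIV. (w - \<delta> i) / (lam * d i))"
  shows "0 < m"
    and "lam * q + 2 * s * (ln m - ln ma - ln mb + (ln dA + ln dB + ln d1 + ln dS) / 2)
      + 2 * w * (ln m - ln ma + (ln dA + ln d1) / 2)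
      + 2 * w * (ln m - ln mb + (ln dB + ln d2) / 2) = 0"
proof -
  have lam0: "0 < lam" using s w lam by simp
  have \<tau>0: "0 < \<tau>" using w lam0 by (simp add: \<tau>)
  have d0: "0 < d i" for i using \<delta>(1)[of i] s \<tau>0 by (simp add: d)
  have wd: "0 < w - \<delta> i" for i using \<delta>(2)[of i] by simp
  have nz: "\<delta> i \<noteq> 0" "d i \<noteq> 0" "w - \<delta> i \<noteq> 0" "w \<noteq> \<delta> i" "lam \<noteq> 0" "s \<noteq> 0" for i
    using \<delta>(1)[of i] d0[of i] wd[of i] s lam0 by auto
  have p: "0 < (\<Prod>i\<in>UNIV. \<delta> i)" "0 < (\<Prod>i\<in>UNIV. d i)" "0 < (\<Prod>i\<in>UNIV. \<delta> i * (w - \<delta> i) / lam)"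
    using \<delta>(1) d0 wd lam0 by (auto intro!: prod_pos)
  define r where "r = ma * mb * (\<Prod>i\<in>UNIV. \<delta> i) * sqrt ((\<Prod>i\<in>UNIV. d i) powr \<tau> / (dA * dB))"
  have "0 < (\<Prod>i\<in>UNIV. d i) powr \<tau>" using p(2) by (metis powr_gt_zero less_irrefl)
  then have r: "0 < r" unfolding r_def using p pos by (intro mult_pos_pos real_sqrt_gt_zero divide_pos_pos) auto
  show m0: "0 < m" unfolding m using s r p by (simp add: r_def[symmetric])
  define n Ld Lw LD where "n = real CARD('n)" and "Ld = (\<Sum>i\<in>UNIV. ln (\<delta> i))"
    and "Lw = (\<Sum>i\<in>UNIV. ln (w - \<delta> i))" and "LD = (\<Sum>i\<in>UNIV. ln (d i))"
  have l\<delta>: "ln (\<Prod>i\<in>UNIV. \<delta> i) = Ld" unfolding Ld_def using \<delta>(1) by (intro ln_prod) (simp_all add: nz)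
  have ld: "ln (\<Prod>i\<in>UNIV. d i) = LD" unfolding LD_def using d0 by (intro ln_prod) (simp_all add: nz)
  have lc: "ln (\<Prod>i\<in>UNIV. \<delta> i * (w - \<delta> i) / lam) = Ld + Lw - n * ln lam"
  proof -
    have "ln (\<Prod>i\<in>UNIV. \<delta> i * (w - \<delta> i) / lam) = (\<Sum>i\<in>UNIV. ln (\<delta> i * (w - \<delta> i) / lam))"
      using \<delta>(1) wd lam0 by (intro ln_prod) (simp_all add: nz)
    also have "\<dots> = (\<Sum>i\<in>UNIV. ln (\<delta> i) + ln (w - \<delta> i) - ln lam)"
      using \<delta>(1) wd lam0 by (intro sum.cong) (auto simp: ln_div ln_mult less_imp_neq[symmetric])
    finally show ?thesis by (simp add: sum.distrib sum_subtractf Ld_def Lw_def n_def)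
  qed
  have v2: "0 < v\<^sup>2" using pos(5) by simp
  have lnv: "ln (v\<^sup>2 * T) = ln (v\<^sup>2) + ln T" "ln (1 / v\<^sup>2 * T) = ln T - ln (v\<^sup>2)" if "0 < T" for T
    using v2 that by (simp_all add: ln_mult ln_div)
  have lS: "ln dS = ln (v\<^sup>2) - n * ln s - Ld"
  proof -
    have "ln (\<Prod>i\<in>UNIV. 1 / (s * \<delta> i)) = (\<Sum>i\<in>UNIV. ln (1 / (s * \<delta> i)))"
      using \<delta>(1) s by (intro ln_prod) (simp_all add: nz)
    also have "\<dots> = (\<Sum>i\<in>UNIV. - ln s - ln (\<delta> i))"
      using \<delta>(1) s by (intro sum.cong) (auto simp: ln_div ln_mult less_imp_neq[symmetric])
    finally have e: "ln (\<Prod>i\<in>UNIV. 1 / (s * \<delta> i)) = - n * ln s - Ld"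
      by (simp add: sum_subtractf Ld_def n_def sum_negf)
    have pp: "0 < (\<Prod>i\<in>UNIV. 1 / (s * \<delta> i))" using \<delta>(1) s by (intro prod_pos) auto
    show ?thesis unfolding dS lnv(1)[OF pp] e by simp
  qed
  have l1: "ln d1 = - ln (v\<^sup>2) + Lw - n * ln lam"
  proof -
    have "ln (\<Prod>i\<in>UNIV. (w - \<delta> i) / lam) = (\<Sum>i\<in>UNIV. ln ((w - \<delta> i) / lam))"
      using wd lam0 by (intro ln_prod) (simp_all add: nz)
    also have "\<dots> = (\<Sum>i\<in>UNIV. ln (w - \<delta> i) - ln lam)"
      using wd lam0 by (intro sum.cong) (auto simp: ln_div less_imp_neq[symmetric])
    finally have e: "ln (\<Prod>i\<in>UNIV. (w - \<delta> i) / lam) = Lw - n * ln lam"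
      by (simp add: sum_subtractf Lw_def n_def)
    have pp: "0 < (\<Prod>i\<in>UNIV. (w - \<delta> i) / lam)" using wd lam0 by (intro prod_pos) auto
    show ?thesis unfolding d1 lnv(2)[OF pp] e by simp
  qed
  have l2: "ln d2 = ln (v\<^sup>2) + Lw - n * ln lam - LD"
  proof -
    have "ln (\<Prod>i\<in>UNIV. (w - \<delta> i) / (lam * d i)) = (\<Sum>i\<in>UNIV. ln ((w - \<delta> i) / (lam * d i)))"
      using wd d0 lam0 by (intro ln_prod) (simp_all add: nz)
    also have "\<dots> = (\<Sum>i\<in>UNIV. ln (w - \<delta> i) - ln lam - ln (d i))"
      using wd d0 lam0 by (intro sum.cong) (auto simp: ln_div ln_mult less_imp_neq[symmetric])
    finally have e: "ln (\<Prod>i\<in>UNIV. (w - \<delta> i) / (lam * d i)) = Lw - n * ln lam - LD"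
      by (simp add: sum_subtractf Lw_def LD_def n_def)
    have pp: "0 < (\<Prod>i\<in>UNIV. (w - \<delta> i) / (lam * d i))" using wd d0 lam0 by (intro prod_pos) auto
    show ?thesis unfolding d2 lnv(1)[OF pp] e by simp
  qed
  have lr: "ln r = ln ma + ln mb + Ld + (\<tau> * LD - (ln dA + ln dB)) / 2"
    unfolding r_def using p pos
    by (simp add: ln_mult ln_sqrt ln_div ln_powr l\<delta> ld nz)
  have lm: "ln m = n * s / (2 * w + s) * (ln s / 2) + 1 / (\<tau> + 1) * ln r - q / (2 * (\<tau> + 1))
      - (Ld + Lw - n * ln lam) / 2"
    unfolding m r_def[symmetric] using s r p
    by (simp add: ln_mult ln_div ln_powr ln_sqrt lc n_def nz)
  define D where "D = s + 2 * w"
  have D: "D \<noteq> 0" using s w by (simp add: D_def)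
  have t1: "\<tau> + 1 = D / lam" using lam0 by (simp add: D_def \<tau> lam field_simps)
  have tl: "\<tau> * lam = w" using lam0 by (simp add: \<tau>)
  have "ln m = n * s / D * (ln s / 2) + lam / D * ln r - lam * q / (2 * D) - (Ld + Lw - n * ln lam) / 2"
    unfolding lm t1 by (simp add: D_def add.commute)
  then have M: "D * ln m = n * s * (ln s / 2) + lam * ln r - lam * q / 2 - D * (Ld + Lw - n * ln lam) / 2"
    using D by (simp add: distrib_left right_diff_distrib)
  have R: "lam * ln r = lam * (ln ma + ln mb + Ld) + (w * LD - lam * (ln dA + ln dB)) / 2"
    unfolding lr tl[symmetric] by (simp add: field_simps)
  have "lam * q + 2 * s * (ln m - ln ma - ln mb + (ln dA + ln dB + ln d1 + ln dS) / 2)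
      + 2 * w * (ln m - ln ma + (ln dA + ln d1) / 2)
      + 2 * w * (ln m - ln mb + (ln dB + ln d2) / 2)
     = lam * q + 2 * (D * ln m) - 2 * lam * (ln ma + ln mb) + lam * (ln dA + ln dB)
      + s * (ln d1 + ln dS) + w * (ln d1 + ln d2)"
    by (simp add: lam D_def field_simps)
  also have "\<dots> = 0" unfolding M R lS l1 l2 by (simp add: lam D_def field_simps)
  finally show "lam * q + 2 * s * (ln m - ln ma - ln mb + (ln dA + ln dB + ln d1 + ln dS) / 2)
      + 2 * w * (ln m - ln ma + (ln dA + ln d1) / 2)
      + 2 * w * (ln m - ln mb + (ln dB + ln d2) / 2) = 0" .
qed

lemma scaled_gaussian_density_exp:
  fixes x :: "real^'n"
  assumes "0 < m" "sym_pos_def A"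
  shows "m * gaussian_density a A x =
    exp (ln m - (real CARD('n) * ln (2 * pi) + ln (det A)) / 2
      - ((x - a) \<bullet> (matrix_inv A *v (x - a))) / 2)"
proof -
  have N: "0 < sqrt ((2 * pi) ^ CARD('n) * det A)"
    using sym_pos_def_inverse(4)[OF assms(2)] by simp
  have "ln (sqrt ((2 * pi) ^ CARD('n) * det A)) = (real CARD('n) * ln (2 * pi) + ln (det A)) / 2"
    using sym_pos_def_inverse(4)[OF assms(2)]
    by (subst ln_sqrt) (simp_all add: ln_mult ln_realpow algebra_simps)
  then have E: "exp (ln m - (real CARD('n) * ln (2 * pi) + ln (det A)) / 2) = m / sqrt ((2 * pi) ^ CARD('n) * det A)"
    using assms(1) N by (metis exp_diff exp_ln)
  have "m * gaussian_density a A x =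
      m / sqrt ((2 * pi) ^ CARD('n) * det A) * exp (- ((x - a) \<bullet> (matrix_inv A *v (x - a))) / 2)"
    by (simp add: gaussian_density_def)
  then show ?thesis unfolding E[symmetric] exp_add[symmetric] by simp
qed

section \<open>Optimality of the Gaussian plan\<close>

theorem theorem3:
  fixes \<sigma> \<gamma> m\<^sub>\<alpha> m\<^sub>\<beta> \<tau> lam m\<^sub>\<pi> :: real
    and a b :: "real^'n"
    and A B X At Bt C :: "real^'n^'n"
    and \<mu> :: "real^('n + 'n)"
    and H :: "real^('n + 'n)^('n + 'n)"
    and \<alpha> \<beta> :: "(real^'n) measure"
  assumes "\<sigma> > 0" "\<gamma> > 0" "m\<^sub>\<alpha> > 0" "m\<^sub>\<beta> > 0"
    and "sym_pos_def A" "sym_pos_def B"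
    and "\<alpha> = scale_measure (ennreal m\<^sub>\<alpha>) (gaussian a A)"
    and "\<beta> = scale_measure (ennreal m\<^sub>\<beta>) (gaussian b B)"
    and "\<tau> = \<gamma> / (2 * \<sigma>\<^sup>2 + \<gamma>)"
    and "lam = \<sigma>\<^sup>2 / (1 - \<tau>)"
    and "X = A + B + lam *\<^sub>R mat 1"
    and "At = (\<gamma> / 2) *\<^sub>R (mat 1 - lam *\<^sub>R matrix_inv (A + lam *\<^sub>R mat 1))"
    and "Bt = (\<gamma> / 2) *\<^sub>R (mat 1 - lam *\<^sub>R matrix_inv (B + lam *\<^sub>R mat 1))"
    and "C = principal_sqrt ((1 / \<tau>) *\<^sub>R (At ** Bt) + (\<sigma> ^ 4 / 4) *\<^sub>R mat 1)
             - (\<sigma>\<^sup>2 / 2) *\<^sub>R mat 1"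
    and "\<mu> = block_vec (a + (A ** matrix_inv X) *v (b - a))
                       (b + (B ** matrix_inv X) *v (a - b))"
    and "H = block_mat
               ((mat 1 + (1 / lam) *\<^sub>R C) ** (A - A ** matrix_inv X ** A))
               (C + (mat 1 + (1 / lam) *\<^sub>R C) ** A ** matrix_inv X ** B)
               (transpose C + (mat 1 + (1 / lam) *\<^sub>R transpose C) ** B ** matrix_inv X ** A)
               ((mat 1 + (1 / lam) *\<^sub>R transpose C) ** (B - B ** matrix_inv X ** B))"
    and "m\<^sub>\<pi> = \<sigma> powr (real CARD('n) * \<sigma>\<^sup>2 / (\<gamma> + \<sigma>\<^sup>2))
               * (m\<^sub>\<alpha> * m\<^sub>\<beta> * det C * sqrt (det (At ** Bt) powr \<tau> / det (A ** B)))
                   powr (1 / (\<tau> + 1))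
               * (exp (- ((a - b) \<bullet> (matrix_inv X *v (a - b))) / (2 * (\<tau> + 1)))
                  / sqrt (det (C - (2 / \<gamma>) *\<^sub>R (At ** Bt))))"
  shows "lam = \<sigma>\<^sup>2 + \<gamma> / 2
    \<and> (m\<^sub>\<pi> > 0 \<and> sym_pos_def H
         \<and> UOT_plans \<sigma> \<gamma> \<alpha> \<beta> = {scale_measure (ennreal m\<^sub>\<pi>) (gaussian_pair \<mu> H)})
    \<and> enn2ereal (UOT \<sigma> \<gamma> \<alpha> \<beta>)
         = ereal (\<gamma> * (m\<^sub>\<alpha> + m\<^sub>\<beta>) + 2 * \<sigma>\<^sup>2 * m\<^sub>\<alpha> * m\<^sub>\<beta> - 2 * (\<sigma>\<^sup>2 + \<gamma>) * m\<^sub>\<pi>)"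
proof -
  note A = assms(5) and B = assms(6)
  define s w where "s = \<sigma>\<^sup>2" and "w = \<gamma> / 2"
  have s: "0 < s" and w: "0 < w" using assms by (auto simp: s_def w_def)
  have \<gamma>: "\<gamma> = 2 * w" by (simp add: w_def)
  have \<tau>1: "\<tau> = w / (s + w)" using s w by (simp add: assms(9) s_def[symmetric] \<gamma> field_simps)
  have "1 - \<tau> = s / (s + w)" unfolding \<tau>1 using s w by (simp add: field_simps)
  then have lam: "lam = s + w" using s w by (simp add: assms(10) s_def[symmetric])
  have \<tau>: "\<tau> = w / lam" by (simp add: \<tau>1 lam)
  have lam0: "0 < lam" using s w lam by simp
  have At: "At = w *\<^sub>R (mat 1 - lam *\<^sub>R matrix_inv (A + lam *\<^sub>R mat 1))"
    and Bt: "Bt = w *\<^sub>R (mat 1 - lam *\<^sub>R matrix_inv (B + lam *\<^sub>R mat 1))"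
    using assms(12,13) by (simp_all add: w_def)
  have C: "C = principal_sqrt ((1 / \<tau>) *\<^sub>R (At ** Bt) + (s\<^sup>2 / 4) *\<^sub>R mat 1) - (s / 2) *\<^sub>R mat 1"
    using assms(14) by (simp add: s_def)
  obtain P S L1 L2 :: "real^'n^'n" and \<delta> d :: "'n \<Rightarrow> real" and v :: real
    where pd: "sym_pos_def P" "sym_pos_def S" "sym_pos_def L1" "sym_pos_def L2"
      and L: "L1 = P - (1 / s)\<^sup>2 *\<^sub>R matrix_inv S" "L2 = S - (1 / s)\<^sup>2 *\<^sub>R matrix_inv P"
      and HK: "H ** block_mat P (- (1 / s) *\<^sub>R mat 1) (- (1 / s) *\<^sub>R mat 1) S = mat 1"
      and PL: "lam *\<^sub>R matrix_inv A + mat 1 = s *\<^sub>R P + w *\<^sub>R L1"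
        "lam *\<^sub>R matrix_inv B + mat 1 = s *\<^sub>R S + w *\<^sub>R L2"
      and \<delta>: "\<And>i. 0 < \<delta> i" "\<And>i. \<delta> i < w" "\<And>i. d i = \<tau> * \<delta> i * (\<delta> i + s)" and v: "v \<noteq> 0"
      and dets: "det C = (\<Prod>i\<in>UNIV. \<delta> i)" "det (At ** Bt) = (\<Prod>i\<in>UNIV. d i)"
        "det (C - (1 / w) *\<^sub>R (At ** Bt)) = (\<Prod>i\<in>UNIV. \<delta> i * (w - \<delta> i) / lam)"
      and dS: "det S = v\<^sup>2 * (\<Prod>i\<in>UNIV. 1 / (s * \<delta> i))"
      and d1: "det L1 = (1 / v\<^sup>2) * (\<Prod>i\<in>UNIV. (w - \<delta> i) / lam)"
      and d2: "det L2 = v\<^sup>2 * (\<Prod>i\<in>UNIV. (w - \<delta> i) / (lam * d i))"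
    by (rule plan_precision[OF s w lam \<tau> A B assms(11) At Bt C assms(16)]) (rule that)
  define q where "q = (a - b) \<bullet> (matrix_inv X *v (a - b))"
  have mass: "m\<^sub>\<pi> = sqrt s powr (real CARD('n) * s / (2 * w + s))
       * (m\<^sub>\<alpha> * m\<^sub>\<beta> * (\<Prod>i\<in>UNIV. \<delta> i) * sqrt ((\<Prod>i\<in>UNIV. d i) powr \<tau> / (det A * det B))) powr (1 / (\<tau> + 1))
       * (exp (- q / (2 * (\<tau> + 1))) / sqrt (\<Prod>i\<in>UNIV. \<delta> i * (w - \<delta> i) / lam))"
  proof -
    have "sqrt s = \<sigma>" using assms(1) by (simp add: s_def)
    moreover have "det (C - (2 / \<gamma>) *\<^sub>R (At ** Bt)) = (\<Prod>i\<in>UNIV. \<delta> i * (w - \<delta> i) / lam)"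
      using dets(3) by (simp add: \<gamma>)
    ultimately show ?thesis
      unfolding assms(17) dets det_mul[of A B] q_def by (simp only: \<gamma> s_def)
  qed
  note lmi = log_mass_identity[OF s w lam \<tau> \<delta> assms(3,4) sym_pos_def_inverse(4)[OF A]
      sym_pos_def_inverse(4)[OF B] v mass dS d1 d2]
  have m0: "0 < m\<^sub>\<pi>" by (rule lmi(1))
  define a' b' where "a' = a + (A ** matrix_inv X) *v (b - a)" and "b' = b + (B ** matrix_inv X) *v (a - b)"
  have \<mu>: "\<mu> = block_vec a' b'" by (simp add: assms(15) a'_def b'_def)
  note gp = gaussian_pair_precision[OF pd(1,2,3) L(1) pd(4) L(2) HK]
  have Hp: "sym_pos_def H" by (rule gp(1))
  define \<pi> where "\<pi> = scale_measure (ennreal m\<^sub>\<pi>) (gaussian_pair \<mu> H)"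
  note sgp = scaled_gaussian_pair[OF Hp less_imp_le[OF m0], of \<mu>, folded \<pi>_def]
  \<comment> \<open>\<open>f\<close> and \<open>g\<close> are the logarithms of the densities of the marginals of the plan with respect to
    \<open>\<alpha>\<close> and \<open>\<beta>\<close>; \<open>c1\<close> and \<open>c2\<close> are their constant terms.\<close>
  define c1 where "c1 = ln m\<^sub>\<pi> - ln m\<^sub>\<alpha> + (ln (det A) + ln (det L1)) / 2"
  define c2 where "c2 = ln m\<^sub>\<pi> - ln m\<^sub>\<beta> + (ln (det B) + ln (det L2)) / 2"
  define f where "f x = c1 + ((x - a) \<bullet> (matrix_inv A *v (x - a)) - (x - a') \<bullet> (L1 *v (x - a'))) / 2" for x
  define g where "g x = c2 + ((x - b) \<bullet> (matrix_inv B *v (x - b)) - (x - b') \<bullet> (L2 *v (x - b'))) / 2" for x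
  have L1i: "matrix_inv (matrix_inv L1) = L1" "matrix_inv (matrix_inv L2) = L2"
    using sym_pos_def_inverse(2)[OF pd(3)] sym_pos_def_inverse(2)[OF pd(4)] by (auto intro: matrix_inv_eqI)
  have lnL: "ln (det (matrix_inv L1)) = - ln (det L1)" "ln (det (matrix_inv L2)) = - ln (det L2)"
    using sym_pos_def_inverse(4)[OF pd(3)] sym_pos_def_inverse(4)[OF pd(4)]
    by (simp_all add: det_matrix_inv_sym_pos_def pd ln_div)
  have \<alpha>d: "\<alpha> = density lborel (\<lambda>x. ennreal (m\<^sub>\<alpha> * gaussian_density a A x))"
    unfolding assms(7) using A assms(3) by (intro scaled_gaussian_eq_density) auto
  have \<beta>d: "\<beta> = density lborel (\<lambda>x. ennreal (m\<^sub>\<beta> * gaussian_density b B x))"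
    unfolding assms(8) using B assms(4) by (intro scaled_gaussian_eq_density) auto
  have fm[measurable]: "f \<in> borel_measurable borel" and gm[measurable]: "g \<in> borel_measurable borel"
    unfolding f_def g_def by measurable
  have finA: "finite_measure \<alpha>" and finB: "finite_measure \<beta>"
    and mA: "measure \<alpha> UNIV = m\<^sub>\<alpha>" and mB: "measure \<beta> UNIV = m\<^sub>\<beta>"
    unfolding assms(7,8)
    using scaled_gaussian_mass(2,3)[OF A less_imp_le[OF assms(3)], of a]
      scaled_gaussian_mass(2,3)[OF B less_imp_le[OF assms(4)], of b]
    by (simp_all only:)
  have sA: "sets \<alpha> = sets borel" and sB: "sets \<beta> = sets borel" by (simp_all add: \<alpha>d \<beta>d)
  have fst_snd: "fst \<in> gaussian_pair \<mu> H \<rightarrow>\<^sub>M (borel :: (real^'n) measure)"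
    "snd \<in> gaussian_pair \<mu> H \<rightarrow>\<^sub>M (borel :: (real^'n) measure)"
    unfolding gaussian_pair_def by (auto intro!: borel_measurable_continuous_onI continuous_intros)
  have \<pi>1: "distr \<pi> borel fst = density \<alpha> (\<lambda>x. ennreal (exp (f x)))"
  proof -
    have "distr \<pi> borel fst = scale_measure (ennreal m\<^sub>\<pi>) (gaussian a' (matrix_inv L1))"
      unfolding \<pi>_def by (simp add: distr_scale_measure fst_snd gp(4)[of a' b', folded \<mu>])
    also have "\<dots> = density lborel (\<lambda>x. ennreal (m\<^sub>\<pi> * gaussian_density a' (matrix_inv L1) x))"
      using sym_pos_def_inverse(3)[OF pd(3)] m0 by (intro scaled_gaussian_eq_density) auto
    also have "\<dots> = density lborel (\<lambda>x. ennreal (m\<^sub>\<alpha> * gaussian_density a A x) * ennreal (exp (f x)))"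
    proof -
      have "m\<^sub>\<pi> * gaussian_density a' (matrix_inv L1) x = m\<^sub>\<alpha> * gaussian_density a A x * exp (f x)" for x
        unfolding scaled_gaussian_density_exp[OF m0 sym_pos_def_inverse(3)[OF pd(3)]]
          scaled_gaussian_density_exp[OF assms(3) A] exp_add[symmetric] lnL L1i f_def c1_def
        by (simp add: field_simps)
      then show ?thesis
        using assms(3) gaussian_density_pos[OF A, THEN less_imp_le] by (simp add: ennreal_mult)
    qed
    also have "\<dots> = density \<alpha> (\<lambda>x. ennreal (exp (f x)))"
      unfolding \<alpha>d by (subst density_density_eq) auto
    finally show ?thesis .
  qed
  have \<pi>2: "distr \<pi> borel snd = density \<beta> (\<lambda>x. ennreal (exp (g x)))"
  proof -
    have "distr \<pi> borel snd = scale_measure (ennreal m\<^sub>\<pi>) (gaussian b' (matrix_inv L2))"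
      unfolding \<pi>_def by (simp add: distr_scale_measure fst_snd gp(5)[of a' b', folded \<mu>])
    also have "\<dots> = density lborel (\<lambda>x. ennreal (m\<^sub>\<pi> * gaussian_density b' (matrix_inv L2) x))"
      using sym_pos_def_inverse(3)[OF pd(4)] m0 by (intro scaled_gaussian_eq_density) auto
    also have "\<dots> = density lborel (\<lambda>x. ennreal (m\<^sub>\<beta> * gaussian_density b B x) * ennreal (exp (g x)))"
    proof -
      have "m\<^sub>\<pi> * gaussian_density b' (matrix_inv L2) x = m\<^sub>\<beta> * gaussian_density b B x * exp (g x)" for x
        unfolding scaled_gaussian_density_exp[OF m0 sym_pos_def_inverse(3)[OF pd(4)]]
          scaled_gaussian_density_exp[OF assms(4) B] exp_add[symmetric] lnL L1i g_def c2_def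
        by (simp add: field_simps)
      then show ?thesis
        using assms(4) gaussian_density_pos[OF B, THEN less_imp_le] by (simp add: ennreal_mult)
    qed
    also have "\<dots> = density \<beta> (\<lambda>x. ennreal (exp (g x)))"
      unfolding \<beta>d by (subst density_density_eq) auto
    finally show ?thesis .
  qed
  define l where "l p = - ((norm (fst p - snd p))\<^sup>2 + \<gamma> * f (fst p) + \<gamma> * g (snd p)) / (2 * \<sigma>\<^sup>2)" for p
  have key: "m\<^sub>\<pi> * gaussian_density \<mu> H (block_vec x y) =
      (m\<^sub>\<alpha> * gaussian_density a A x) * (m\<^sub>\<beta> * gaussian_density b B y) * exp (l (x, y))" for x y
  proof -
    \<comment> \<open>After taking logarithms this is the pointwise optimality equation.\<close>
    define Q where "Q = (x - a') \<bullet> (P *v (x - a')) - 2 * (1 / s) * ((x - a') \<bullet> (y - b')) + (y - b') \<bullet> (S *v (y - b'))"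
    define Q1 where "Q1 = (x - a') \<bullet> (L1 *v (x - a'))"
    define Q2 where "Q2 = (y - b') \<bullet> (L2 *v (y - b'))"
    define QA where "QA = (x - a) \<bullet> (matrix_inv A *v (x - a))"
    define QB where "QB = (y - b) \<bullet> (matrix_inv B *v (y - b))"
    have id: "(norm (x - y))\<^sup>2 - s * Q + lam * (QA + QB) - w * (Q1 + Q2) = lam * q"
      unfolding Q_def Q1_def Q2_def QA_def QB_def q_def
      by (rule plan_quadratic_identity[OF A B less_imp_neq[OF s, symmetric] lam0 assms(11) PL])
        (simp_all add: a'_def b'_def)
    have dH: "ln (det H) = - ln (det L1) - ln (det S)"
    proof -
      have "ln (det H * det L1 * det S) = 0" by (simp add: gp(3))
      then show ?thesis
        using sym_pos_def_inverse(4)[OF Hp] sym_pos_def_inverse(4)[OF pd(3)] sym_pos_def_inverse(4)[OF pd(2)]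
        by (simp add: ln_mult)
    qed
    have QH: "(block_vec x y - \<mu>) \<bullet> (matrix_inv H *v (block_vec x y - \<mu>)) = Q"
      unfolding \<mu> Q_def by (rule gp(2))
    have "l (x, y) = ln m\<^sub>\<pi> - (real CARD('n + 'n) * ln (2 * pi) + ln (det H)) / 2 - Q / 2
       - (ln m\<^sub>\<alpha> - (real CARD('n) * ln (2 * pi) + ln (det A)) / 2 - QA / 2)
       - (ln m\<^sub>\<beta> - (real CARD('n) * ln (2 * pi) + ln (det B)) / 2 - QB / 2)"
    proof -
      have fx: "f x = c1 + (QA - Q1) / 2" "g y = c2 + (QB - Q2) / 2"
        by (simp_all add: f_def g_def QA_def QB_def Q1_def Q2_def)
      have "2 * s * l (x, y) = - ((norm (x - y))\<^sup>2 + 2 * w * f x + 2 * w * g y)"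
        using s by (simp add: l_def s_def[symmetric] \<gamma>)
      also have "\<dots> = - (lam * q + s * Q - lam * (QA + QB) + w * (QA + QB) + 2 * w * c1 + 2 * w * c2)"
        unfolding fx using id by (simp add: field_simps)
      also have "\<dots> = 2 * s * (ln m\<^sub>\<pi> - ln m\<^sub>\<alpha> - ln m\<^sub>\<beta> + (ln (det A) + ln (det B) + ln (det L1) + ln (det S)) / 2
          - Q / 2 + (QA + QB) / 2)"
        using lmi(2) by (simp add: c1_def c2_def lam field_simps)
      finally have "l (x, y) = ln m\<^sub>\<pi> - ln m\<^sub>\<alpha> - ln m\<^sub>\<beta> + (ln (det A) + ln (det B) + ln (det L1) + ln (det S)) / 2
          - Q / 2 + (QA + QB) / 2"
        using s by simp
      then show ?thesis by (simp add: dH field_simps)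
    qed
    then show ?thesis
      unfolding scaled_gaussian_density_exp[OF m0 Hp] scaled_gaussian_density_exp[OF assms(3) A]
        scaled_gaussian_density_exp[OF assms(4) B] QH QA_def[symmetric] QB_def[symmetric]
        exp_add[symmetric] by simp
  qed
  have \<pi>_eq: "\<pi> = density (\<alpha> \<Otimes>\<^sub>M \<beta>) (\<lambda>p. ennreal (exp (l p)))"
  proof -
    have sfB: "sigma_finite_measure \<beta>" using finB by (simp add: finite_measure.axioms(1) finite_measure_def)
    have ab: "\<alpha> \<Otimes>\<^sub>M \<beta> = density lborel (\<lambda>(x, y). ennreal (m\<^sub>\<alpha> * gaussian_density a A x) * ennreal (m\<^sub>\<beta> * gaussian_density b B y))"
      unfolding \<alpha>d \<beta>d lborel_prod[symmetric]
      using sfB by (intro pair_measure_density) (auto simp: \<beta>d sigma_finite_lborel)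
    have [measurable]: "l \<in> borel_measurable (lborel \<Otimes>\<^sub>M lborel)"
      unfolding l_def by measurable
    have "density (\<alpha> \<Otimes>\<^sub>M \<beta>) (\<lambda>p. ennreal (exp (l p))) =
        density lborel (\<lambda>p. (case p of (x, y) \<Rightarrow> ennreal (m\<^sub>\<alpha> * gaussian_density a A x) * ennreal (m\<^sub>\<beta> * gaussian_density b B y)) * ennreal (exp (l p)))"
      unfolding ab lborel_prod[symmetric] by (subst density_density_eq) auto
    also have "\<dots> = density lborel (\<lambda>p. ennreal (m\<^sub>\<pi> * gaussian_density \<mu> H (block_vec (fst p) (snd p))))"
    proof (rule arg_cong[of _ _ "density lborel"], rule ext)
      fix p :: "(real^'n) \<times> (real^'n)"
      obtain x y where p: "p = (x, y)" by (cases p)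
      have "0 \<le> m\<^sub>\<alpha> * gaussian_density a A x" "0 \<le> m\<^sub>\<beta> * gaussian_density b B y"
        using assms(3,4) gaussian_density_pos[OF A, of a x] gaussian_density_pos[OF B, of b y] by simp_all
      then show "(case p of (x, y) \<Rightarrow> ennreal (m\<^sub>\<alpha> * gaussian_density a A x) * ennreal (m\<^sub>\<beta> * gaussian_density b B y)) * ennreal (exp (l p))
          = ennreal (m\<^sub>\<pi> * gaussian_density \<mu> H (block_vec (fst p) (snd p)))"
        unfolding p fst_conv snd_conv key prod.case by (simp only: ennreal_mult mult_nonneg_nonneg exp_ge_zero)
    qed
    finally show ?thesis using sgp(3) by simp
  qed
  obtain KA where KA: "0 \<le> KA" "\<And>x. \<bar>(x - a) \<bullet> (matrix_inv A *v (x - a))\<bar> \<le> KA * (1 + (norm x)\<^sup>2)"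
    using quadratic_growth[of a "matrix_inv A"] by blast
  obtain KB where KB: "0 \<le> KB" "\<And>x. \<bar>(x - b) \<bullet> (matrix_inv B *v (x - b))\<bar> \<le> KB * (1 + (norm x)\<^sup>2)"
    using quadratic_growth[of b "matrix_inv B"] by blast
  obtain K1 where K1: "0 \<le> K1" "\<And>x. \<bar>(x - a') \<bullet> (L1 *v (x - a'))\<bar> \<le> K1 * (1 + (norm x)\<^sup>2)"
    using quadratic_growth[of a' L1] by blast
  obtain K2 where K2: "0 \<le> K2" "\<And>x. \<bar>(x - b') \<bullet> (L2 *v (x - b'))\<bar> \<le> K2 * (1 + (norm x)\<^sup>2)"
    using quadratic_growth[of b' L2] by blast
  define K where "K = \<bar>c1\<bar> + \<bar>c2\<bar> + KA + KB + K1 + K2"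
  have growth: "\<bar>c + (p - r) / 2\<bar> \<le> K * t"
    if "\<bar>p\<bar> \<le> k1 * t" "\<bar>r\<bar> \<le> k2 * t" "0 \<le> k1" "0 \<le> k2" "1 \<le> t" "\<bar>c\<bar> + k1 + k2 \<le> K" for c p r t k1 k2 :: real
  proof -
    have "\<bar>c + (p - r) / 2\<bar> \<le> \<bar>c\<bar> + \<bar>p\<bar> + \<bar>r\<bar>"
    proof -
      have "\<bar>(p - r) / 2\<bar> = \<bar>p - r\<bar> / 2" by (simp add: abs_divide)
      then show ?thesis
        using abs_triangle_ineq[of c "(p - r) / 2"] abs_triangle_ineq4[of p r] abs_ge_zero[of "p - r"] by linarith
    qed
    also have "\<dots> \<le> \<bar>c\<bar> * t + k1 * t + k2 * t"
      using that mult_left_mono[of 1 t "\<bar>c\<bar>"] by simp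
    also have "\<dots> = (\<bar>c\<bar> + k1 + k2) * t" by (simp add: algebra_simps)
    also have "\<dots> \<le> K * t" using that by (intro mult_right_mono) auto
    finally show ?thesis .
  qed
  have fK: "\<bar>f x\<bar> \<le> K * (1 + (norm x)\<^sup>2)" for x
    unfolding f_def using KA K1 KB(1) K2(1) by (intro growth[OF KA(2) K1(2)]) (auto simp: K_def)
  have gK: "\<bar>g x\<bar> \<le> K * (1 + (norm x)\<^sup>2)" for x
    unfolding g_def using KA K1 KB K2 by (intro growth[OF KB(2) K2(2)]) (auto simp: K_def)
  note opt = UOT_optimality[OF assms(1,2) finA finB sA sB fm gm fK gK sgp(1) \<pi>_eq[unfolded l_def] \<pi>1 \<pi>2]
  have "UOT \<sigma> \<gamma> \<alpha> \<beta> = ennreal (\<gamma> * (m\<^sub>\<alpha> + m\<^sub>\<beta>) + 2 * \<sigma>\<^sup>2 * m\<^sub>\<alpha> * m\<^sub>\<beta> - 2 * (\<sigma>\<^sup>2 + \<gamma>) * m\<^sub>\<pi>)"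
    and "0 \<le> \<gamma> * (m\<^sub>\<alpha> + m\<^sub>\<beta>) + 2 * \<sigma>\<^sup>2 * m\<^sub>\<alpha> * m\<^sub>\<beta> - 2 * (\<sigma>\<^sup>2 + \<gamma>) * m\<^sub>\<pi>"
    using opt(2,3) by (simp_all add: mA mB sgp(2) mult.assoc)
  then show ?thesis
    using opt(1) m0 Hp by (simp add: lam s_def w_def \<pi>_def enn2ereal_ennreal)
qed

end
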